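(* Let $(M,\omega,g,J,\Omega_\gamma)$ be a toric almost Calabi--Yau manifold of real dimension $2m$ with moment map $\mu$, moment polytope $\Delta$ and real form $M^\sigma$. Let $0\le n\le m$, let $\zeta=\{\zeta_1,\dots,\zeta_n\}\subset\mathbb{Z}^m$ be linearly independent, and let $c=\{c_1,\dots,c_n\}\subset\mathbb{R}$. Put $V_\zeta:=\mathrm{Span}_{\mathbb{R}}\{\zeta_1,\dots,\zeta_n\}$, and assume that the affine plane $\bigcap_{i=1}^n\{y\mid\langle y,\zeta_i\rangle=c_i\}$ meets the interior of $\Delta$, and that every point $y\in\Delta$ with $\langle y,\zeta_i\rangle=c_i$ ($i=1,\dots,n$) is $\zeta$-regular. Assume that $$M^\sigma_{\zeta,c}:=\{p\in M^\sigma\mid\langle\mu(p),\zeta_i\rangle=c_i,\ i=1,\dots,n\}$$ is a real $(m-n)$-dimensional submanifold of $M^\sigma$ and that $T_\zeta:=V_\zeta/(V_\zeta\cap\mathbb{Z}^m)$ is isomorphic to a subtorus $T^n$ of $T^m$. Put $L_{\zeta,c}:=M^\sigma_{\zeta,c}\times T_\zeta$ and define $F_{\zeta,c}:L_{\zeta,c}\to M$ by $F_{\zeta,c}(p,[v]):=\exp(v)\cdot p$. Then $F_{\zeta,c}:L_{\zeta,c}\to M$ is a Lagrangian immersion, its Lagrangian angle $\theta_{\zeta,c}:L_{\zeta,c}\to\mathbb{R}/\pi\mathbb{Z}$ is given by $$\theta_{\zeta,c}(p,[v])=2\pi\langle\gamma,v\rangle+\frac{\pi}{2}n\pmod{\pi},$$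 and $F_{\zeta,c}:L_{\zeta,c}\to M$ is a $T^n$-invariant weighted Hamiltonian stationary Lagrangian submanifold.
   Context: **Toric Kähler manifold.** $T^m\cong(S^1)^m$ is a real torus with Lie algebra $\mathfrak g\cong\mathbb{R}^m$; $\exp:\mathfrak g\to T^m$ has kernel the integral lattice $\mathbb{Z}_{\mathfrak g}\cong\mathbb{Z}^m$, i.e. $\exp(v)=(e^{2\pi i v_1},\dots,e^{2\pi i v_m})$. $(M,\omega,g,J)$ is a toric Kähler manifold of complex dimension $m$: $(M,J)$ is a smooth toric variety with fan $\Sigma$, the complexified torus $T^m_{\mathbb C}\cong(\mathbb{C}^\times)^m$ acts holomorphically with an open dense orbit, $T^m$ acts effectively preserving $\omega$, $\omega(\cdot,\cdot)=g(J\cdot,\cdot)$, and there is a moment map $\mu:M\to\mathfrak g^*$ with $d\langle\mu,v\rangle=-\omega(v_p,\cdot)$, where $v_p=\frac{d}{dt}|_{t=0}\exp(tv)\cdot p$. $\Delta:=\mu(M)$ is the moment polytope. The set of one-dimensional cones of $\Sigma$ is finite, with primitive generators $\lambda_1,\dots,\lambda_d\in\mathbb{Z}_{\mathfrak g}$; there are $\kappa_i\in\mathbb{R}$ with $\overline\Delta=\bigcap_{i=1}^d\{y\in\mathfrak g^*\mid\langle y,\lambda_i\rangle\ge\kappa_i\}$, and $\Delta$ is $\overline\Delta$ with some (possibly no) faces removed. **Real form.** $\sigma:M\to M$ is the anti-holomorphic involution determined by the fan: it satisfies $\sigma(u\cdot p)=\overline u\cdot\sigma(p)$ for $u\in T^m_{\mathbb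 C}$ and is complex conjugation on the open orbit $\cong(\mathbb{C}^\times)^m$. $M^\sigma$ is its fixed point set, a real $m$-dimensional submanifold. **Regular points.** For $y\in\Delta$ let $\mathfrak z_y:=\mathrm{Span}_{\mathbb R}\{\lambda_i\mid\langle y,\lambda_i\rangle=\kappa_i\}$. The point $y$ is $\zeta$-regular if $V_\zeta\cap\mathfrak z_y=\{0\}$. **Toric almost Calabi--Yau.** An almost Calabi--Yau manifold is a Kähler manifold with a nowhere vanishing holomorphic $(m,0)$-form $\Omega$. Here one assumes there is $\gamma=(\gamma_1,\dots,\gamma_m)\in\mathbb{Z}_{\mathfrak g}^*$ with $\langle\gamma,\lambda_i\rangle=1$ for all $i$, and $\Omega_\gamma$ is the nowhere vanishing holomorphic $(m,0)$-form on $M$ extending $e^{\gamma_1z^1+\dots+\gamma_mz^m}dz^1\wedge\dots\wedge dz^m$, where $z^j$ are the logarithmic coordinates ($e^{z^j}=w^j$) on the open orbit with coordinates $(w^1,\dots,w^m)\in(\mathbb{C}^\times)^m$. Ricci-flatness is not assumed. **Lagrangian angle.** For a Lagrangian immersion $F:L\to M$, locally $F^*\Omega=h\,dx^1\wedge\dots\wedge dx^m$ with $h$ valued in $\mathbb{C}^*$; the Lagrangian angle is $\theta_F:=\arg h\bmod\pi$, a well-defined map $L\to\mathbb{R}/\pi\mathbb{Z}$. **Weighted Hamiltonian stationary.** Let $\psi$ be the function on $M$ with $e^{2m\psi}\frac{\omega^m}{m!}=(-1)^{m(m-1)/2}(\frac i2)^m\Omega\wedge\overline\Omega$, and $f:=-mF^*\psi$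 on $L$. $F$ is weighted Hamiltonian stationary if $\Delta_f\theta_F=0$ (using local real lifts of $\theta_F$), where $\Delta_fu:=\Delta u+\langle\nabla u,\nabla f\rangle$ on $(L,F^*g)$ with $\Delta=d^*d$ (the nonnegative Laplacian), so that $\Delta_fu=\delta_f(du)$ with $\delta_f$ the formal adjoint of $d$ for the measure $e^{-f}dV_{F^*g}$. The torus $T^n$ in the conclusion is $T_\zeta$ regarded as a subtorus of $T^m$, acting on $M$. *)

theory Defs
  imports "HOL-Analysis.Analysis"
begin

section \<open>Smooth maps, charts and tensors\<close>

primrec Ck_on :: "nat \<Rightarrow> 'a::euclidean_space set \<Rightarrow> ('a \<Rightarrow> 'b::real_normed_vector) \<Rightarrow> bool" where
  "Ck_on 0 S f \<longleftrightarrow> continuous_on S f"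
| "Ck_on (Suc k) S f \<longleftrightarrow>
     f differentiable_on S \<and> (\<forall>v. Ck_on k S (\<lambda>x. frechet_derivative f (at x) v))"

text \<open>Only used for open \<open>S\<close>.\<close>
definition smooth_on :: "'a::euclidean_space set \<Rightarrow> ('a \<Rightarrow> 'b::real_normed_vector) \<Rightarrow> bool" where
  "smooth_on S f \<longleftrightarrow> (\<forall>k. Ck_on k S f)"

text \<open>A chart is a pair of its domain and its coordinate map; the model space \<open>'e\<close> is
  \<open>complex^'m\<close> for complex manifolds and \<open>real^'m\<close> for real ones. The topology of a manifold
  is the one determined by its atlas.\<close>
type_synonym ('p, 'e) chart = "'p set \<times> ('p \<Rightarrow> 'e)"

definition chart_image :: "('p, 'e) chart \<Rightarrow> 'e set" where
  "chart_image c = snd c ` fst c"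

definition chart_inv :: "('p, 'e) chart \<Rightarrow> 'e \<Rightarrow> 'p" where
  "chart_inv c = inv_into (fst c) (snd c)"

text \<open>Membership in the maximal smooth atlas containing \<open>A\<close>.\<close>
definition compatible_chart ::
  "'p set \<Rightarrow> ('p, 'e::euclidean_space) chart set \<Rightarrow> ('p, 'e) chart \<Rightarrow> bool" where
  "compatible_chart X A c \<longleftrightarrow>
     fst c \<subseteq> X \<and> inj_on (snd c) (fst c) \<and> open (chart_image c) \<and>
     (\<forall>d\<in>A. open (snd c ` (fst c \<inter> fst d)) \<and> open (snd d ` (fst c \<inter> fst d)) \<and>
        smooth_on (snd c ` (fst c \<inter> fst d)) (snd d \<circ> chart_inv c) \<and>
        smooth_on (snd d ` (fst c \<inter> fst d)) (snd c \<circ> chart_inv d))"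

definition smooth_map ::
  "('p, 'e::euclidean_space) chart set \<Rightarrow> ('q, 'f::euclidean_space) chart set \<Rightarrow> ('p \<Rightarrow> 'q) \<Rightarrow> bool"
where
  "smooth_map A B F \<longleftrightarrow> (\<forall>c\<in>A. \<forall>d\<in>B.
     open (snd c ` (fst c \<inter> F -` fst d)) \<and>
     smooth_on (snd c ` (fst c \<inter> F -` fst d)) (snd d \<circ> F \<circ> chart_inv c))"

text \<open>The differential of \<open>F\<close> at \<open>p\<close>, expressed in the charts \<open>c\<close> and \<open>d\<close>.\<close>
definition coord_deriv ::
  "('p \<Rightarrow> 'q) \<Rightarrow> ('p, 'e::euclidean_space) chart \<Rightarrow> ('q, 'f::euclidean_space) chart \<Rightarrow> 'p \<Rightarrow> 'e \<Rightarrow> 'f"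
where
  "coord_deriv F c d p = frechet_derivative (snd d \<circ> F \<circ> chart_inv c) (at (snd c p))"

text \<open>A covariant 2-tensor is given by its coordinate expressions: \<open>T c p v w\<close> is its value at the
  point \<open>p\<close> on the tangent vectors represented by \<open>v\<close> and \<open>w\<close> in the chart \<open>c\<close>.\<close>
type_synonym ('p, 'e) tensor2 = "('p, 'e) chart \<Rightarrow> 'p \<Rightarrow> 'e \<Rightarrow> 'e \<Rightarrow> real"

definition smooth_tensor2 ::
  "('p, 'e::euclidean_space) chart set \<Rightarrow> ('p, 'e) tensor2 \<Rightarrow> bool" where
  "smooth_tensor2 A T \<longleftrightarrow>
     (\<forall>c\<in>A. \<forall>p\<in>fst c. bilinear (T c p)) \<and>
     (\<forall>c\<in>A. \<forall>v w. smooth_on (chart_image c) (\<lambda>x. T c (chart_inv c x) v w)) \<and>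
     (\<forall>c\<in>A. \<forall>d\<in>A. \<forall>p\<in>fst c \<inter> fst d. \<forall>v w.
        T c p v w = T d p (coord_deriv id c d p v) (coord_deriv id c d p w))"

definition riemannian_metric ::
  "('p, 'e::euclidean_space) chart set \<Rightarrow> ('p, 'e) tensor2 \<Rightarrow> bool" where
  "riemannian_metric A g \<longleftrightarrow> smooth_tensor2 A g \<and>
     (\<forall>c\<in>A. \<forall>p\<in>fst c. (\<forall>v w. g c p v w = g c p w v) \<and> (\<forall>v. v \<noteq> 0 \<longrightarrow> g c p v v > 0))"

text \<open>Closedness: the exterior derivative evaluated on constant coordinate vector fields.\<close>
definition closed_2form ::
  "('p, 'e::euclidean_space) chart set \<Rightarrow> ('p, 'e) tensor2 \<Rightarrow> bool" where
  "closed_2form A \<omega> \<longleftrightarrow> smooth_tensor2 A \<omega> \<and>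
     (\<forall>c\<in>A. \<forall>p\<in>fst c. \<forall>v. \<omega> c p v v = 0) \<and>
     (\<forall>c\<in>A. \<forall>x\<in>chart_image c. \<forall>u v w.
        frechet_derivative (\<lambda>y. \<omega> c (chart_inv c y) v w) (at x) u +
        frechet_derivative (\<lambda>y. \<omega> c (chart_inv c y) w u) (at x) v +
        frechet_derivative (\<lambda>y. \<omega> c (chart_inv c y) u v) (at x) w = 0)"

text \<open>The pullback does not depend on the chosen chart around \<open>F p\<close> when \<open>T\<close> is a tensor on the
  target manifold with atlas \<open>B\<close>.\<close>
definition chart_at :: "('q, 'f) chart set \<Rightarrow> 'q \<Rightarrow> ('q, 'f) chart" where
  "chart_at B q = (SOME d. d \<in> B \<and> q \<in> fst d)"

definition pullback2 ::
  "('q, 'f::euclidean_space) chart set \<Rightarrow> ('p \<Rightarrow> 'q) \<Rightarrow> ('q, 'f) tensor2 \<Rightarrow>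
     ('p, 'e::euclidean_space) tensor2" where
  "pullback2 B F T c p v w =
     (let d = chart_at B (F p)
      in T d (F p) (coord_deriv F c d p v) (coord_deriv F c d p w))"

section \<open>Wedge products\<close>

text \<open>A \<open>k\<close>-form on a vector space \<open>'e\<close> is an alternating function of the entries
  \<open>X 0, \<dots>, X (k - 1)\<close> of a sequence \<open>X\<close> of vectors.\<close>
definition wedge ::
  "nat \<Rightarrow> nat \<Rightarrow> ((nat \<Rightarrow> 'e) \<Rightarrow> complex) \<Rightarrow> ((nat \<Rightarrow> 'e) \<Rightarrow> complex) \<Rightarrow> (nat \<Rightarrow> 'e) \<Rightarrow> complex" where
  "wedge k l \<alpha> \<beta> X =
     (\<Sum>\<pi> | \<pi> permutes {..<k + l}. of_int (sign \<pi>) * \<alpha> (X \<circ> \<pi>) * \<beta> (\<lambda>i. X (\<pi> (k + i))))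
     / (fact k * fact l)"

primrec wedge_power2 ::
  "((nat \<Rightarrow> 'e) \<Rightarrow> complex) \<Rightarrow> nat \<Rightarrow> (nat \<Rightarrow> 'e) \<Rightarrow> complex" where
  "wedge_power2 \<alpha> 0 = (\<lambda>X. 1)"
| "wedge_power2 \<alpha> (Suc k) = wedge 2 (2 * k) \<alpha> (wedge_power2 \<alpha> k)"

section \<open>Kaehler and almost Calabi--Yau structures\<close>

text \<open>The atlases of complex manifolds consist of holomorphic charts, in which \<open>J\<close> is
  multiplication by \<open>\<i>\<close>.\<close>
definition kahler_structure ::
  "('p, complex^'m) chart set \<Rightarrow> ('p, complex^'m) tensor2 \<Rightarrow> ('p, complex^'m) tensor2 \<Rightarrow> bool" where
  "kahler_structure A g \<omega> \<longleftrightarrow>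
     riemannian_metric A g \<and> closed_2form A \<omega> \<and>
     (\<forall>c\<in>A. \<forall>p\<in>fst c. \<forall>v w. g c p (\<i> *s v) (\<i> *s w) = g c p v w \<and>
                               \<omega> c p v w = g c p (\<i> *s v) w)"

definition holomorphic_on_vec :: "(complex^'m \<Rightarrow> complex) \<Rightarrow> (complex^'m) set \<Rightarrow> bool" where
  "holomorphic_on_vec h S \<longleftrightarrow>
     (\<forall>x\<in>S. \<exists>D. (h has_derivative D) (at x) \<and> (\<forall>v. D (\<i> *s v) = \<i> * D v))"

text \<open>An \<open>(m,0)\<close>-form takes \<open>m\<close> tangent vectors, indexed by \<open>'m\<close>; in particular
  \<open>(dz\<^sup>1 \<and> \<dots> \<and> dz\<^sup>m)(X\<^sub>1, \<dots>, X\<^sub>m)\<close> is the determinant of the matrix \<open>dz\<^sup>i(X\<^sub>j)\<close>.\<close>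
type_synonym ('p, 'm) top_form = "('p, complex^'m) chart \<Rightarrow> 'p \<Rightarrow> ('m \<Rightarrow> complex^'m) \<Rightarrow> complex"

definition dz_top :: "('m \<Rightarrow> complex^'m) \<Rightarrow> complex" where
  "dz_top X = det (\<chi> i j. X j $ i)"

definition holomorphic_volume_form ::
  "('p, complex^'m) chart set \<Rightarrow> ('p, 'm) top_form \<Rightarrow> bool" where
  "holomorphic_volume_form A \<Omega> \<longleftrightarrow>
     (\<forall>c\<in>A. \<exists>h. holomorphic_on_vec h (chart_image c) \<and> (\<forall>x\<in>chart_image c. h x \<noteq> 0) \<and>
        (\<forall>p\<in>fst c. \<forall>X. \<Omega> c p X = h (snd c p) * dz_top X)) \<and>
     (\<forall>c\<in>A. \<forall>d\<in>A. \<forall>p\<in>fst c \<inter> fst d. \<forall>X. \<Omega> c p X = \<Omega> d p (coord_deriv id c d p \<circ> X))"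

text \<open>The function \<open>\<psi>\<close> with
  \<open>e\<^bsup>2m\<psi>\<^esup> \<omega>\<^sup>m / m! = (-1)\<^bsup>m(m-1)/2\<^esup> (\<i>/2)\<^sup>m \<Omega> \<and> cnj \<Omega>\<close>.
  The index type \<open>'m\<close> is enumerated by \<open>to_nat_on UNIV\<close>; another enumeration changes \<open>\<Omega>\<close> and
  its conjugate by the same sign.\<close>
definition acy_potential ::
  "('p, complex^'m) chart set \<Rightarrow> ('p, complex^'m) tensor2 \<Rightarrow> ('p, 'm::finite) top_form \<Rightarrow> 'p \<Rightarrow> real"
where
  "acy_potential A \<omega> \<Omega> p = (THE \<psi>. \<forall>c\<in>A. p \<in> fst c \<longrightarrow>
     (let m = CARD('m);
          \<omega>p = (\<lambda>X. complex_of_real (\<omega> c p (X 0) (X 1)));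
          \<Omega>p = (\<lambda>X. \<Omega> c p (\<lambda>j. X (to_nat_on (UNIV :: 'm set) j)))
      in \<forall>X. complex_of_real (exp (2 * real m * \<psi>)) * wedge_power2 \<omega>p m X / fact m =
             (- 1) ^ (m * (m - 1) div 2) * (\<i> / 2) ^ m * wedge m m \<Omega>p (\<lambda>X. cnj (\<Omega>p X)) X))"

section \<open>Lagrangian immersions\<close>

definition lagrangian_immersion ::
  "('q, real^'m) chart set \<Rightarrow> ('p, complex^'m) chart set \<Rightarrow> ('p, complex^'m) tensor2 \<Rightarrow>
     ('q \<Rightarrow> 'p) \<Rightarrow> bool" where
  "lagrangian_immersion B A \<omega> F \<longleftrightarrow>
     smooth_map B A F \<and>
     (\<forall>c\<in>B. \<forall>d\<in>A. \<forall>q\<in>fst c. F q \<in> fst d \<longrightarrow> inj (coord_deriv F c d q)) \<and>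
     (\<forall>c\<in>B. \<forall>q\<in>fst c. \<forall>v w. pullback2 A F \<omega> c q v w = 0)"

text \<open>The coefficient \<open>h\<close> in \<open>F\<^sup>*\<Omega> = h dx\<^sup>1 \<and> \<dots> \<and> dx\<^sup>m\<close> for the coordinates of the chart \<open>c\<close>.\<close>
definition pullback_coeff ::
  "('p, complex^'m) chart set \<Rightarrow> ('p, 'm) top_form \<Rightarrow> ('q \<Rightarrow> 'p) \<Rightarrow> ('q, real^'m) chart \<Rightarrow> 'q \<Rightarrow> complex"
where
  "pullback_coeff A \<Omega> F c q =
     (let d = chart_at A (F q) in \<Omega> d (F q) (\<lambda>j. coord_deriv F c d q (axis j 1)))"

text \<open>Elements of \<open>\<real>/\<pi>\<int>\<close> are cosets.\<close>
definition mod_pi :: "real \<Rightarrow> real set" where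
  "mod_pi t = {t + pi * of_int k | k. True}"

text \<open>Charts of \<open>L\<close> change \<open>h\<close> by a nonzero real factor, so for a Lagrangian immersion the union
  over all charts around \<open>q\<close> is a single element of \<open>\<real>/\<pi>\<int>\<close>.\<close>
definition lagrangian_angle ::
  "('q, real^'m) chart set \<Rightarrow> ('p, complex^'m) chart set \<Rightarrow> ('p, 'm) top_form \<Rightarrow>
     ('q \<Rightarrow> 'p) \<Rightarrow> 'q \<Rightarrow> real set" where
  "lagrangian_angle B A \<Omega> F q =
     \<Union>{mod_pi (Arg (pullback_coeff A \<Omega> F c q)) | c.
          c \<in> B \<and> q \<in> fst c \<and> pullback_coeff A \<Omega> F c q \<noteq> 0}"

section \<open>The weighted Laplacian in coordinates\<close>

definition partial_deriv :: "(real^'m \<Rightarrow> real) \<Rightarrow> real^'m \<Rightarrow> 'm \<Rightarrow> real" where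
  "partial_deriv u x i = deriv (\<lambda>s. u (x + s *\<^sub>R axis i 1)) 0"

text \<open>\<open>G x\<close> is the matrix of the metric at \<open>x\<close>. The codifferential on 1-forms is the formal adjoint
  of \<open>d\<close> for the measure \<open>sqrt (det G) dx\<close>.\<close>
definition codifferential ::
  "(real^'m \<Rightarrow> real^'m^'m) \<Rightarrow> (real^'m \<Rightarrow> 'm \<Rightarrow> real) \<Rightarrow> real^'m \<Rightarrow> real" where
  "codifferential G \<alpha> x =
     - (\<Sum>i\<in>UNIV. partial_deriv
          (\<lambda>y. sqrt (det (G y)) * (\<Sum>j\<in>UNIV. matrix_inv (G y) $ i $ j * \<alpha> y j)) x i)
       / sqrt (det (G x))"

definition laplacian :: "(real^'m \<Rightarrow> real^'m^'m) \<Rightarrow> (real^'m \<Rightarrow> real) \<Rightarrow> real^'m \<Rightarrow> real" where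
  "laplacian G u = codifferential G (partial_deriv u)"

definition grad_inner ::
  "(real^'m \<Rightarrow> real^'m^'m) \<Rightarrow> (real^'m \<Rightarrow> real) \<Rightarrow> (real^'m \<Rightarrow> real) \<Rightarrow> real^'m \<Rightarrow> real" where
  "grad_inner G u f x =
     (\<Sum>i\<in>UNIV. \<Sum>j\<in>UNIV. matrix_inv (G x) $ i $ j * partial_deriv u x i * partial_deriv f x j)"

definition weighted_laplacian ::
  "(real^'m \<Rightarrow> real^'m^'m) \<Rightarrow> (real^'m \<Rightarrow> real) \<Rightarrow> (real^'m \<Rightarrow> real) \<Rightarrow> real^'m \<Rightarrow> real" where
  "weighted_laplacian G f u x = laplacian G u x + grad_inner G u f x"

definition gram_matrix ::
  "('q, real^'m) tensor2 \<Rightarrow> ('q, real^'m) chart \<Rightarrow> real^'m \<Rightarrow> real^'m^'m" where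
  "gram_matrix h c x = (\<chi> i j. h c (chart_inv c x) (axis i 1) (axis j 1))"

text \<open>\<open>u\<close> is a local real lift of the Lagrangian angle; two such lifts differ by a locally
  constant function, which the Laplacian does not see.\<close>
definition weighted_hamiltonian_stationary ::
  "('q, real^'m) chart set \<Rightarrow> ('p, complex^'m) chart set \<Rightarrow> ('p, complex^'m) tensor2 \<Rightarrow>
     ('p, complex^'m) tensor2 \<Rightarrow> ('p, 'm::finite) top_form \<Rightarrow> ('q \<Rightarrow> 'p) \<Rightarrow> bool" where
  "weighted_hamiltonian_stationary B A g \<omega> \<Omega> F \<longleftrightarrow>
     (\<forall>c\<in>B. \<forall>x\<in>chart_image c. \<exists>W u.
        open W \<and> x \<in> W \<and> W \<subseteq> chart_image c \<and> smooth_on W u \<and>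
        (\<forall>y\<in>W. u y \<in> lagrangian_angle B A \<Omega> F (chart_inv c y)) \<and>
        (\<forall>y\<in>W. weighted_laplacian (gram_matrix (pullback2 A F g) c)
                 (\<lambda>z. - real CARD('m) * acy_potential A \<omega> \<Omega> (F (chart_inv c z))) u y = 0))"

section \<open>Smooth toric varieties\<close>

definition of_ivec :: "int^'m \<Rightarrow> real^'m" where
  "of_ivec a = (\<chi> i. of_int (a $ i))"

definition int_lattice :: "(real^'m) set" where
  "int_lattice = range of_ivec"

text \<open>\<open>B'\<close> is the basis of the character lattice dual to the lattice basis \<open>B\<close>.\<close>
definition dual_bases :: "('m \<Rightarrow> int^'m) \<Rightarrow> ('m \<Rightarrow> int^'m) \<Rightarrow> bool" where
  "dual_bases B B' \<longleftrightarrow> (\<forall>j k. (\<Sum>i\<in>UNIV. B' j $ i * B k $ i) = (if j = k then 1 else 0))"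

definition fan :: "(real^'m) set set \<Rightarrow> bool" where
  "fan \<Sigma> \<longleftrightarrow>
     \<Sigma> \<noteq> {} \<and>
     (\<forall>\<sigma>\<in>\<Sigma>. (\<exists>S :: (int^'m) set. finite S \<and> \<sigma> = convex_cone hull (of_ivec ` S)) \<and>
              \<sigma> \<inter> uminus ` \<sigma> = {0}) \<and>
     (\<forall>\<sigma>\<in>\<Sigma>. \<forall>\<tau>. \<tau> face_of \<sigma> \<and> \<tau> \<noteq> {} \<longrightarrow> \<tau> \<in> \<Sigma>) \<and>
     (\<forall>\<sigma>\<in>\<Sigma>. \<forall>\<tau>\<in>\<Sigma>. (\<sigma> \<inter> \<tau>) face_of \<sigma> \<and> (\<sigma> \<inter> \<tau>) face_of \<tau>)"

definition smooth_fan :: "(real^'m) set set \<Rightarrow> bool" where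
  "smooth_fan \<Sigma> \<longleftrightarrow> fan \<Sigma> \<and>
     (\<forall>\<sigma>\<in>\<Sigma>. \<exists>B B' K. dual_bases B B' \<and> \<sigma> = convex_cone hull (of_ivec ` B ` K))"

definition ray_generators :: "(real^'m) set set \<Rightarrow> (int^'m) set" where
  "ray_generators \<Sigma> =
     {a. Gcd (range (($) a)) = 1 \<and> convex_cone hull {of_ivec a} \<in> \<Sigma>}"

text \<open>The toric variety is glued from the affine pieces \<open>U\<^sub>\<sigma>\<close> of semigroup homomorphisms from
  \<open>S\<^sub>\<sigma> = dual_monoid \<sigma>\<close> to \<open>\<complex>\<close>, where \<open>U\<^sub>\<tau>\<close> for a face \<open>\<tau>\<close> of \<open>\<sigma>\<close> is included in \<open>U\<^sub>\<sigma>\<close> by restriction.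
  Every point lies in a smallest \<open>U\<^sub>\<tau>\<close>, the one for which the homomorphism is nonzero exactly on
  \<open>\<tau>\<^sup>\<bottom>\<close>; it is represented by \<open>\<tau>\<close> and this homomorphism, extended by 0 outside of \<open>S\<^sub>\<tau>\<close>. As an
  element of any larger \<open>U\<^sub>\<sigma>\<close> it is the restriction to \<open>S\<^sub>\<sigma> \<subseteq> S\<^sub>\<tau>\<close>.\<close>
type_synonym 'm tpoint = "(real^'m) set \<times> (int^'m \<Rightarrow> complex)"

definition dual_monoid :: "(real^'m) set \<Rightarrow> (int^'m) set" where
  "dual_monoid \<sigma> = {a. \<forall>v\<in>\<sigma>. of_ivec a \<bullet> v \<ge> 0}"

definition toric_variety :: "(real^'m) set set \<Rightarrow> 'm tpoint set" where
  "toric_variety \<Sigma> = {(\<tau>, \<phi>). \<tau> \<in> \<Sigma> \<and>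
     \<phi> 0 = 1 \<and> (\<forall>a\<in>dual_monoid \<tau>. \<forall>b\<in>dual_monoid \<tau>. \<phi> (a + b) = \<phi> a * \<phi> b) \<and>
     (\<forall>a. a \<notin> dual_monoid \<tau> \<longrightarrow> \<phi> a = 0) \<and>
     (\<forall>a\<in>dual_monoid \<tau>. \<phi> a \<noteq> 0 \<longleftrightarrow> (\<forall>v\<in>\<tau>. of_ivec a \<bullet> v = 0))}"

definition affine_piece :: "(real^'m) set set \<Rightarrow> (real^'m) set \<Rightarrow> 'm tpoint set" where
  "affine_piece \<Sigma> \<sigma> = {p \<in> toric_variety \<Sigma>. fst p face_of \<sigma>}"

definition toric_chart ::
  "(real^'m) set set \<Rightarrow> (real^'m) set \<Rightarrow> ('m \<Rightarrow> int^'m) \<Rightarrow> ('m tpoint, complex^'m) chart" where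
  "toric_chart \<Sigma> \<sigma> B' = (affine_piece \<Sigma> \<sigma>, \<lambda>p. \<chi> j. snd p (B' j))"

definition toric_atlas :: "(real^'m) set set \<Rightarrow> ('m tpoint, complex^'m) chart set" where
  "toric_atlas \<Sigma> = {toric_chart \<Sigma> \<sigma> B' | \<sigma> B' B K.
     \<sigma> \<in> \<Sigma> \<and> dual_bases B B' \<and> \<sigma> = convex_cone hull (of_ivec ` B ` K)}"

definition monomial :: "complex^'m \<Rightarrow> int^'m \<Rightarrow> complex" where
  "monomial w a = (\<Prod>i\<in>UNIV. (w $ i) powi (a $ i))"

text \<open>The point of the open orbit with coordinates \<open>w\<close> (all nonzero), and the chart given by these
  coordinates.\<close>
definition orbit_point :: "complex^'m \<Rightarrow> 'm tpoint" where
  "orbit_point w = ({0}, monomial w)"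

definition orbit_chart :: "(real^'m) set set \<Rightarrow> ('m tpoint, complex^'m) chart" where
  "orbit_chart \<Sigma> = toric_chart \<Sigma> {0} (\<lambda>j. axis j 1)"

definition torus_act :: "complex^'m \<Rightarrow> 'm tpoint \<Rightarrow> 'm tpoint" where
  "torus_act u p = (fst p, \<lambda>a. monomial u a * snd p a)"

definition real_torus :: "(complex^'m) set" where
  "real_torus = {u. \<forall>i. norm (u $ i) = 1}"

definition torus_exp :: "real^'m \<Rightarrow> complex^'m" where
  "torus_exp v = (\<chi> i. exp (2 * pi * \<i> * of_real (v $ i)))"

definition conjugation :: "'m tpoint \<Rightarrow> 'm tpoint" where
  "conjugation p = (fst p, \<lambda>a. cnj (snd p a))"

definition real_form :: "(real^'m) set set \<Rightarrow> 'm tpoint set" where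
  "real_form \<Sigma> = {p \<in> toric_variety \<Sigma>. conjugation p = p}"

definition real_form_atlas :: "(real^'m) set set \<Rightarrow> ('m tpoint, real^'m) chart set" where
  "real_form_atlas \<Sigma> =
     {(fst c \<inter> real_form \<Sigma>, \<lambda>p. \<chi> j. Re (snd c p $ j)) | c. c \<in> toric_atlas \<Sigma>}"

section \<open>Toric Kaehler and toric almost Calabi--Yau manifolds\<close>

text \<open>The vector field \<open>v\<^sub>p\<close> generated by \<open>v\<close>, in the chart \<open>c\<close>.\<close>
definition fundamental_vector ::
  "real^'m \<Rightarrow> ('m tpoint, complex^'m) chart \<Rightarrow> 'm tpoint \<Rightarrow> complex^'m" where
  "fundamental_vector v c p =
     vector_derivative (\<lambda>t. snd c (torus_act (torus_exp (t *\<^sub>R v)) p)) (at 0)"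

text \<open>The dual of the Lie algebra is identified with \<open>real^'m\<close> through the inner product.\<close>
definition moment_map ::
  "(real^'m) set set \<Rightarrow> ('m tpoint, complex^'m) tensor2 \<Rightarrow> ('m tpoint \<Rightarrow> real^'m) \<Rightarrow> bool" where
  "moment_map \<Sigma> \<omega> \<mu> \<longleftrightarrow> (\<forall>c\<in>toric_atlas \<Sigma>. \<forall>p\<in>fst c. \<forall>v.
     ((\<lambda>x. \<mu> (chart_inv c x) \<bullet> v) has_derivative (\<lambda>w. - \<omega> c p (fundamental_vector v c p) w))
       (at (snd c p)))"

definition moment_polytope :: "(real^'m) set set \<Rightarrow> ('m tpoint \<Rightarrow> real^'m) \<Rightarrow> (real^'m) set" where
  "moment_polytope \<Sigma> \<mu> = \<mu> ` toric_variety \<Sigma>"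

definition toric_kahler ::
  "(real^'m) set set \<Rightarrow> ('m tpoint, complex^'m) tensor2 \<Rightarrow> ('m tpoint, complex^'m) tensor2 \<Rightarrow>
     ('m tpoint \<Rightarrow> real^'m) \<Rightarrow> (int^'m \<Rightarrow> real) \<Rightarrow> bool" where
  "toric_kahler \<Sigma> \<omega> g \<mu> \<kappa> \<longleftrightarrow>
     smooth_fan \<Sigma> \<and> finite (ray_generators \<Sigma>) \<and>
     kahler_structure (toric_atlas \<Sigma>) g \<omega> \<and>
     (\<forall>u\<in>real_torus. \<forall>c\<in>toric_atlas \<Sigma>. \<forall>p\<in>fst c. \<forall>v w.
        pullback2 (toric_atlas \<Sigma>) (torus_act u) \<omega> c p v w = \<omega> c p v w) \<and>
     moment_map \<Sigma> \<omega> \<mu> \<and>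
     (let \<Delta> = moment_polytope \<Sigma> \<mu>
      in closure \<Delta> = (\<Inter>a\<in>ray_generators \<Sigma>. {y. y \<bullet> of_ivec a \<ge> \<kappa> a}) \<and>
         (\<exists>\<F>. (\<forall>T\<in>\<F>. T face_of closure \<Delta>) \<and> \<Delta> = closure \<Delta> - \<Union>\<F>))"

text \<open>\<open>\<Omega>\<close> is the extension of \<open>exp (\<gamma>\<^sub>1 z\<^sup>1 + \<dots> + \<gamma>\<^sub>m z\<^sup>m) dz\<^sup>1 \<and> \<dots> \<and> dz\<^sup>m\<close>. The tangent vector
  with components \<open>Y $ i\<close> in the logarithmic coordinates \<open>z\<close> has components \<open>exp (z $ i) * Y $ i\<close> in
  the coordinates \<open>w $ i = exp (z $ i)\<close>.\<close>
definition toric_volume_form ::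
  "(real^'m) set set \<Rightarrow> int^'m \<Rightarrow> ('m tpoint, 'm) top_form \<Rightarrow> bool" where
  "toric_volume_form \<Sigma> \<gamma> \<Omega> \<longleftrightarrow>
     holomorphic_volume_form (toric_atlas \<Sigma>) \<Omega> \<and>
     (\<forall>z Y. \<Omega> (orbit_chart \<Sigma>) (orbit_point (\<chi> i. exp (z $ i))) (\<lambda>j. \<chi> i. exp (z $ i) * Y j $ i) =
            exp (\<Sum>i\<in>UNIV. of_int (\<gamma> $ i) * z $ i) * dz_top Y)"

definition toric_almost_calabi_yau ::
  "(real^'m) set set \<Rightarrow> ('m tpoint, complex^'m) tensor2 \<Rightarrow> ('m tpoint, complex^'m) tensor2 \<Rightarrow>
     ('m tpoint \<Rightarrow> real^'m) \<Rightarrow> (int^'m \<Rightarrow> real) \<Rightarrow> int^'m \<Rightarrow> ('m tpoint, 'm) top_form \<Rightarrow> bool" where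
  "toric_almost_calabi_yau \<Sigma> \<omega> g \<mu> \<kappa> \<gamma> \<Omega> \<longleftrightarrow>
     toric_kahler \<Sigma> \<omega> g \<mu> \<kappa> \<and>
     (\<forall>a\<in>ray_generators \<Sigma>. (\<Sum>i\<in>UNIV. \<gamma> $ i * a $ i) = 1) \<and>
     toric_volume_form \<Sigma> \<gamma> \<Omega>"

section \<open>The torus-invariant Lagrangians\<close>

definition V_span :: "nat \<Rightarrow> (nat \<Rightarrow> int^'m) \<Rightarrow> (real^'m) set" where
  "V_span n \<zeta> = span ((\<lambda>i. of_ivec (\<zeta> i)) ` {..<n})"

definition regular_point ::
  "(real^'m) set set \<Rightarrow> (int^'m \<Rightarrow> real) \<Rightarrow> (real^'m) set \<Rightarrow> real^'m \<Rightarrow> bool" where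
  "regular_point \<Sigma> \<kappa> V y \<longleftrightarrow>
     V \<inter> span (of_ivec ` {a \<in> ray_generators \<Sigma>. y \<bullet> of_ivec a = \<kappa> a}) = {0}"

text \<open>\<open>T_class V v\<close> is the class of \<open>v\<close> in \<open>V / (V \<inter> \<int>\<^sup>m)\<close>.\<close>
definition T_class :: "(real^'m) set \<Rightarrow> real^'m \<Rightarrow> (real^'m) set" where
  "T_class V v = {v + l | l. l \<in> V \<inter> int_lattice}"

definition T_quot :: "(real^'m) set \<Rightarrow> (real^'m) set set" where
  "T_quot V = T_class V ` V"

text \<open>An \<open>n\<close>-dimensional subtorus is the isomorphic image of a coordinate torus.\<close>
definition subtorus :: "nat \<Rightarrow> (complex^'m) set \<Rightarrow> bool" where
  "subtorus n H \<longleftrightarrow> H \<subseteq> real_torus \<and>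
     (\<exists>(I :: 'm set) (h :: complex^'m \<Rightarrow> complex^'m).
        let C = {u \<in> real_torus. \<forall>i. i \<notin> I \<longrightarrow> u $ i = 1}
        in card I = n \<and> continuous_on C h \<and> bij_betw h C H \<and>
           (\<forall>u\<in>C. \<forall>w\<in>C. h (u * w) = h u * h w))"

text \<open>The quotient topology on \<open>T_quot V\<close> enters through the quotient map condition.\<close>
definition T_quot_iso_subtorus :: "nat \<Rightarrow> (real^'m) set \<Rightarrow> bool" where
  "T_quot_iso_subtorus n V \<longleftrightarrow> (\<exists>(H :: (complex^'m) set) \<Phi>. subtorus n H \<and>
     bij_betw \<Phi> (T_quot V) H \<and>
     (\<forall>v\<in>V. \<forall>w\<in>V. \<Phi> (T_class V (v + w)) = \<Phi> (T_class V v) * \<Phi> (T_class V w)) \<and>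
     quotient_map (top_of_set V) (top_of_set H) (\<lambda>v. \<Phi> (T_class V v)))"

text \<open>A chart of the maximal atlas in which \<open>S\<close> is the locus where the coordinates with indices
  outside of \<open>I\<close> vanish.\<close>
definition slice_chart ::
  "'p set \<Rightarrow> ('p, real^'m) chart set \<Rightarrow> 'p set \<Rightarrow> 'm set \<Rightarrow> ('p, real^'m) chart \<Rightarrow> bool" where
  "slice_chart X A S I c \<longleftrightarrow> compatible_chart X A c \<and>
     snd c ` (fst c \<inter> S) = {x \<in> chart_image c. \<forall>j. j \<notin> I \<longrightarrow> x $ j = 0}"

definition submanifold ::
  "'p set \<Rightarrow> ('p, real^'m) chart set \<Rightarrow> nat \<Rightarrow> 'p set \<Rightarrow> bool" where
  "submanifold X A k S \<longleftrightarrow> S \<subseteq> X \<and>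
     (\<forall>p\<in>S. \<exists>I c. card I = k \<and> slice_chart X A S I c \<and> p \<in> fst c)"

definition real_level ::
  "(real^'m) set set \<Rightarrow> ('m tpoint \<Rightarrow> real^'m) \<Rightarrow> nat \<Rightarrow> (nat \<Rightarrow> int^'m) \<Rightarrow> (nat \<Rightarrow> real) \<Rightarrow> 'm tpoint set"
where
  "real_level \<Sigma> \<mu> n \<zeta> c = {p \<in> real_form \<Sigma>. \<forall>i<n. \<mu> p \<bullet> of_ivec (\<zeta> i) = c i}"

text \<open>Local parametrization of \<open>S \<times> T_quot V\<close>: the coordinates with indices in \<open>I\<close> are slice
  coordinates \<open>d\<close> on the submanifold \<open>S\<close>, the others are, via \<open>e\<close>, linear coordinates on \<open>V\<close> with
  respect to the basis \<open>\<zeta>\<close>.\<close>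
definition torus_part :: "(nat \<Rightarrow> int^'m) \<Rightarrow> 'm set \<Rightarrow> ('m \<Rightarrow> nat) \<Rightarrow> real^'m \<Rightarrow> real^'m" where
  "torus_part \<zeta> I e x = (\<Sum>j\<in>-I. (x $ j) *\<^sub>R of_ivec (\<zeta> (e j)))"

definition slice_part :: "'m set \<Rightarrow> real^'m \<Rightarrow> real^'m" where
  "slice_part I x = (\<chi> j. if j \<in> I then x $ j else 0)"

definition product_param ::
  "nat \<Rightarrow> (nat \<Rightarrow> int^'m) \<Rightarrow> 'm set \<Rightarrow> ('m \<Rightarrow> nat) \<Rightarrow> ('p, real^'m) chart \<Rightarrow> real^'m \<Rightarrow> 'p \<times> (real^'m) set"
where
  "product_param n \<zeta> I e d x =
     (chart_inv d (slice_part I x), T_class (V_span n \<zeta>) (torus_part \<zeta> I e x))"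

text \<open>The product atlas on \<open>S \<times> T_quot V\<close>, for an \<open>(m - n)\<close>-dimensional submanifold \<open>S\<close> of \<open>X\<close>.
  On \<open>W\<close> the torus coordinates are injective modulo the lattice.\<close>
definition product_atlas ::
  "'p set \<Rightarrow> ('p, real^'m) chart set \<Rightarrow> 'p set \<Rightarrow> nat \<Rightarrow> (nat \<Rightarrow> int^'m) \<Rightarrow>
     ('p \<times> (real^'m) set, real^'m) chart set" where
  "product_atlas X A S n \<zeta> =
     {(product_param n \<zeta> I e d ` D, inv_into D (product_param n \<zeta> I e d)) | I e d W D.
        slice_chart X A S I d \<and> card I = CARD('m) - n \<and> bij_betw e (-I) {..<n} \<and> open W \<and>
        (\<forall>x\<in>W. \<forall>y\<in>W. torus_part \<zeta> I e x - torus_part \<zeta> I e y \<in> int_lattice \<longrightarrow>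
                        torus_part \<zeta> I e x = torus_part \<zeta> I e y) \<and>
        D = {x \<in> W. slice_part I x \<in> chart_image d}}"

text \<open>\<open>F(p,[v]) = exp(v) \<cdot> p\<close>, which does not depend on the representative \<open>v\<close>.\<close>
definition F_map :: "'m tpoint \<times> (real^'m) set \<Rightarrow> 'm tpoint" where
  "F_map q = torus_act (torus_exp (SOME v. v \<in> snd q)) (fst q)"

definition torus_invariant ::
  "(real^'m) set \<Rightarrow> 'm tpoint set \<Rightarrow> ('m tpoint \<times> (real^'m) set \<Rightarrow> 'm tpoint) \<Rightarrow> bool" where
  "torus_invariant V S F \<longleftrightarrow>
     (\<forall>v\<in>V. torus_act (torus_exp v) ` F ` (S \<times> T_quot V) = F ` (S \<times> T_quot V)) \<and>
     (\<forall>v\<in>V. \<forall>p\<in>S. \<forall>w\<in>V.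
        F (p, T_class V (w + v)) = torus_act (torus_exp v) (F (p, T_class V w)))"

end

theory Submission
  imports Defs
begin

text \<open>A toric chart belongs to a lattice basis \<open>B\<close> and its dual basis \<open>B'\<close>. In its coordinates \<open>w\<close> the
  element \<open>exp(v)\<close> of the torus multiplies \<open>w $ j\<close> by \<open>exp(2\<pi>\<i>\<langle>B' j, v\<rangle>)\<close>, and the real form is the locus of
  real \<open>w\<close>. If \<open>\<rho>(s)\<close> denotes the real coordinates of the point of the level set with slice coordinates
  \<open>s\<close>, then \<open>F(p, [v])\<close> has the coordinates \<open>exp(2\<pi>\<i>\<langle>B' j, v\<rangle>) \<rho>(s) $ j\<close>. Up to the action of \<open>exp(v)\<close>, its
  differential is \<open>\<xi> + \<i>\<eta>\<close> with real vectors \<open>\<xi>\<close> (the derivative of \<open>\<rho>\<close>) and \<open>\<eta>\<close> (the rotation of \<open>\<rho>\<close>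
  by a vector of \<open>V\<close>); see \<open>F_derivative\<close>. All claims are read off from this normal form at the points of
  the real form, since the torus preserves \<open>\<omega>\<close> and \<open>g\<close> and multiplies \<open>\<Omega>\<close> by \<open>exp(2\<pi>\<i>\<langle>\<gamma>, v\<rangle>)\<close>.

  \<^bold>\<open>Lagrangian.\<close> Torus orbits are isotropic (\<open>orbits_isotropic\<close>), and on the open orbit \<open>\<i>\<close> times a real
  vector is tangent to them; by continuity real vectors are \<open>\<omega>\<close>-orthogonal to each other on the whole real
  form (\<open>real_form_isotropic\<close>), hence so are imaginary ones. The mixed terms \<open>\<omega>(\<i>\<eta>, \<xi>)\<close> are derivatives of
  components of \<open>\<mu>\<close> along the level set and vanish (\<open>slice_torus_isotropic\<close>).

  \<^bold>\<open>Immersion.\<close> \<open>\<rho>\<close> is a change of charts, so \<open>\<xi> = 0\<close> only for the zero slice direction. If \<open>\<eta> = 0\<close>, the vector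
  of \<open>V\<close> lies in the span of those \<open>B k\<close> for which \<open>w $ k\<close> vanishes at \<open>p\<close>. These lie in the span of the active
  constraints at \<open>\<mu> p\<close> (\<open>stabilizer_in_active_span\<close>), because \<open>\<langle>\<mu>, B k\<rangle>\<close> attains its minimum over \<open>M\<close> where
  \<open>w $ k = 0\<close>; by regularity the vector is zero.

  \<^bold>\<open>Angle.\<close> Since \<open>\<gamma>\<close> pairs to \<open>1\<close> with the rays, \<open>\<Omega>\<close> is a real constant times
  \<open>\<Prod>k. (w $ k) powi (\<langle>\<gamma>, B k\<rangle> - 1)\<close> times \<open>dw\<close> (\<open>volume_form_chart\<close>), which is real on the real form. Hence
  the coefficient of \<open>F\<^sup>*\<Omega>\<close> is a nonzero real number times the phase of \<open>\<gamma>\<close> and one factor \<open>\<i>\<close> for each of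
  the \<open>n\<close> torus directions (\<open>volume_form_tangent\<close>).

  \<^bold>\<open>Stationarity.\<close> The angle is an affine function of the torus coordinates, while the induced metric and the
  potential depend on the slice coordinates only, and slice and torus directions are orthogonal. So the
  gradient of the angle points in torus directions, along which the metric and the potential are constant
  (\<open>weighted_laplacian_adapted_zero\<close>).\<close>


section \<open>Calculus of smooth maps\<close>

lemma Ck_on_cong:
  fixes f g :: "'a::euclidean_space \<Rightarrow> 'b::real_normed_vector"
  assumes "open S" "\<And>x. x \<in> S \<Longrightarrow> f x = g x" "Ck_on k S f"
  shows "Ck_on k S g"
  using assms(2,3)
proof (induction k arbitrary: f g)
  case 0
  then show ?case using continuous_on_cong by (metis Ck_on.simps(1))
next
  case (Suc k)
  have *: "frechet_derivative f (at x) = frechet_derivative g (at x)" if "x \<in> S" for x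
    using frechet_derivative_transform_within_open[OF _ \<open>open S\<close> that, of f g] Suc.prems that assms(1)
    by (simp add: differentiable_on_eq_differentiable_at)
  have "g differentiable_on S"
    using Suc.prems differentiable_transform_within[of f _ S 1 g]
    by (auto simp: differentiable_on_def)
  moreover have "Ck_on k S (\<lambda>x. frechet_derivative g (at x) v)" for v
    by (rule Suc.IH[of "\<lambda>x. frechet_derivative f (at x) v"]) (use * Suc.prems in auto)
  ultimately show ?case by simp
qed

lemma Ck_on_const: "Ck_on k S (\<lambda>x. a)"
  by (induction k arbitrary: a) auto

lemma frechet_derivative_eqI:
  "(f has_derivative D) (at x) \<Longrightarrow> frechet_derivative f (at x) = D"
  using frechet_derivative_at by metis

lemma Ck_on_bounded_linear:
  assumes "bounded_linear f" shows "Ck_on k S f"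
proof (cases k)
  case 0 then show ?thesis using assms linear_continuous_on by auto
next
  case (Suc j)
  have "frechet_derivative f (at x) = f" for x
    by (intro frechet_derivative_eqI bounded_linear_imp_has_derivative assms)
  then show ?thesis
    using Suc assms by (simp add: Ck_on_const bounded_linear_imp_differentiable_on)
qed

lemma Ck_on_Suc_imp:
  assumes "Ck_on (Suc k) S f" shows "Ck_on k S f"
  using assms
proof (induction k arbitrary: f)
  case 0 then show ?case using differentiable_imp_continuous_on by auto
next
  case (Suc k) then show ?case by auto
qed

lemma Ck_on_has_derivative:
  assumes "Ck_on (Suc k) S f" "open S" "x \<in> S"
  shows "(f has_derivative frechet_derivative f (at x)) (at x)"
  using assms by (simp add: differentiable_on_eq_differentiable_at frechet_derivative_works[symmetric])

lemma Ck_on_SucI: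
  assumes "open S" "\<And>x. x \<in> S \<Longrightarrow> (f has_derivative D x) (at x)" "\<And>v. Ck_on k S (\<lambda>x. D x v)"
  shows "Ck_on (Suc k) S f"
proof -
  have "f differentiable_on S"
    using assms by (auto simp: differentiable_on_eq_differentiable_at differentiable_def)
  moreover have "Ck_on k S (\<lambda>x. frechet_derivative f (at x) v)" for v
    by (rule Ck_on_cong[OF assms(1) _ assms(3)[of v]]) (simp add: frechet_derivative_eqI[OF assms(2)])
  ultimately show ?thesis by simp
qed

lemma Ck_on_compose_linear_left:
  assumes "bounded_linear l" "open S" "Ck_on k S f"
  shows "Ck_on k S (\<lambda>x. l (f x))"
  using assms(3)
proof (induction k arbitrary: f)
  case 0
  then show ?case using bounded_linear.continuous_on[OF assms(1)] by auto
next
  case (Suc k)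
  show ?case
  proof (rule Ck_on_SucI[OF assms(2)])
    show "((\<lambda>x. l (f x)) has_derivative (\<lambda>v. l (frechet_derivative f (at x) v))) (at x)" if "x \<in> S" for x
      using bounded_linear.has_derivative[OF assms(1) Ck_on_has_derivative[OF Suc.prems assms(2) that]] .
    show "Ck_on k S (\<lambda>x. l (frechet_derivative f (at x) v))" for v
      by (rule Suc.IH) (use Suc.prems in simp)
  qed
qed

lemma Ck_on_add:
  assumes "open S" "Ck_on k S f" "Ck_on k S g"
  shows "Ck_on k S (\<lambda>x. f x + g x)"
  using assms(2,3)
proof (induction k arbitrary: f g)
  case 0
  then show ?case by (auto intro: continuous_on_add)
next
  case (Suc k)
  show ?case
  proof (rule Ck_on_SucI[OF assms(1)])
    show "((\<lambda>x. f x + g x) has_derivative (\<lambda>v. frechet_derivative f (at x) v + frechet_derivative g (at x) v)) (at x)"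
      if "x \<in> S" for x
      using Suc.prems that by (intro has_derivative_add Ck_on_has_derivative[OF _ assms(1)]) auto
    show "Ck_on k S (\<lambda>x. frechet_derivative f (at x) v + frechet_derivative g (at x) v)" for v
      by (rule Suc.IH) (use Suc.prems in simp_all)
  qed
qed

lemma Ck_on_sum:
  assumes "open S" "\<And>i. i \<in> I \<Longrightarrow> Ck_on k S (f i)"
  shows "Ck_on k S (\<lambda>x. \<Sum>i\<in>I. f i x)"
proof (cases "finite I")
  case True
  then show ?thesis using assms(2)
    by (induction I) (auto simp: Ck_on_const intro: Ck_on_add[OF assms(1)])
qed (simp add: Ck_on_const)

lemma Ck_on_mult:
  fixes f g :: "'a::euclidean_space \<Rightarrow> 'b::real_normed_algebra"
  assumes "open S" "Ck_on k S f" "Ck_on k S g"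
  shows "Ck_on k S (\<lambda>x. f x * g x)"
  using assms(2,3)
proof (induction k arbitrary: f g)
  case 0
  then show ?case by (auto intro: continuous_on_mult)
next
  case (Suc k)
  show ?case
  proof (rule Ck_on_SucI[OF assms(1)])
    show "((\<lambda>x. f x * g x) has_derivative
        (\<lambda>v. f x * frechet_derivative g (at x) v + frechet_derivative f (at x) v * g x)) (at x)"
      if "x \<in> S" for x
      using Suc.prems that by (intro has_derivative_mult Ck_on_has_derivative[OF _ assms(1)]) auto
    show "Ck_on k S (\<lambda>x. f x * frechet_derivative g (at x) v + frechet_derivative f (at x) v * g x)" for v
      using Ck_on_Suc_imp[OF Suc.prems(1)] Ck_on_Suc_imp[OF Suc.prems(2)] Suc.prems
      by (auto intro!: Ck_on_add[OF assms(1)] Suc.IH)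
  qed
qed

lemma Ck_on_compose_linear_right:
  fixes l :: "'a::euclidean_space \<Rightarrow> 'b::euclidean_space"
  assumes "linear l" "open S" "open T" "l ` T \<subseteq> S" "Ck_on k S f"
  shows "Ck_on k T (\<lambda>x. f (l x))"
  using assms(5)
proof (induction k arbitrary: f)
  case 0
  have "bounded_linear l" using assms(1) by (simp add: linear_conv_bounded_linear)
  then have "continuous_on T l" by (rule linear_continuous_on)
  then show ?case using continuous_on_compose2[of S f T l] assms(4) 0 by simp
next
  case (Suc k)
  show ?case
  proof (rule Ck_on_SucI[OF assms(3)])
    show "((\<lambda>x. f (l x)) has_derivative (\<lambda>v. frechet_derivative f (at (l x)) (l v))) (at x)"
      if "x \<in> T" for x
      using has_derivative_compose[OF linear_imp_has_derivative[OF assms(1)]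
          Ck_on_has_derivative[OF Suc.prems assms(2)], of x UNIV] that assms(4) by auto
    show "Ck_on k T (\<lambda>x. frechet_derivative f (at (l x)) (l v))" for v
      by (rule Suc.IH) (use Suc.prems in simp)
  qed
qed

lemma Ck_on_exp_linear:
  fixes l :: "'a::euclidean_space \<Rightarrow> complex"
  assumes "linear l" "open S"
  shows "Ck_on k S (\<lambda>x. exp (l x))"
proof (induction k)
  case 0
  have "continuous_on S l" using assms linear_continuous_on linear_conv_bounded_linear by metis
  then show ?case by (auto intro: continuous_on_exp)
next
  case (Suc k)
  show ?case
  proof (rule Ck_on_SucI[OF assms(2)])
    show "((\<lambda>x. exp (l x)) has_derivative (\<lambda>v. exp (l x) * l v)) (at x)" for x
      using has_derivative_compose[OF linear_imp_has_derivative[OF assms(1)], of exp _ x UNIV]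
        DERIV_exp[of "l x"] by (simp add: has_field_derivative_def)
    show "Ck_on k S (\<lambda>x. exp (l x) * l v)" for v
      by (intro Ck_on_mult Suc.IH assms Ck_on_const)
  qed
qed

lemma smooth_on_vec:
  fixes f :: "'m::finite \<Rightarrow> 'a::euclidean_space \<Rightarrow> complex"
  assumes "open S" "\<And>j k. Ck_on k S (f j)"
  shows "smooth_on S (\<lambda>x. \<chi> j. f j x)"
proof -
  have "Ck_on k S (\<lambda>x. \<Sum>j\<in>UNIV. (\<chi> i. if i = j then f j x else 0) :: complex^'m)" for k
  proof (rule Ck_on_sum[OF assms(1)])
    fix j :: 'm
    have "linear (\<lambda>z. (\<chi> i. if i = j then z else 0) :: complex^'m)"
      by (rule linearI) (auto simp: vec_eq_iff)
    then show "Ck_on k S (\<lambda>x. (\<chi> i. if i = j then f j x else 0) :: complex^'m)"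
      using Ck_on_compose_linear_left[OF _ assms] linear_conv_bounded_linear by blast
  qed
  moreover have "(\<Sum>j\<in>UNIV. (\<chi> i. if i = j then f j x else 0) :: complex^'m) = (\<chi> j. f j x)" for x
    by (simp add: vec_eq_iff)
  ultimately show ?thesis unfolding smooth_on_def by simp
qed

lemma smooth_on_has_derivative:
  assumes "smooth_on S f" "open S" "x \<in> S"
  shows "(f has_derivative frechet_derivative f (at x)) (at x)"
  using assms Ck_on_has_derivative unfolding smooth_on_def by blast

lemma smooth_on_imp_continuous_on: "smooth_on S f \<Longrightarrow> continuous_on S f"
  unfolding smooth_on_def by (metis Ck_on.simps(1))

section \<open>The weighted Laplacian in adapted coordinates\<close>

lemma matrix_inv_unique:
  fixes G :: "real^'n^'n"
  assumes "invertible G" "G ** H = mat 1"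
  shows "matrix_inv G = H"
proof -
  have "matrix_inv G ** G = mat 1"
    using assms(1) unfolding invertible_def matrix_inv_def by (metis (mono_tags, lifting) someI_ex)
  then show ?thesis using assms(2) by (metis matrix_mul_assoc matrix_mul_lid matrix_mul_rid)
qed

text \<open>The sign matrix \<open>s\<close> that separates \<open>I\<close> from its complement commutes with \<open>G\<close>, hence with its inverse.\<close>
lemma matrix_inv_block:
  fixes G :: "real^'n^'n"
  assumes G: "invertible G" and block: "\<And>i j. (i \<in> I) \<noteq> (j \<in> I) \<Longrightarrow> G $ i $ j = 0"
    and ij: "(i \<in> I) \<noteq> (j \<in> I)"
  shows "matrix_inv G $ i $ j = 0"
proof -
  let ?H = "matrix_inv G"
  define s where "s i = (if i \<in> I then 1 else - 1 :: real)" for i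
  define H' where "H' = (\<chi> i j. s i * ?H $ i $ j * s j)"
  have ss: "s i * s i = 1" for i by (simp add: s_def)
  have sG: "G $ i $ j * s j = s i * G $ i $ j" for i j
    using block[of i j] by (auto simp: s_def)
  have GH: "G ** ?H = mat 1"
    using G unfolding invertible_def matrix_inv_def by (metis (mono_tags, lifting) someI_ex)
  have "G ** H' = mat 1"
  proof -
    have "(G ** H') $ i $ j = (mat 1 :: real^'n^'n) $ i $ j" for i j
    proof -
      have "(G ** H') $ i $ j = (\<Sum>k\<in>UNIV. G $ i $ k * (s k * ?H $ k $ j * s j))"
        by (simp add: matrix_matrix_mult_def H'_def)
      also have "\<dots> = (\<Sum>k\<in>UNIV. (G $ i $ k * s k) * (?H $ k $ j * s j))"
        by (simp add: mult.assoc)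
      also have "\<dots> = s i * (\<Sum>k\<in>UNIV. G $ i $ k * ?H $ k $ j) * s j"
        unfolding sG sum_distrib_left sum_distrib_right by (rule sum.cong) (simp_all only: mult.assoc)
      also have "(\<Sum>k\<in>UNIV. G $ i $ k * ?H $ k $ j) = (G ** ?H) $ i $ j"
        by (simp add: matrix_matrix_mult_def)
      finally show ?thesis using GH ss by (auto simp: mat_def)
    qed
    then show ?thesis by (simp add: vec_eq_iff)
  qed
  then have "?H = H'" using matrix_inv_unique[OF G] by simp
  then have "?H $ i $ j = H' $ i $ j" by simp
  also have "H' $ i $ j = s i * ?H $ i $ j * s j" by (simp only: H'_def vec_lambda_beta)
  finally have "?H $ i $ j = s i * ?H $ i $ j * s j" .
  then show ?thesis using ij by (auto simp: s_def split: if_splits)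
qed

lemma partial_deriv_zero:
  fixes x :: "real^'n"
  assumes "open D" "x \<in> D" "\<And>s. x + s *\<^sub>R axis i 1 \<in> D \<Longrightarrow> F (x + s *\<^sub>R axis i 1) = F x"
  shows "partial_deriv F x i = 0"
proof -
  have "continuous (at 0) (\<lambda>s. x + s *\<^sub>R axis i (1::real))" by (intro continuous_intros)
  then have "eventually (\<lambda>s. x + s *\<^sub>R axis i 1 \<in> D) (at 0)"
    using assms(1,2) unfolding continuous_at by (auto dest: topological_tendstoD)
  then have "eventually (\<lambda>s. x + s *\<^sub>R axis i 1 \<in> D) (nhds 0)"
    using assms(2) by (simp add: eventually_nhds_conv_at)
  then have "eventually (\<lambda>s. F (x + s *\<^sub>R axis i 1) = F x) (nhds 0)"
    by (rule eventually_mono) (rule assms(3))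
  then have "deriv (\<lambda>s. F (x + s *\<^sub>R axis i 1)) 0 = deriv (\<lambda>s::real. F x) 0"
    by (intro deriv_cong_ev) auto
  then show ?thesis by (simp add: partial_deriv_def)
qed

text \<open>The flux \<open>G\<^sup>-\<^sup>1 du\<close> has components outside \<open>I\<close> only, and those are the directions in which the metric and
  \<open>f\<close> are constant. So the divergence of the flux and its pairing with \<open>df\<close> vanish separately.\<close>
lemma weighted_laplacian_adapted_zero:
  fixes G :: "real^'n \<Rightarrow> real^'n^'n" and f u :: "real^'n \<Rightarrow> real"
  assumes D: "open D" "x \<in> D"
    and G: "\<And>y. y \<in> D \<Longrightarrow> invertible (G y)"
    and block: "\<And>y i j. y \<in> D \<Longrightarrow> (i \<in> I) \<noteq> (j \<in> I) \<Longrightarrow> G y $ i $ j = 0"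
    and G_slice: "\<And>y z. y \<in> D \<Longrightarrow> z \<in> D \<Longrightarrow> slice_part I y = slice_part I z \<Longrightarrow> G y = G z"
    and f_slice: "\<And>y z. y \<in> D \<Longrightarrow> z \<in> D \<Longrightarrow> slice_part I y = slice_part I z \<Longrightarrow> f y = f z"
    and u: "\<And>y. u y = (\<Sum>j\<in>-I. a j * y $ j) + b"
  shows "weighted_laplacian G f u x = 0"
proof -
  define a' where "a' j = (if j \<in> I then 0 else a j)" for j
  have du: "partial_deriv u y i = a' i" for y i
  proof -
    have "u (y + s *\<^sub>R axis i 1) = u y + s * a' i" for s
    proof -
      have "(\<Sum>j\<in>-I. a j * (y + s *\<^sub>R axis i 1) $ j)
          = (\<Sum>j\<in>-I. a j * y $ j) + (\<Sum>j\<in>-I. s * (if j = i then a j else 0))"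
        by (auto simp: axis_def algebra_simps sum.distrib[symmetric] intro!: sum.cong)
      also have "(\<Sum>j\<in>-I. s * (if j = i then a j else 0)) = s * a' i"
        by (simp add: a'_def sum_distrib_left[symmetric])
      finally show ?thesis by (simp add: u)
    qed
    then have "((\<lambda>s. u (y + s *\<^sub>R axis i 1)) has_real_derivative a' i) (at 0)"
      by (auto intro!: derivative_eq_intros)
    then show ?thesis unfolding partial_deriv_def by (rule DERIV_imp_deriv)
  qed
  have slice_move: "slice_part I (y + s *\<^sub>R axis i 1) = slice_part I y" if "i \<notin> I" for y s i
    using that by (auto simp: slice_part_def vec_eq_iff axis_def)
  have flux: "(\<Sum>j\<in>UNIV. matrix_inv (G y) $ i $ j * a' j) = 0" if "y \<in> D" "i \<in> I" for y i
    using matrix_inv_block[OF G block, of y I i] that by (intro sum.neutral) (auto simp: a'_def)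
  have "partial_deriv (\<lambda>y. sqrt (det (G y)) * (\<Sum>j\<in>UNIV. matrix_inv (G y) $ i $ j * a' j)) x i = 0" for i
  proof (cases "i \<in> I")
    case True
    show ?thesis by (rule partial_deriv_zero[OF D]) (use flux[OF _ True] D in auto)
  next
    case False
    show ?thesis
      by (rule partial_deriv_zero[OF D]) (simp add: G_slice[OF _ D(2)] slice_move[OF False])
  qed
  then have "laplacian G u x = 0" by (simp add: laplacian_def codifferential_def du)
  moreover have "grad_inner G u f x = 0"
  proof -
    have "matrix_inv (G x) $ i $ j * a' i * partial_deriv f x j = 0" for i j
    proof (cases "j \<in> I")
      case True
      then show ?thesis using matrix_inv_block[OF G block, of x I i j] D by (auto simp: a'_def)
    next
      case False
      have "partial_deriv f x j = 0"
        by (rule partial_deriv_zero[OF D]) (simp add: f_slice[OF _ D(2)] slice_move[OF False])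
      then show ?thesis by simp
    qed
    then show ?thesis unfolding grad_inner_def du by (intro sum.neutral ballI)
  qed
  ultimately show ?thesis by (simp add: weighted_laplacian_def)
qed



section \<open>Dual lattice bases and simplicial cones\<close>

definition pairing :: "int^'m \<Rightarrow> int^'m \<Rightarrow> int" where
  "pairing a b = (\<Sum>i\<in>UNIV. a $ i * b $ i)"

lemma of_ivec_nth [simp]: "of_ivec a $ i = of_int (a $ i)"
  by (simp add: of_ivec_def)

lemma inner_of_ivec: "of_ivec a \<bullet> v = (\<Sum>i\<in>UNIV. of_int (a $ i) * v $ i)"
  by (simp add: inner_vec_def)

lemma inner_of_ivec_of_ivec: "of_ivec a \<bullet> of_ivec b = of_int (pairing a b)"
  by (simp add: inner_of_ivec pairing_def)

lemma pairing_add: "pairing (a + b) x = pairing a x + pairing b x"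
  by (simp add: pairing_def algebra_simps sum.distrib)

lemma pairing_zero [simp]: "pairing 0 x = 0"
  by (simp add: pairing_def)

lemma dual_bases_pairing: "dual_bases B B' \<Longrightarrow> pairing (B' j) (B k) = (if j = k then 1 else 0)"
  by (simp add: dual_bases_def pairing_def)

text \<open>A one-sided inverse of a square matrix is two-sided.\<close>
lemma dual_bases_complete:
  assumes "dual_bases B B'"
  shows "(\<Sum>k\<in>UNIV. B k $ i * B' k $ l) = (if i = l then 1 else 0)"
proof -
  define M :: "real^'a^'a" where "M = (\<chi> j i. of_int (B' j $ i))"
  define N :: "real^'a^'a" where "N = (\<chi> i k. of_int (B k $ i))"
  have "M ** N = mat 1"
  proof -
    have "(M ** N) $ j $ k = (mat 1 :: real^'a^'a) $ j $ k" for j k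
    proof -
      have "(M ** N) $ j $ k = of_int (pairing (B' j) (B k))"
        by (simp add: matrix_matrix_mult_def M_def N_def pairing_def)
      then show ?thesis using dual_bases_pairing[OF assms] by (simp add: mat_def)
    qed
    then show ?thesis by (simp add: vec_eq_iff)
  qed
  then have "(N ** M) $ i $ l = (mat 1 :: real^'a^'a) $ i $ l" using matrix_left_right_inverse by metis
  then have "real_of_int (\<Sum>k\<in>UNIV. B k $ i * B' k $ l) = of_int (if i = l then 1 else 0)"
    by (simp add: matrix_matrix_mult_def M_def N_def mat_def)
  then show ?thesis by (simp only: of_int_eq_iff)
qed

lemma dual_bases_expand:
  fixes z :: "'m::finite \<Rightarrow> 'a::comm_ring_1"
  assumes "dual_bases B B'"
  shows "(\<Sum>k\<in>UNIV. of_int (B k $ i) * (\<Sum>l\<in>UNIV. of_int (B' k $ l) * z l)) = z i"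
proof -
  have "(\<Sum>k\<in>UNIV. of_int (B k $ i) * (\<Sum>l\<in>UNIV. of_int (B' k $ l) * z l))
      = (\<Sum>l\<in>UNIV. \<Sum>k\<in>UNIV. of_int (B k $ i * B' k $ l) * z l)"
    by (subst sum.swap) (simp add: sum_distrib_left mult.assoc)
  also have "\<dots> = (\<Sum>l\<in>UNIV. of_int (\<Sum>k\<in>UNIV. B k $ i * B' k $ l) * z l)"
    by (simp add: sum_distrib_right)
  also have "\<dots> = (\<Sum>l\<in>UNIV. if i = l then z l else 0)"
    unfolding dual_bases_complete[OF assms] by (intro sum.cong) auto
  finally show ?thesis by simp
qed

lemma dual_bases_expand_pairing:
  fixes z :: "'m::finite \<Rightarrow> 'a::comm_ring_1"
  assumes "dual_bases B B'"
  shows "(\<Sum>i\<in>UNIV. of_int (a $ i) * z i)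
    = (\<Sum>k\<in>UNIV. of_int (pairing a (B k)) * (\<Sum>i\<in>UNIV. of_int (B' k $ i) * z i))"
proof -
  have "(\<Sum>i\<in>UNIV. of_int (a $ i) * z i)
    = (\<Sum>i\<in>UNIV. of_int (a $ i) * (\<Sum>k\<in>UNIV. of_int (B k $ i) * (\<Sum>l\<in>UNIV. of_int (B' k $ l) * z l)))"
    by (simp only: dual_bases_expand[OF assms])
  also have "\<dots> = (\<Sum>k\<in>UNIV. \<Sum>i\<in>UNIV. of_int (a $ i * B k $ i) * (\<Sum>l\<in>UNIV. of_int (B' k $ l) * z l))"
    by (subst sum.swap) (simp add: sum_distrib_left mult.assoc)
  also have "\<dots> = (\<Sum>k\<in>UNIV. of_int (pairing a (B k)) * (\<Sum>i\<in>UNIV. of_int (B' k $ i) * z i))"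
    by (simp add: sum_distrib_right pairing_def)
  finally show ?thesis .
qed

lemma dual_bases_expand_inner:
  assumes "dual_bases B B'"
  shows "of_ivec a \<bullet> v = (\<Sum>k\<in>UNIV. of_int (pairing a (B k)) * (of_ivec (B' k) \<bullet> v))"
  using dual_bases_expand_pairing[OF assms, of a "($) v"] by (simp add: inner_of_ivec)

lemma dual_bases_expand_vector:
  assumes "dual_bases B B'"
  shows "(\<Sum>k\<in>UNIV. (of_ivec (B' k) \<bullet> v) *\<^sub>R of_ivec (B k)) = v"
  using dual_bases_expand[OF assms, of _ "($) v"]
  by (simp add: vec_eq_iff inner_of_ivec mult.commute)

lemma dual_bases_expand_lattice:
  assumes "dual_bases B B'"
  shows "(\<Sum>k\<in>UNIV. pairing a (B k) *s B' k) = a"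
proof -
  have "(\<Sum>k\<in>UNIV. pairing a (B k) *s B' k) $ l = a $ l" for l
  proof -
    have "(\<Sum>i\<in>UNIV. of_int (a $ i) * of_int (if i = l then 1 else 0)) =
      (\<Sum>k\<in>UNIV. of_int (pairing a (B k)) * (\<Sum>i\<in>UNIV. of_int (B' k $ i) * of_int (if i = l then 1 else 0)) :: int)"
      by (rule dual_bases_expand_pairing[OF assms])
    then show ?thesis by (simp add: if_distrib if_distribR cong: if_cong)
  qed
  then show ?thesis by (simp add: vec_eq_iff)
qed

text \<open>Cones spanned by parts of \<open>B\<close> are given by sign conditions on the dual coordinates. Their faces, dual
  monoids and annihilators are read off from these conditions.\<close>
lemma simplicial_cone_eq:
  assumes "dual_bases B B'"
  shows "convex_cone hull (of_ivec ` B ` J) =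
    {x. \<forall>k. (k \<in> J \<longrightarrow> 0 \<le> of_ivec (B' k) \<bullet> x) \<and> (k \<notin> J \<longrightarrow> of_ivec (B' k) \<bullet> x = 0)}" (is "_ = ?C")
proof
  have "of_ivec (B j) \<in> ?C" if "j \<in> J" for j
    using that by (auto simp: inner_of_ivec_of_ivec dual_bases_pairing[OF assms])
  moreover have "convex_cone ?C"
    by (auto simp: convex_cone_iff inner_add_right)
  ultimately show "convex_cone hull (of_ivec ` B ` J) \<subseteq> ?C"
    by (intro hull_minimal) auto
next
  have "x \<in> convex_cone hull (of_ivec ` B ` J)" if "x \<in> ?C" for x
  proof -
    have "(\<Sum>k\<in>T. (of_ivec (B' k) \<bullet> x) *\<^sub>R of_ivec (B k)) \<in> convex_cone hull (of_ivec ` B ` J)"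
      if "finite T" for T
      using that
    proof (induction T)
      case empty then show ?case by (simp add: convex_cone_hull_contains_0)
    next
      case (insert k T)
      have "(of_ivec (B' k) \<bullet> x) *\<^sub>R of_ivec (B k) \<in> convex_cone hull (of_ivec ` B ` J)"
      proof (cases "k \<in> J")
        case True
        then show ?thesis using \<open>x \<in> ?C\<close>
          by (intro convex_cone_hull_mul hull_inc) auto
      next
        case False
        then show ?thesis using \<open>x \<in> ?C\<close> by (simp add: convex_cone_hull_contains_0)
      qed
      then show ?case using insert by (simp add: convex_cone_hull_add)
    qed
    from this[of UNIV] show ?thesis using dual_bases_expand_vector[OF assms, of x] by simp
  qed
  then show "?C \<subseteq> convex_cone hull (of_ivec ` B ` J)" by blast
qed

section \<open>Toric charts\<close>

locale smooth_cone =
  fixes \<Sigma> :: "(real^'m) set set" and B B' :: "'m \<Rightarrow> int^'m" and K :: "'m set"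
  assumes smooth_fan: "smooth_fan \<Sigma>"
    and dual: "dual_bases B B'"
    and cone_in_fan: "convex_cone hull (of_ivec ` B ` K) \<in> \<Sigma>"
begin

abbreviation cone :: "'m set \<Rightarrow> (real^'m) set" where
  "cone J \<equiv> convex_cone hull (of_ivec ` B ` J)"

abbreviation chart :: "('m tpoint, complex^'m) chart" where
  "chart \<equiv> toric_chart \<Sigma> (cone K) B'"

lemmas cone_eq = simplicial_cone_eq[OF dual]
lemmas pairing_dual = dual_bases_pairing[OF dual]

lemma generator_in_cone_iff: "of_ivec (B k) \<in> cone J \<longleftrightarrow> k \<in> J"
  by (auto simp: cone_eq inner_of_ivec_of_ivec pairing_dual)

text \<open>A dual coordinate that is nonnegative at the ends of a segment and zero inside it vanishes at the ends.\<close>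
lemma cone_face_of:
  assumes "J \<subseteq> J'" shows "cone J face_of cone J'"
  unfolding face_of_def
proof (intro conjI ballI impI)
  show "cone J \<subseteq> cone J'" using assms by (intro hull_mono) auto
  show "convex (cone J)" by (rule convex_convex_cone_hull)
next
  fix a b x assume a: "a \<in> cone J'" and b: "b \<in> cone J'" and x: "x \<in> cone J" and "x \<in> open_segment a b"
  then obtain t where t: "0 < t" "t < 1" "x = (1 - t) *\<^sub>R a + t *\<^sub>R b" by (auto simp: in_segment)
  have nonneg: "0 \<le> of_ivec (B' k) \<bullet> a" "0 \<le> of_ivec (B' k) \<bullet> b" for k
    using a b unfolding cone_eq by (cases "k \<in> J'"; force)+
  have "of_ivec (B' k) \<bullet> a = 0 \<and> of_ivec (B' k) \<bullet> b = 0" if "k \<notin> J" for k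
  proof -
    have "(1 - t) * (of_ivec (B' k) \<bullet> a) + t * (of_ivec (B' k) \<bullet> b) = 0"
      using x that unfolding cone_eq t(3) by (auto simp: inner_add_right)
    moreover have "0 \<le> (1 - t) * (of_ivec (B' k) \<bullet> a)" "0 \<le> t * (of_ivec (B' k) \<bullet> b)"
      using nonneg t by auto
    ultimately have "(1 - t) * (of_ivec (B' k) \<bullet> a) = 0 \<and> t * (of_ivec (B' k) \<bullet> b) = 0" by linarith
    then show ?thesis using t by auto
  qed
  then show "a \<in> cone J" "b \<in> cone J" using nonneg unfolding cone_eq by auto
qed

text \<open>If a generator occurs in a point \<open>x\<close> of the face, then \<open>x\<close> is the midpoint of a multiple of the generator
  and of another point of the cone, so the face contains this multiple and, being conic, the generator.\<close>
lemma face_of_coneE: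
  assumes F: "F face_of cone K" and "F \<noteq> {}"
  obtains J where "J \<subseteq> K" "F = cone J"
proof
  let ?J = "{k \<in> K. of_ivec (B k) \<in> F}"
  show "?J \<subseteq> K" by auto
  have cone_K: "convex_cone (cone K)" by (rule convex_cone_convex_cone_hull)
  have sub: "F \<subseteq> cone K" using F face_of_imp_subset by blast
  have scale: "t *\<^sub>R x \<in> F" if "x \<in> F" "0 \<le> t" for t x
  proof (cases "x = 0 \<or> t = 1")
    case False
    \<comment> \<open>Any factor on the other side of \<open>1\<close> from \<open>t\<close> makes \<open>x\<close> an interior point of a segment.\<close>
    define s where "s = (if t < 1 then 2 else (0::real))"
    have "t *\<^sub>R x \<in> cone K" "s *\<^sub>R x \<in> cone K"
      using that sub cone_K by (auto simp: s_def intro: convex_cone_scaleR convex_cone_contains_0)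
    moreover have "x \<in> open_segment (t *\<^sub>R x) (s *\<^sub>R x)"
    proof -
      define u where "u = (1 - t) / (s - t)"
      have "s \<noteq> t" using False that by (auto simp: s_def)
      then have "u * (s - t) = 1 - t" by (simp add: u_def)
      then have u: "(1 - u) * t + u * s = 1" by (simp add: algebra_simps)
      have "0 < u \<and> u < 1"
        using False that by (auto simp: u_def s_def field_simps)
      moreover have "x = (1 - u) *\<^sub>R t *\<^sub>R x + u *\<^sub>R s *\<^sub>R x"
        using u by (simp add: scaleR_left_distrib[symmetric])
      ultimately show ?thesis using False \<open>s \<noteq> t\<close> unfolding in_segment
        by (intro conjI exI[of _ u]) auto
    qed
    ultimately show ?thesis using F that(1) unfolding face_of_def by blast
  qed (use that in auto)
  have conv: "convex F" using F face_of_imp_convex by blast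
  have add: "x + y \<in> F" if "x \<in> F" "y \<in> F" for x y
  proof -
    have "(1/2) *\<^sub>R x + (1/2) *\<^sub>R y \<in> F" using conv that by (intro convexD) auto
    then have "2 *\<^sub>R ((1/2) *\<^sub>R x + (1/2) *\<^sub>R y) \<in> F" by (intro scale) auto
    then show ?thesis by (simp add: scaleR_right_distrib)
  qed
  have "convex_cone F"
    using add scale scale[of _ 0] \<open>F \<noteq> {}\<close> by (auto simp: convex_cone_iff)
  then have "cone ?J \<subseteq> F" by (intro hull_minimal) auto
  moreover have "F \<subseteq> cone ?J"
  proof
    fix x assume x: "x \<in> F"
    then have xK: "x \<in> cone K" using sub by auto
    have "k \<in> ?J" if nz: "of_ivec (B' k) \<bullet> x \<noteq> 0" for k
    proof -
      define c where "c = of_ivec (B' k) \<bullet> x"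
      have k: "k \<in> K" and c: "c > 0" using nz xK unfolding cone_eq c_def by force+
      define a b where "a = (2 * c) *\<^sub>R of_ivec (B k)" and "b = 2 *\<^sub>R (x - c *\<^sub>R of_ivec (B k))"
      have aK: "a \<in> cone K" unfolding a_def
        using c k by (intro convex_cone_hull_mul hull_inc) auto
      have "of_ivec (B' j) \<bullet> b = (if j = k then 0 else 2 * (of_ivec (B' j) \<bullet> x))" for j
        by (simp add: b_def inner_diff_right inner_of_ivec_of_ivec pairing_dual c_def)
      then have bK: "b \<in> cone K" using xK k unfolding cone_eq by auto
      have xab: "x = (1 - 1/2) *\<^sub>R a + (1/2) *\<^sub>R b" by (simp add: a_def b_def algebra_simps)
      have "a \<in> F"
      proof (cases "a = b")
        case True
        then have "x = a" using xab by (simp flip: scaleR_left_distrib)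
        then show ?thesis using x by simp
      next
        case False
        then have "x \<in> open_segment a b" using xab unfolding in_segment
          by (intro conjI exI[of _ "1/2"]) auto
        then show ?thesis using F aK bK x unfolding face_of_def by blast
      qed
      then have "(1 / (2 * c)) *\<^sub>R a \<in> F" using c by (intro scale) auto
      then show ?thesis using c k by (simp add: a_def)
    qed
    then have "of_ivec (B' k) \<bullet> x = 0" if "k \<notin> ?J" for k using that by blast
    moreover have "0 \<le> of_ivec (B' k) \<bullet> x" if "k \<in> ?J" for k
      using that xK unfolding cone_eq by auto
    ultimately show "x \<in> cone ?J" unfolding cone_eq[of ?J] by blast
  qed
  ultimately show "F = cone ?J" by auto
qed

lemma cone_in_fan_subset:
  assumes "J \<subseteq> K" shows "cone J \<in> \<Sigma>"
proof -
  have "\<And>\<sigma> \<tau>. \<sigma> \<in> \<Sigma> \<Longrightarrow> \<tau> face_of \<sigma> \<Longrightarrow> \<tau> \<noteq> {} \<Longrightarrow> \<tau> \<in> \<Sigma>"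
    using smooth_fan unfolding smooth_fan_def fan_def by simp
  from this[OF cone_in_fan cone_face_of[OF assms] convex_cone_hull_nonempty] show ?thesis .
qed

lemma dual_monoid_cone: "dual_monoid (cone J) = {a. \<forall>k\<in>J. 0 \<le> pairing a (B k)}"
proof -
  have "a \<in> dual_monoid (cone J) \<longleftrightarrow> (\<forall>k\<in>J. 0 \<le> pairing a (B k))" for a
  proof
    assume "a \<in> dual_monoid (cone J)"
    then have "0 \<le> of_ivec a \<bullet> of_ivec (B k)" if "k \<in> J" for k
      using that generator_in_cone_iff unfolding dual_monoid_def by blast
    then show "\<forall>k\<in>J. 0 \<le> pairing a (B k)" by (simp add: inner_of_ivec_of_ivec)
  next
    assume a: "\<forall>k\<in>J. 0 \<le> pairing a (B k)"
    have "0 \<le> of_ivec a \<bullet> v" if "v \<in> cone J" for v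
      unfolding dual_bases_expand_inner[OF dual, of a v]
    proof (intro sum_nonneg)
      fix k show "0 \<le> of_int (pairing a (B k)) * (of_ivec (B' k) \<bullet> v)"
        using that a unfolding cone_eq by (cases "k \<in> J") auto
    qed
    then show "a \<in> dual_monoid (cone J)" by (simp add: dual_monoid_def)
  qed
  then show ?thesis by blast
qed

lemma annihilator_cone: "(\<forall>v\<in>cone J. of_ivec a \<bullet> v = 0) \<longleftrightarrow> (\<forall>k\<in>J. pairing a (B k) = 0)"
proof
  assume "\<forall>v\<in>cone J. of_ivec a \<bullet> v = 0"
  then have "of_ivec a \<bullet> of_ivec (B k) = 0" if "k \<in> J" for k
    using that generator_in_cone_iff by blast
  then show "\<forall>k\<in>J. pairing a (B k) = 0" by (simp add: inner_of_ivec_of_ivec)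
next
  assume a: "\<forall>k\<in>J. pairing a (B k) = 0"
  show "\<forall>v\<in>cone J. of_ivec a \<bullet> v = 0"
  proof
    fix v assume v: "v \<in> cone J"
    have "of_int (pairing a (B k)) * (of_ivec (B' k) \<bullet> v) = 0" for k
      using v a unfolding cone_eq by (cases "k \<in> J") auto
    then show "of_ivec a \<bullet> v = 0" unfolding dual_bases_expand_inner[OF dual, of a v]
      by (intro sum.neutral ballI)
  qed
qed

definition zero_set :: "complex^'m \<Rightarrow> 'm set" where
  "zero_set w = {k. w $ k = 0}"

text \<open>The inverse of the chart: a point is determined by the zero set of its coordinates, which names
  the cone of its orbit, and by the Laurent monomials in its coordinates.\<close>
definition chart_point :: "complex^'m \<Rightarrow> 'm tpoint" where
  "chart_point w = (cone (zero_set w),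
     \<lambda>a. if a \<in> dual_monoid (cone (zero_set w)) then \<Prod>k\<in>UNIV. (w $ k) powi pairing a (B k) else 0)"

lemma chart_point_coord:
  assumes "a \<in> dual_monoid (cone (zero_set w))"
  shows "snd (chart_point w) a = (\<Prod>k\<in>UNIV. (w $ k) powi pairing a (B k))"
  using assms by (simp add: chart_point_def)

lemma dual_basis_in_dual_monoid: "B' j \<in> dual_monoid (cone J)"
  by (simp add: dual_monoid_cone pairing_dual)

lemma snd_chart_chart_point: "snd chart (chart_point w) = w"
proof -
  have "snd (chart_point w) (B' j) = w $ j" for j
  proof -
    have "snd (chart_point w) (B' j) = (\<Prod>k\<in>UNIV. if j = k then w $ k else 1)"
      unfolding chart_point_coord[OF dual_basis_in_dual_monoid] pairing_dual by (intro prod.cong) auto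
    then show ?thesis by simp
  qed
  then show ?thesis by (simp add: toric_chart_def vec_eq_iff)
qed

lemma chart_point_in:
  assumes "\<And>k. k \<notin> K \<Longrightarrow> w $ k \<noteq> 0"
  shows "chart_point w \<in> fst chart"
proof -
  let ?J = "zero_set w"
  have J: "?J \<subseteq> K" using assms by (auto simp: zero_set_def)
  let ?\<phi> = "snd (chart_point w)"
  have mono: "0 \<le> pairing a (B k)" if "a \<in> dual_monoid (cone ?J)" "w $ k = 0" for a k
    using that by (auto simp: dual_monoid_cone zero_set_def)
  have zero_in: "0 \<in> dual_monoid (cone ?J)" by (simp add: dual_monoid_cone)
  have add_in: "a + b \<in> dual_monoid (cone ?J)"
    if "a \<in> dual_monoid (cone ?J)" "b \<in> dual_monoid (cone ?J)" for a b
    using that by (simp add: dual_monoid_cone pairing_add)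
  have "?\<phi> 0 = 1" using chart_point_coord[OF zero_in] by simp
  moreover have "?\<phi> (a + b) = ?\<phi> a * ?\<phi> b"
    if a: "a \<in> dual_monoid (cone ?J)" and b: "b \<in> dual_monoid (cone ?J)" for a b
  proof -
    have "(w $ k) powi pairing (a + b) (B k) = (w $ k) powi pairing a (B k) * (w $ k) powi pairing b (B k)" for k
    proof (cases "w $ k = 0")
      case True
      then show ?thesis
        using mono[OF a True] mono[OF b True] by (auto simp: pairing_add power_int_0_left_if)
    next
      case False
      then show ?thesis by (simp add: pairing_add power_int_add)
    qed
    then show ?thesis
      by (simp add: chart_point_coord a b add_in prod.distrib)
  qed
  moreover have "?\<phi> a = 0" if "a \<notin> dual_monoid (cone ?J)" for a
    using that by (simp add: chart_point_def)
  moreover have "?\<phi> a \<noteq> 0 \<longleftrightarrow> (\<forall>v\<in>cone ?J. of_ivec a \<bullet> v = 0)" if "a \<in> dual_monoid (cone ?J)" for a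
    using that unfolding annihilator_cone chart_point_coord[OF that]
    by (auto simp: zero_set_def power_int_0_left_if split: if_splits)
  ultimately have "chart_point w \<in> toric_variety \<Sigma>"
    using cone_in_fan_subset[OF J] unfolding toric_variety_def by (auto simp: chart_point_def)
  then show ?thesis
    using cone_face_of[OF J] by (auto simp: toric_chart_def affine_piece_def chart_point_def)
qed

text \<open>A homomorphism on the dual monoid is determined by its values on the dual basis: exponents of a basis
  element with value zero are nonnegative, the other basis elements have invertible values.\<close>
lemma chart_point_snd_chart:
  assumes "p \<in> fst chart"
  shows "chart_point (snd chart p) = p" "k \<notin> K \<Longrightarrow> snd chart p $ k \<noteq> 0"
proof -
  define w where "w = snd chart p"
  obtain \<tau> \<phi> where p: "p = (\<tau>, \<phi>)" by (cases p)
  have \<tau>: "\<tau> face_of cone K" and "\<tau> \<in> \<Sigma>" and \<phi>0: "\<phi> 0 = 1"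
    and add: "\<And>a b. a \<in> dual_monoid \<tau> \<Longrightarrow> b \<in> dual_monoid \<tau> \<Longrightarrow> \<phi> (a + b) = \<phi> a * \<phi> b"
    and out: "\<And>a. a \<notin> dual_monoid \<tau> \<Longrightarrow> \<phi> a = 0"
    and nz: "\<And>a. a \<in> dual_monoid \<tau> \<Longrightarrow> \<phi> a \<noteq> 0 \<longleftrightarrow> (\<forall>v\<in>\<tau>. of_ivec a \<bullet> v = 0)"
    using assms by (auto simp: toric_chart_def affine_piece_def toric_variety_def p)
  have "\<exists>S. \<tau> = convex_cone hull (of_ivec ` S)"
    using \<open>\<tau> \<in> \<Sigma>\<close> smooth_fan unfolding smooth_fan_def by metis
  then have "\<tau> \<noteq> {}" using convex_cone_hull_nonempty by auto
  then obtain J where J: "J \<subseteq> K" "\<tau> = cone J" using face_of_coneE[OF \<tau>] by blast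
  have w: "w $ k = \<phi> (B' k)" for k by (simp add: w_def toric_chart_def p)
  have zero: "w $ k = 0 \<longleftrightarrow> k \<in> J" for k
  proof -
    have "\<phi> (B' k) \<noteq> 0 \<longleftrightarrow> (\<forall>j\<in>J. pairing (B' k) (B j) = 0)"
      using nz[of "B' k"] dual_basis_in_dual_monoid[of k J] by (simp add: J(2) annihilator_cone)
    also have "\<dots> \<longleftrightarrow> k \<notin> J" by (auto simp: pairing_dual)
    finally show ?thesis by (auto simp: w)
  qed
  then show "k \<notin> K \<Longrightarrow> snd chart p $ k \<noteq> 0" using J by (auto simp: w_def)
  have J': "zero_set w = J" using zero by (auto simp: zero_set_def)
  have in_J: "a \<in> dual_monoid \<tau> \<longleftrightarrow> (\<forall>k\<in>J. 0 \<le> pairing a (B k))" for a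
    by (simp add: J(2) dual_monoid_cone)
  have pair_smult: "pairing (x *s B' k) (B j) = (if k = j then x else 0)" for x k j
  proof -
    have "pairing (x *s B' k) (B j) = x * pairing (B' k) (B j)"
      by (simp add: pairing_def sum_distrib_left mult.assoc)
    then show ?thesis by (simp add: pairing_dual)
  qed
  have nat_mult: "\<phi> (int n *s B' k) = (w $ k) ^ n" for n k
  proof (induction n)
    case 0 then show ?case by (simp add: \<phi>0 vector_scalar_mult_def zero_vec_def[symmetric])
  next
    case (Suc n)
    have "int (Suc n) *s B' k = B' k + int n *s B' k" by (simp add: vec_eq_iff algebra_simps)
    then show ?case
      using add[of "B' k" "int n *s B' k"] Suc by (simp add: in_J pairing_dual pair_smult w)
  qed
  have int_mult: "\<phi> (x *s B' k) = (w $ k) powi x" if "k \<in> J \<Longrightarrow> 0 \<le> x" for x k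
  proof (cases "0 \<le> x")
    case True
    then show ?thesis using nat_mult[of "nat x" k] by (simp add: power_int_def)
  next
    case False
    then have "k \<notin> J" using that by auto
    have "x *s B' k + int (nat (- x)) *s B' k = 0" using False by (simp add: vec_eq_iff)
    moreover have "x *s B' k \<in> dual_monoid \<tau>" "int (nat (- x)) *s B' k \<in> dual_monoid \<tau>"
      using \<open>k \<notin> J\<close> by (auto simp: in_J pair_smult)
    ultimately have "\<phi> (x *s B' k) * (w $ k) ^ nat (- x) = 1"
      using add[of "x *s B' k" "int (nat (- x)) *s B' k"] nat_mult[of "nat (- x)" k] \<phi>0 by simp
    then have "\<phi> (x *s B' k) = inverse ((w $ k) ^ nat (- x))" by (metis inverse_unique mult.commute)
    then show ?thesis using False by (simp add: power_int_def power_inverse)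
  qed
  have "\<phi> a = (\<Prod>k\<in>UNIV. (w $ k) powi pairing a (B k))" if a: "a \<in> dual_monoid \<tau>" for a
  proof -
    have "(\<Sum>k\<in>T. pairing a (B k) *s B' k) \<in> dual_monoid \<tau> \<and>
        \<phi> (\<Sum>k\<in>T. pairing a (B k) *s B' k) = (\<Prod>k\<in>T. (w $ k) powi pairing a (B k))" if "finite T" for T
      using that
    proof (induction T)
      case empty then show ?case by (simp add: \<phi>0 in_J)
    next
      case (insert k T)
      have "pairing a (B k) *s B' k \<in> dual_monoid \<tau>" using a by (auto simp: in_J pair_smult)
      moreover have "\<phi> (pairing a (B k) *s B' k) = (w $ k) powi pairing a (B k)"
        using a by (intro int_mult) (auto simp: in_J)
      ultimately show ?case using insert add by (auto simp: in_J pairing_add)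
    qed
    from this[of UNIV] show ?thesis by (simp add: dual_bases_expand_lattice[OF dual])
  qed
  then have "chart_point w = p"
    unfolding chart_point_def J' p J(2)[symmetric] using out by auto
  then show "chart_point (snd chart p) = p" by (simp add: w_def)
qed

lemma chart_image_eq: "chart_image chart = {w. \<forall>k. k \<notin> K \<longrightarrow> w $ k \<noteq> 0}"
proof
  show "chart_image chart \<subseteq> {w. \<forall>k. k \<notin> K \<longrightarrow> w $ k \<noteq> 0}"
    using chart_point_snd_chart(2) by (auto simp: chart_image_def)
  show "{w. \<forall>k. k \<notin> K \<longrightarrow> w $ k \<noteq> 0} \<subseteq> chart_image chart"
  proof
    fix w :: "complex^'m" assume "w \<in> {w. \<forall>k. k \<notin> K \<longrightarrow> w $ k \<noteq> 0}"
    then have "chart_point w \<in> fst chart" by (intro chart_point_in) auto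
    then have "snd chart (chart_point w) \<in> chart_image chart" unfolding chart_image_def by (rule imageI)
    then show "w \<in> chart_image chart" by (simp only: snd_chart_chart_point)
  qed
qed

lemma inj_on_chart: "inj_on (snd chart) (fst chart)"
  by (rule inj_on_inverseI[of _ chart_point]) (rule chart_point_snd_chart(1))

lemma chart_inv_chart: "p \<in> fst chart \<Longrightarrow> chart_inv chart (snd chart p) = p"
  by (simp add: chart_inv_def inj_on_chart)

lemma chart_inv_eq:
  assumes "w \<in> chart_image chart" shows "chart_inv chart w = chart_point w"
proof -
  have "chart_point w \<in> fst chart" using assms by (intro chart_point_in) (auto simp: chart_image_eq)
  from chart_inv_chart[OF this] show ?thesis by (simp only: snd_chart_chart_point)
qed

lemma chart_in_atlas: "chart \<in> toric_atlas \<Sigma>"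
  using cone_in_fan dual by (auto simp: toric_atlas_def)

lemma open_chart_image: "open (chart_image chart)"
proof -
  have "chart_image chart = (\<Inter>k\<in>-K. (\<lambda>w. w $ k) -` (- {0}))" by (auto simp: chart_image_eq)
  moreover have "open ((\<lambda>w::complex^'m. w $ k) -` (- {0}))" for k
    by (intro open_vimage continuous_intros)
  ultimately show ?thesis by (auto intro: open_INT)
qed

end

lemma toric_atlasE:
  assumes "smooth_fan \<Sigma>" "c \<in> toric_atlas \<Sigma>"
  obtains B B' K where "smooth_cone \<Sigma> B B' K" "c = toric_chart \<Sigma> (convex_cone hull (of_ivec ` B ` K)) B'"
  using assms unfolding toric_atlas_def smooth_cone_def by blast

lemma toric_variety_covered:
  assumes "smooth_fan \<Sigma>" "p \<in> toric_variety \<Sigma>"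
  shows "\<exists>c\<in>toric_atlas \<Sigma>. p \<in> fst c"
proof -
  have "fst p \<in> \<Sigma>" using assms(2) by (auto simp: toric_variety_def)
  then obtain B B' K where *: "dual_bases B B'" "fst p = convex_cone hull (of_ivec ` B ` K)"
    using assms(1) unfolding smooth_fan_def by meson
  then have "toric_chart \<Sigma> (fst p) B' \<in> toric_atlas \<Sigma>"
    using \<open>fst p \<in> \<Sigma>\<close> by (auto simp: toric_atlas_def)
  moreover have "p \<in> fst (toric_chart \<Sigma> (fst p) B')"
    using assms(2) *(2) face_of_refl[OF convex_convex_cone_hull] by (simp add: toric_chart_def affine_piece_def)
  ultimately show ?thesis by blast
qed


section \<open>The torus action in toric charts\<close>

lemma monomial_nonzero: "(\<And>i. u $ i \<noteq> 0) \<Longrightarrow> monomial u a \<noteq> 0"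
  by (simp add: monomial_def)

lemma monomial_zero_exponent [simp]: "monomial u 0 = 1"
  by (simp add: monomial_def)

lemma monomial_add: "(\<And>i. u $ i \<noteq> 0) \<Longrightarrow> monomial u (a + b) = monomial u a * monomial u b"
  by (simp add: monomial_def power_int_add prod.distrib)

lemma monomial_mult: "monomial (u * u') a = monomial u a * monomial u' a"
  by (simp add: monomial_def power_int_mult_distrib prod.distrib)

lemma monomial_exp: "monomial (\<chi> i. exp (z i)) a = exp (\<Sum>i\<in>UNIV. of_int (a $ i) * z i)"
  by (simp add: monomial_def exp_sum exp_power_int mult.commute)

lemma torus_exp_nonzero: "torus_exp v $ i \<noteq> 0"
  by (simp add: torus_exp_def)

lemma torus_exp_in_real_torus: "torus_exp v \<in> real_torus"
  by (simp add: torus_exp_def real_torus_def norm_exp_eq_Re)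

lemma monomial_torus_exp: "monomial (torus_exp v) a = exp (2 * pi * \<i> * of_real (of_ivec a \<bullet> v))"
  unfolding torus_exp_def monomial_exp inner_of_ivec
  by (simp add: sum_distrib_left mult_ac)

lemma torus_exp_add: "torus_exp (v + w) = torus_exp v * torus_exp w"
  by (simp add: torus_exp_def vec_eq_iff exp_add[symmetric] algebra_simps)

lemma real_torus_nonzero: "u \<in> real_torus \<Longrightarrow> u $ i \<noteq> 0"
  by (auto simp: real_torus_def dest: spec[of _ i])

lemma fst_torus_act [simp]: "fst (torus_act u p) = fst p"
  by (simp add: torus_act_def)

lemma torus_act_mult: "torus_act u (torus_act u' p) = torus_act (u * u') p"
  by (simp add: torus_act_def monomial_mult mult.assoc)

lemma torus_act_one: "torus_act 1 p = p"
  by (simp add: torus_act_def monomial_def)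

lemma torus_act_toric_variety:
  assumes "\<And>i. u $ i \<noteq> 0" "p \<in> toric_variety \<Sigma>"
  shows "torus_act u p \<in> toric_variety \<Sigma>"
  using assms(2) monomial_nonzero[OF assms(1)] monomial_add[OF assms(1)]
  by (auto simp: toric_variety_def torus_act_def)

lemma torus_act_toric_variety_iff:
  assumes u: "\<And>i. u $ i \<noteq> 0"
  shows "torus_act u p \<in> toric_variety \<Sigma> \<longleftrightarrow> p \<in> toric_variety \<Sigma>"
proof
  assume *: "torus_act u p \<in> toric_variety \<Sigma>"
  let ?u = "(\<chi> i. inverse (u $ i)) :: complex^_"
  have "?u * u = 1" using u by (simp add: vec_eq_iff)
  then have "torus_act ?u (torus_act u p) = p" by (simp add: torus_act_mult torus_act_one)
  moreover have "torus_act ?u (torus_act u p) \<in> toric_variety \<Sigma>"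
    using u by (intro torus_act_toric_variety *) simp
  ultimately show "p \<in> toric_variety \<Sigma>" by simp
qed (rule torus_act_toric_variety[OF u])

lemma torus_act_in_chart_iff:
  assumes "\<And>i. u $ i \<noteq> 0" "c \<in> toric_atlas \<Sigma>"
  shows "torus_act u p \<in> fst c \<longleftrightarrow> p \<in> fst c"
proof -
  obtain \<sigma> C where "c = toric_chart \<Sigma> \<sigma> C" using assms(2) by (auto simp: toric_atlas_def)
  then show ?thesis
    using torus_act_toric_variety_iff[OF assms(1), of p] by (simp add: toric_chart_def affine_piece_def)
qed

text \<open>The torus preserves the orbits and therefore the domains of the toric charts.\<close>
lemma chart_at_torus_act:
  assumes "\<And>i. u $ i \<noteq> 0"
  shows "chart_at (toric_atlas \<Sigma>) (torus_act u p) = chart_at (toric_atlas \<Sigma>) p"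
  using torus_act_in_chart_iff[OF assms] by (simp add: chart_at_def cong: conj_cong)

lemma chart_at_toric_atlas:
  assumes "smooth_fan \<Sigma>" "p \<in> toric_variety \<Sigma>"
  shows "chart_at (toric_atlas \<Sigma>) p \<in> toric_atlas \<Sigma>" "p \<in> fst (chart_at (toric_atlas \<Sigma>) p)"
proof -
  have "\<exists>d. d \<in> toric_atlas \<Sigma> \<and> p \<in> fst d" using toric_variety_covered[OF assms] by blast
  from someI_ex[OF this]
  show "chart_at (toric_atlas \<Sigma>) p \<in> toric_atlas \<Sigma>" "p \<in> fst (chart_at (toric_atlas \<Sigma>) p)"
    by (simp_all add: chart_at_def)
qed

lemma has_derivative_vec_lambda:
  fixes f :: "'m::finite \<Rightarrow> 'a::real_normed_vector \<Rightarrow> complex"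
  assumes "\<And>j. (f j has_derivative D j) F"
  shows "((\<lambda>x. \<chi> j. f j x) has_derivative (\<lambda>h. \<chi> j. D j h)) F"
proof -
  define l :: "'m \<Rightarrow> complex \<Rightarrow> complex^'m" where "l j z = (\<chi> i. if i = j then z else 0)" for j z
  have l: "bounded_linear (l j)" for j
    unfolding linear_conv_bounded_linear[symmetric]
    by (rule linearI) (auto simp: l_def vec_eq_iff)
  have "((\<lambda>x. \<Sum>j\<in>UNIV. l j (f j x)) has_derivative (\<lambda>h. \<Sum>j\<in>UNIV. l j (D j h))) F"
    by (intro has_derivative_sum bounded_linear.has_derivative[OF l] assms)
  moreover have "(\<Sum>j\<in>UNIV. l j (y j)) = (\<chi> j. y j)" for y
    by (simp add: l_def vec_eq_iff)
  ultimately show ?thesis by simp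
qed

context smooth_cone
begin

definition torus_coords :: "complex^'m \<Rightarrow> complex^'m" where
  "torus_coords u = (\<chi> j. monomial u (B' j))"

lemma snd_chart_torus_act: "snd chart (torus_act u p) = torus_coords u * snd chart p"
  by (simp add: toric_chart_def torus_act_def torus_coords_def vec_eq_iff)

lemma torus_coords_nonzero: "(\<And>i. u $ i \<noteq> 0) \<Longrightarrow> torus_coords u $ j \<noteq> 0"
  by (simp add: torus_coords_def monomial_nonzero)

lemma torus_coords_torus_exp:
  "torus_coords (torus_exp v) $ j = exp (2 * pi * \<i> * of_real (of_ivec (B' j) \<bullet> v))"
  by (simp add: torus_coords_def monomial_torus_exp)

lemma chart_inv_in: "w \<in> chart_image chart \<Longrightarrow> chart_inv chart w \<in> fst chart"
  using chart_point_in[of w] by (simp add: chart_inv_eq) (simp add: chart_image_eq)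

lemma snd_chart_chart_inv: "w \<in> chart_image chart \<Longrightarrow> snd chart (chart_inv chart w) = w"
  by (simp add: chart_inv_eq snd_chart_chart_point)

lemma snd_chart_in: "p \<in> fst chart \<Longrightarrow> snd chart p \<in> chart_image chart"
  by (simp add: chart_image_def)

lemma torus_act_chart_inv:
  assumes u: "\<And>i. u $ i \<noteq> 0" and w: "w \<in> chart_image chart"
  shows "torus_act u (chart_inv chart w) = chart_inv chart (torus_coords u * w)"
proof -
  have "torus_act u (chart_inv chart w) \<in> fst chart"
    using torus_act_in_chart_iff[OF u chart_in_atlas] chart_inv_in[OF w] by blast
  from chart_inv_chart[OF this] show ?thesis
    by (simp add: snd_chart_torus_act snd_chart_chart_inv[OF w])
qed

text \<open>Changes between toric charts are given by Laurent monomials that involve negative powers only of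
  nonvanishing coordinates.\<close>
lemma transition_monomial:
  fixes C C' :: "'m \<Rightarrow> int^'m"
  assumes C: "smooth_cone \<Sigma> C C' H"
  defines "d \<equiv> toric_chart \<Sigma> (convex_cone hull (of_ivec ` C ` H)) C'"
  assumes p: "p \<in> fst chart" "p \<in> fst d"
  shows "\<And>j k. snd chart p $ k = 0 \<Longrightarrow> 0 \<le> pairing (C' j) (B k)"
    and "\<exists>N. open N \<and> snd chart p \<in> N \<and> N \<subseteq> chart_image chart \<and>
      (\<forall>w\<in>N. chart_inv chart w \<in> fst d \<and>
        snd d (chart_inv chart w) = (\<chi> j. \<Prod>k\<in>UNIV. (w $ k) powi pairing (C' j) (B k)))"
proof -
  let ?\<sigma> = "convex_cone hull (of_ivec ` C ` H)"
  define w0 where "w0 = snd chart p"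
  have "fst p = cone (zero_set w0)"
    using arg_cong[OF chart_point_snd_chart(1)[OF p(1)], of fst] by (simp add: w0_def chart_point_def)
  then have face0: "cone (zero_set w0) face_of ?\<sigma>"
    using p(2) by (simp add: d_def toric_chart_def affine_piece_def)
  have nonneg: "0 \<le> of_ivec (C' j) \<bullet> x" if "x \<in> ?\<sigma>" for x j
    using that unfolding simplicial_cone_eq[OF smooth_cone.dual[OF C]] by (cases "j \<in> H") auto
  show "0 \<le> pairing (C' j) (B k)" if "snd chart p $ k = 0" for j k
  proof -
    have "of_ivec (B k) \<in> cone (zero_set w0)"
      using that generator_in_cone_iff by (simp add: zero_set_def w0_def)
    then have "of_ivec (B k) \<in> ?\<sigma>" using face_of_imp_subset[OF face0] by blast
    from nonneg[OF this, of j] show ?thesis by (simp add: inner_of_ivec_of_ivec)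
  qed
  define N where "N = {w :: complex^'m. \<forall>k. w0 $ k \<noteq> 0 \<longrightarrow> w $ k \<noteq> 0}"
  have "N = (\<Inter>k\<in>{k. w0 $ k \<noteq> 0}. (\<lambda>w. w $ k) -` (- {0}))" by (auto simp: N_def)
  moreover have "open ((\<lambda>w::complex^'m. w $ k) -` (- {0}))" for k
    by (intro open_vimage continuous_intros)
  ultimately have "open N" by (auto intro: open_INT)
  moreover have "w0 \<in> N" by (simp add: N_def)
  moreover have "N \<subseteq> chart_image chart"
    using chart_point_snd_chart(2)[OF p(1)] by (auto simp: N_def chart_image_eq w0_def)
  moreover have "chart_inv chart w \<in> fst d \<and>
        snd d (chart_inv chart w) = (\<chi> j. \<Prod>k\<in>UNIV. (w $ k) powi pairing (C' j) (B k))"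
    if "w \<in> N" for w
  proof -
    have w: "w \<in> chart_image chart" using that \<open>N \<subseteq> chart_image chart\<close> by blast
    have "cone (zero_set w) face_of cone (zero_set w0)"
      using that by (intro cone_face_of) (auto simp: zero_set_def N_def)
    then have face: "cone (zero_set w) face_of ?\<sigma>" using face0 face_of_trans by blast
    have "C' j \<in> dual_monoid (cone (zero_set w))" for j
      using nonneg face_of_imp_subset[OF face] by (auto simp: dual_monoid_def)
    then have "snd d (chart_inv chart w) = (\<chi> j. \<Prod>k\<in>UNIV. (w $ k) powi pairing (C' j) (B k))"
      unfolding chart_inv_eq[OF w] by (simp add: d_def toric_chart_def chart_point_coord)
    moreover have "chart_inv chart w \<in> fst d"
      using chart_inv_in[OF w] face
      unfolding chart_inv_eq[OF w]
      by (simp add: d_def toric_chart_def affine_piece_def) (simp add: chart_point_def)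
    ultimately show ?thesis by blast
  qed
  ultimately show "\<exists>N. open N \<and> snd chart p \<in> N \<and> N \<subseteq> chart_image chart \<and>
      (\<forall>w\<in>N. chart_inv chart w \<in> fst d \<and>
        snd d (chart_inv chart w) = (\<chi> j. \<Prod>k\<in>UNIV. (w $ k) powi pairing (C' j) (B k)))"
    unfolding w0_def by blast
qed

lemma transition_differentiable:
  assumes d: "d \<in> toric_atlas \<Sigma>" and p: "p \<in> fst chart" "p \<in> fst d"
  shows "(snd d \<circ> chart_inv chart) differentiable (at (snd chart p))"
proof -
  obtain C C' H where C: "smooth_cone \<Sigma> C C' H"
    and d: "d = toric_chart \<Sigma> (convex_cone hull (of_ivec ` C ` H)) C'"
    using toric_atlasE[OF smooth_fan d] by blast
  define w0 where "w0 = snd chart p"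
  note * = transition_monomial[OF C p[unfolded d], folded d w0_def]
  obtain N where N: "open N" "w0 \<in> N"
    "\<And>w. w \<in> N \<Longrightarrow> snd d (chart_inv chart w) = (\<chi> j. \<Prod>k\<in>UNIV. (w $ k) powi pairing (C' j) (B k))"
    using *(2) by blast
  have "\<exists>D. ((\<lambda>w. (w $ k) powi pairing (C' j) (B k)) has_derivative D) (at w0)" for j k
  proof -
    have lin: "((\<lambda>w::complex^'m. w $ k) has_derivative (\<lambda>w. w $ k)) (at w0)"
      by (rule bounded_linear_imp_has_derivative) (rule bounded_linear_vec_nth)
    show ?thesis
    proof (cases "w0 $ k = 0")
      case True
      then have "0 \<le> pairing (C' j) (B k)" using *(1) by blast
      then have "(\<lambda>w::complex^'m. (w $ k) powi pairing (C' j) (B k)) = (\<lambda>w. (w $ k) ^ nat (pairing (C' j) (B k)))"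
        by (simp add: power_int_nonneg_exp)
      then show ?thesis using has_derivative_power[OF lin] by auto
    next
      case False
      then show ?thesis using has_derivative_power_int[OF _ lin] by blast
    qed
  qed
  then have "\<forall>j k. \<exists>D. ((\<lambda>w. (w $ k) powi pairing (C' j) (B k)) has_derivative D) (at w0)" by blast
  then obtain D where "\<And>j k. ((\<lambda>w. (w $ k) powi pairing (C' j) (B k)) has_derivative D j k) (at w0)"
    unfolding choice_iff by blast
  then have "((\<lambda>w. \<chi> j. \<Prod>k\<in>UNIV. (w $ k) powi pairing (C' j) (B k)) has_derivative
     (\<lambda>h. \<chi> j. \<Sum>k\<in>UNIV. D j k h * (\<Prod>i\<in>UNIV - {k}. (w0 $ i) powi pairing (C' j) (B i)))) (at w0)"
    by (intro has_derivative_vec_lambda has_derivative_prod)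
  then have "((snd d \<circ> chart_inv chart) has_derivative
     (\<lambda>h. \<chi> j. \<Sum>k\<in>UNIV. D j k h * (\<Prod>i\<in>UNIV - {k}. (w0 $ i) powi pairing (C' j) (B i)))) (at w0)"
    by (rule has_derivative_transform_within_open[OF _ N(1,2)]) (simp add: N(3))
  then show ?thesis unfolding w0_def differentiable_def by blast
qed

lemma orbit_smooth_cone: "smooth_cone \<Sigma> (\<lambda>j. axis j 1) (\<lambda>j. axis j 1) {}"
proof
  show "dual_bases (\<lambda>j. axis j 1) (\<lambda>j::'m. axis j 1 :: int^'m)"
    unfolding dual_bases_def
  proof (intro allI)
    fix j k :: 'm
    have "(\<Sum>i\<in>UNIV. axis j 1 $ i * axis k 1 $ i :: int) = (\<Sum>i\<in>UNIV. if i = j then if j = k then 1 else 0 else 0)"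
      by (intro sum.cong) (auto simp: axis_def)
    then show "(\<Sum>i\<in>UNIV. axis j 1 $ i * axis k 1 $ i :: int) = (if j = k then 1 else 0)" by simp
  qed
  show "convex_cone hull of_ivec ` (\<lambda>j. axis j 1) ` {} \<in> \<Sigma>"
    using cone_in_fan_subset[of "{}"] by simp
qed (rule smooth_fan)

lemma orbit_point_in_chart:
  assumes "\<And>i. w $ i \<noteq> 0"
  shows "orbit_point w \<in> fst chart" "orbit_point w \<in> fst (orbit_chart \<Sigma>)"
    "chart_inv (orbit_chart \<Sigma>) w = orbit_point w"
proof -
  interpret o: smooth_cone \<Sigma> "\<lambda>j. axis j 1" "\<lambda>j. axis j 1" "{}" by (rule orbit_smooth_cone)
  have chart: "orbit_chart \<Sigma> = o.chart" by (simp add: orbit_chart_def)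
  have pair: "pairing a (axis k 1) = a $ k" for a :: "int^'m" and k
    by (simp add: pairing_def axis_def if_distrib cong: if_cong)
  have zero: "o.zero_set w = {}" using assms by (simp add: o.zero_set_def)
  have "o.chart_point w = orbit_point w"
    using o.dual_monoid_cone[of "{}"]
    by (simp add: o.chart_point_def zero orbit_point_def monomial_def pair fun_eq_iff)
  moreover have w: "w \<in> chart_image o.chart" unfolding o.chart_image_eq using assms by simp
  ultimately show inv: "chart_inv (orbit_chart \<Sigma>) w = orbit_point w"
    unfolding chart using o.chart_inv_eq by simp
  show *: "orbit_point w \<in> fst (orbit_chart \<Sigma>)"
    using o.chart_inv_in[OF w] inv by (simp add: chart)
  have "{0} face_of cone K" using cone_face_of[of "{}" K] by simp
  then show "orbit_point w \<in> fst chart"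
    using * by (simp add: orbit_chart_def toric_chart_def affine_piece_def) (simp add: orbit_point_def)
qed

lemma snd_chart_orbit_point:
  "snd chart (orbit_point (\<chi> i. exp (z i))) = (\<chi> k. exp (\<Sum>i\<in>UNIV. of_int (B' k $ i) * z i))"
  by (simp add: toric_chart_def orbit_point_def monomial_exp)

text \<open>In logarithmic coordinates the change from the orbit chart is linear.\<close>
lemma coord_deriv_orbit_chart:
  fixes z :: "complex^'m"
  shows "coord_deriv id (orbit_chart \<Sigma>) chart (orbit_point (\<chi> i. exp (z $ i))) (\<chi> i. exp (z $ i) * Y $ i)
    = (\<chi> k. exp (\<Sum>i\<in>UNIV. of_int (B' k $ i) * z $ i) * (\<Sum>i\<in>UNIV. of_int (B' k $ i) * Y $ i))"
proof -
  interpret o: smooth_cone \<Sigma> "\<lambda>j. axis j 1" "\<lambda>j. axis j 1" "{}" by (rule orbit_smooth_cone)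
  have chart: "orbit_chart \<Sigma> = o.chart" by (simp add: orbit_chart_def)
  define E :: "complex^'m \<Rightarrow> complex^'m" where "E z = (\<chi> i. exp (z $ i))" for z
  let ?p = "orbit_point (E z)"
  define \<tau> where "\<tau> = snd chart \<circ> chart_inv o.chart"
  have E0: "E y $ i \<noteq> 0" for y i by (simp add: E_def)
  note op = orbit_point_in_chart[OF E0, unfolded chart]
  have "snd o.chart ?p = E z"
    using o.snd_chart_chart_inv[of "E z", unfolded o.chart_image_eq] E0 by (simp add: op(3)[of z, symmetric])
  then have "\<tau> differentiable (at (E z))"
    using o.transition_differentiable[OF chart_in_atlas op(2) op(1), of z] by (simp add: \<tau>_def)
  then have \<tau>': "(\<tau> has_derivative frechet_derivative \<tau> (at (E z))) (at (E z))"
    by (simp add: frechet_derivative_works)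
  have nth: "((\<lambda>w::complex^'m. w $ k) has_derivative (\<lambda>w. w $ k)) (at z)" for k
    by (rule bounded_linear_imp_has_derivative) (rule bounded_linear_vec_nth)
  have exp': "((\<lambda>z. exp (f z)) has_derivative (\<lambda>Y. exp (f z) * f' Y)) (at z)"
    if "(f has_derivative f') (at z)" for f f' :: "complex^'m \<Rightarrow> complex"
    using has_derivative_compose[OF that, of exp] DERIV_exp[of "f z"]
    by (simp add: has_field_derivative_def)
  have "(E has_derivative (\<lambda>Y. \<chi> i. exp (z $ i) * Y $ i)) (at z)"
    unfolding E_def by (intro has_derivative_vec_lambda exp' nth)
  from has_derivative_compose[OF this \<tau>']
  have D1: "((\<lambda>z. \<tau> (E z)) has_derivative
      (\<lambda>Y. frechet_derivative \<tau> (at (E z)) (\<chi> i. exp (z $ i) * Y $ i))) (at z)" .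
  have "(\<lambda>z. \<tau> (E z)) = (\<lambda>z. \<chi> k. exp (\<Sum>i\<in>UNIV. of_int (B' k $ i) * z $ i))"
    using snd_chart_orbit_point op(3) by (simp add: \<tau>_def fun_eq_iff E_def)
  moreover have "((\<lambda>z. \<chi> k. exp (\<Sum>i\<in>UNIV. of_int (B' k $ i) * z $ i)) has_derivative
     (\<lambda>Y. \<chi> k. exp (\<Sum>i\<in>UNIV. of_int (B' k $ i) * z $ i) * (\<Sum>i\<in>UNIV. of_int (B' k $ i) * Y $ i))) (at z)"
    by (intro has_derivative_vec_lambda exp' has_derivative_sum has_derivative_mult_right nth)
  ultimately have "(\<lambda>Y. frechet_derivative \<tau> (at (E z)) (\<chi> i. exp (z $ i) * Y $ i))
     = (\<lambda>Y. \<chi> k. exp (\<Sum>i\<in>UNIV. of_int (B' k $ i) * z $ i) * (\<Sum>i\<in>UNIV. of_int (B' k $ i) * Y $ i))"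
    using has_derivative_unique[OF D1] by simp
  moreover have "coord_deriv id (orbit_chart \<Sigma>) chart (orbit_point (\<chi> i. exp (z $ i)))
      = frechet_derivative \<tau> (at (E z))"
    using \<open>snd o.chart ?p = E z\<close> by (simp add: coord_deriv_def \<tau>_def chart E_def)
  ultimately show ?thesis by metis
qed

lemma chart_point_orbit:
  assumes "p \<in> fst chart" "\<And>k. snd chart p $ k \<noteq> 0"
  obtains z where "p = orbit_point (\<chi> i. exp (z $ i))"
proof
  define y where "y k = Ln (snd chart p $ k)" for k
  define z :: "complex^'m" where "z = (\<chi> i. \<Sum>k\<in>UNIV. of_int (B k $ i) * y k)"
  have "(\<Sum>i\<in>UNIV. of_int (B' j $ i) * z $ i) = y j" for j
  proof -
    have "(\<Sum>i\<in>UNIV. of_int (B' j $ i) * z $ i) = (\<Sum>k\<in>UNIV. of_int (pairing (B' j) (B k)) * y k)"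
      by (simp add: z_def sum_distrib_left pairing_def sum_distrib_right mult.assoc) (rule sum.swap)
    then show ?thesis by (simp add: pairing_dual if_distrib if_distribR cong: if_cong)
  qed
  then have "snd chart (orbit_point (\<chi> i. exp (z $ i))) = snd chart p"
    unfolding snd_chart_orbit_point using assms(2) by (simp add: vec_eq_iff y_def)
  moreover have "orbit_point (\<chi> i. exp (z $ i)) \<in> fst chart" by (intro orbit_point_in_chart) simp
  ultimately show "p = orbit_point (\<chi> i. exp (z $ i))"
    using inj_on_chart assms(1) by (auto dest: inj_onD)
qed

end



section \<open>Toric Kaehler manifolds in toric charts\<close>

definition complexify :: "real^'m \<Rightarrow> complex^'m" where
  "complexify x = (\<chi> j. of_real (x $ j))"

lemma complexify_nth [simp]: "complexify x $ j = of_real (x $ j)"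
  by (simp add: complexify_def)

lemma linear_complexify: "linear complexify"
  by (rule linearI) (simp_all add: vec_eq_iff, simp add: scaleR_conv_of_real)

lemma bounded_linear_complexify: "bounded_linear complexify"
  using linear_complexify by (simp add: linear_conv_bounded_linear)

text \<open>Points of the open orbit that converge to \<open>w\<close>; identities on the open orbit extend along them. They are
  real if \<open>w\<close> is.\<close>
definition perturb :: "complex^'m \<Rightarrow> nat \<Rightarrow> complex^'m" where
  "perturb w n = (\<chi> k. if w $ k = 0 then of_real (inverse (real (Suc n))) else w $ k)"

lemma perturb_nonzero: "perturb w n $ k \<noteq> 0"
  by (simp add: perturb_def del: of_real_inverse of_nat_Suc)

lemma perturb_tendsto: "perturb w \<longlonglongrightarrow> w"
proof (rule vec_tendstoI)
  fix k
  have "(\<lambda>n. of_real (inverse (real (Suc n))) :: complex) \<longlonglongrightarrow> of_real 0"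
    by (intro tendsto_of_real LIMSEQ_inverse_real_of_nat)
  then show "(\<lambda>n. perturb w n $ k) \<longlonglongrightarrow> w $ k"
    by (cases "w $ k = 0") (simp_all add: perturb_def)
qed

lemma perturb_complexify: "perturb (complexify r) n = complexify (\<chi> k. if r $ k = 0 then inverse (real (Suc n)) else r $ k)"
  by (simp add: vec_eq_iff perturb_def)

context smooth_cone
begin

lemma perturb_in: "perturb w n \<in> chart_image chart"
  using perturb_nonzero[of w n] by (simp add: chart_image_eq)

lemma perturb_limit:
  assumes "continuous_on (chart_image chart) f" "w \<in> chart_image chart"
  shows "(\<lambda>n. f (perturb w n)) \<longlonglongrightarrow> f w"
  by (rule continuous_on_tendsto_compose[OF assms(1) perturb_tendsto assms(2)]) (simp add: perturb_in)

text \<open>The vector field generated by \<open>v\<close>; the action is diagonal, so its components decouple.\<close>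
definition rotation :: "real^'m \<Rightarrow> complex^'m \<Rightarrow> complex^'m" where
  "rotation v z = (\<chi> j. 2 * pi * \<i> * of_real (of_ivec (B' j) \<bullet> v) * z $ j)"

lemma torus_flow_derivative:
  "((\<lambda>t. snd chart (torus_act (torus_exp (t *\<^sub>R v)) p)) has_derivative
      (\<lambda>h. h *\<^sub>R rotation v (snd chart (torus_act (torus_exp (t *\<^sub>R v)) p)))) (at t)"
proof -
  define a where "a j = 2 * pi * \<i> * of_real (of_ivec (B' j) \<bullet> v)" for j
  define w where "w = snd chart p"
  have flow: "snd chart (torus_act (torus_exp (s *\<^sub>R v)) p) = (\<chi> j. exp (of_real s * a j) * w $ j)" for s
    by (simp add: snd_chart_torus_act vec_eq_iff torus_coords_torus_exp a_def w_def mult_ac)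
  have "((\<lambda>s. exp (of_real s * a j) * w $ j) has_derivative
      (\<lambda>h. (exp (of_real t * a j) * (of_real h * a j)) * w $ j)) (at t)" for j
  proof -
    have lin: "((\<lambda>s::real. of_real s * a j) has_derivative (\<lambda>h. of_real h * a j)) (at t)"
      by (intro has_derivative_mult_left has_derivative_of_real has_derivative_ident)
    have "((\<lambda>s. exp (of_real s * a j)) has_derivative (\<lambda>h. exp (of_real t * a j) * (of_real h * a j))) (at t)"
      using has_derivative_compose[OF lin, of exp] DERIV_exp[of "of_real t * a j"]
      by (simp add: has_field_derivative_def)
    then show ?thesis by (rule has_derivative_mult_left)
  qed
  from has_derivative_vec_lambda[OF this]
  have "((\<lambda>s. \<chi> j. exp (of_real s * a j) * w $ j) has_derivative
      (\<lambda>h. \<chi> j. (exp (of_real t * a j) * (of_real h * a j)) * w $ j)) (at t)" .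
  moreover have "(\<chi> j. (exp (of_real t * a j) * (of_real h * a j)) * w $ j) =
      h *\<^sub>R rotation v (\<chi> j. exp (of_real t * a j) * w $ j)" for h
    by (simp add: vec_eq_iff rotation_def a_def) (simp add: scaleR_conv_of_real)
  ultimately show ?thesis unfolding flow by simp
qed

lemma fundamental_vector_eq: "fundamental_vector v chart p = rotation v (snd chart p)"
proof -
  have "torus_act (torus_exp (0 *\<^sub>R v)) p = p"
    using torus_act_one by (simp add: torus_exp_def one_vec_def)
  then have "((\<lambda>t. snd chart (torus_act (torus_exp (t *\<^sub>R v)) p)) has_vector_derivative
      rotation v (snd chart p)) (at 0)"
    using torus_flow_derivative[of v p 0] by (simp add: has_vector_derivative_def)
  then show ?thesis unfolding fundamental_vector_def by (rule vector_derivative_at)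
qed

lemma rotation_torus_coords: "rotation v (torus_coords u * z) = torus_coords u * rotation v z"
  by (simp add: rotation_def vec_eq_iff)

lemma rotation_generator:
  "rotation (of_ivec (B k)) z = (\<i> * (2 * pi * z $ k)) *s axis k 1"
  by (auto simp: rotation_def vec_eq_iff inner_of_ivec_of_ivec pairing_dual axis_def)

lemma linear_torus_coords_mult: "bounded_linear (\<lambda>v. torus_coords u * v)"
  unfolding linear_conv_bounded_linear[symmetric]
  by (rule linearI) (simp_all add: vec_eq_iff algebra_simps)

text \<open>The action is linear in the source chart, so the differential of the action is followed by a change of charts.\<close>
lemma coord_deriv_torus_act:
  assumes u: "\<And>i. u $ i \<noteq> 0" and d: "d \<in> toric_atlas \<Sigma>" and p: "p \<in> fst chart" "p \<in> fst d"
  shows "coord_deriv (torus_act u) chart d p v = coord_deriv id chart d (torus_act u p) (torus_coords u * v)"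
proof -
  let ?w = "snd chart p" and ?\<tau> = "snd d \<circ> chart_inv chart"
  have up: "torus_act u p \<in> fst chart" "torus_act u p \<in> fst d"
    using torus_act_in_chart_iff[OF u] chart_in_atlas d p by auto
  have "(?\<tau> has_derivative frechet_derivative ?\<tau> (at (torus_coords u * ?w))) (at (torus_coords u * ?w))"
    using transition_differentiable[OF d up] unfolding snd_chart_torus_act
    by (rule frechet_derivative_works[THEN iffD1])
  from has_derivative_compose[OF bounded_linear_imp_has_derivative[OF linear_torus_coords_mult] this]
  have D: "((\<lambda>w. ?\<tau> (torus_coords u * w)) has_derivative
      (\<lambda>v. frechet_derivative ?\<tau> (at (torus_coords u * ?w)) (torus_coords u * v))) (at ?w)" .
  have "((snd d \<circ> torus_act u \<circ> chart_inv chart) has_derivative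
      (\<lambda>v. frechet_derivative ?\<tau> (at (torus_coords u * ?w)) (torus_coords u * v))) (at ?w)"
    by (rule has_derivative_transform_within_open[OF D open_chart_image snd_chart_in[OF p(1)]])
      (simp add: torus_act_chart_inv[OF u])
  from frechet_derivative_eqI[OF this] show ?thesis
    by (simp add: coord_deriv_def snd_chart_torus_act)
qed

end

locale toric_kahler_chart = smooth_cone \<Sigma> B B' K
  for \<Sigma> :: "(real^'m) set set" and B B' :: "'m \<Rightarrow> int^'m" and K :: "'m set" +
  fixes \<omega> g :: "('m tpoint, complex^'m) tensor2" and \<mu> :: "'m tpoint \<Rightarrow> real^'m"
    and \<kappa> :: "int^'m \<Rightarrow> real"
  assumes toric_kahler: "toric_kahler \<Sigma> \<omega> g \<mu> \<kappa>"
begin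

lemma
  assumes "p \<in> fst chart"
  shows bilinear_\<omega>: "bilinear (\<omega> chart p)" and bilinear_g: "bilinear (g chart p)"
    and g_sym: "g chart p v w = g chart p w v" and g_pos: "v \<noteq> 0 \<Longrightarrow> 0 < g chart p v v"
    and \<omega>_alt: "\<omega> chart p v v = 0"
    and g_J: "g chart p (\<i> *s v) (\<i> *s w) = g chart p v w"
    and \<omega>_eq: "\<omega> chart p v w = g chart p (\<i> *s v) w"
proof -
  have kahler: "kahler_structure (toric_atlas \<Sigma>) g \<omega>" using toric_kahler by (simp add: toric_kahler_def)
  then show "bilinear (\<omega> chart p)" "bilinear (g chart p)"
    using assms chart_in_atlas
    by (simp_all add: kahler_structure_def riemannian_metric_def closed_2form_def smooth_tensor2_def)
  show "g chart p v w = g chart p w v" and "v \<noteq> 0 \<Longrightarrow> 0 < g chart p v v"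
    using kahler assms chart_in_atlas unfolding kahler_structure_def riemannian_metric_def by blast+
  show "\<omega> chart p v v = 0"
    using kahler assms chart_in_atlas unfolding kahler_structure_def closed_2form_def by blast
  show "g chart p (\<i> *s v) (\<i> *s w) = g chart p v w" and "\<omega> chart p v w = g chart p (\<i> *s v) w"
    using kahler assms chart_in_atlas unfolding kahler_structure_def by blast+
qed

lemma moment_map_derivative:
  assumes "p \<in> fst chart"
  shows "((\<lambda>x. \<mu> (chart_inv chart x) \<bullet> v) has_derivative
    (\<lambda>w. - \<omega> chart p (rotation v (snd chart p)) w)) (at (snd chart p))"
  using assms toric_kahler chart_in_atlas
  unfolding toric_kahler_def moment_map_def fundamental_vector_eq[symmetric] by blast

lemma \<omega>_continuous: "continuous_on (chart_image chart) (\<lambda>x. \<omega> chart (chart_inv chart x) v w)"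
  using toric_kahler chart_in_atlas
  unfolding toric_kahler_def kahler_structure_def closed_2form_def smooth_tensor2_def
  by (intro smooth_on_imp_continuous_on) blast

lemma \<omega>_J: "p \<in> fst chart \<Longrightarrow> \<omega> chart p (\<i> *s v) (\<i> *s w) = \<omega> chart p v w"
  unfolding \<omega>_eq by (rule g_J)

lemma \<omega>_antisym:
  assumes p: "p \<in> fst chart" shows "\<omega> chart p v w = - \<omega> chart p w v"
proof -
  have "\<omega> chart p (v + w) (v + w) = 0" by (rule \<omega>_alt[OF p])
  moreover have "\<omega> chart p (v + w) (v + w) =
      \<omega> chart p v v + \<omega> chart p v w + (\<omega> chart p w v + \<omega> chart p w w)"
    by (simp only: bilinear_ladd[OF bilinear_\<omega>[OF p]] bilinear_radd[OF bilinear_\<omega>[OF p]])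
  ultimately show ?thesis using \<omega>_alt[OF p, of v] \<omega>_alt[OF p, of w] by linarith
qed

lemma g_eq: 
  assumes p: "p \<in> fst chart" shows "g chart p v w = - \<omega> chart p (\<i> *s v) w"
proof -
  have "\<i> *s (\<i> *s v) = - v" by (simp add: vec_eq_iff)
  then show ?thesis by (simp add: \<omega>_eq[OF p] bilinear_lneg[OF bilinear_g[OF p]])
qed

text \<open>Invariance is assumed for the pullback through a chosen chart around the image point. That chart is
  replaced by the given one because \<open>\<omega>\<close> is a tensor and changes of toric charts are differentiable.\<close>
lemma \<omega>_torus_act:
  assumes u: "u \<in> real_torus" and p: "p \<in> fst chart"
  shows "\<omega> chart (torus_act u p) (torus_coords u * v) (torus_coords u * w) = \<omega> chart p v w"
proof -
  note nz = real_torus_nonzero[OF u]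
  let ?d = "chart_at (toric_atlas \<Sigma>) (torus_act u p)"
  have up: "torus_act u p \<in> fst chart" using torus_act_in_chart_iff[OF nz chart_in_atlas] p by blast
  then have "torus_act u p \<in> toric_variety \<Sigma>" by (simp add: toric_chart_def affine_piece_def)
  note d = chart_at_toric_atlas[OF smooth_fan this]
  have pd: "p \<in> fst ?d" using torus_act_in_chart_iff[OF nz d(1)] d(2) by blast
  have "pullback2 (toric_atlas \<Sigma>) (torus_act u) \<omega> chart p v w = \<omega> chart p v w"
    using u p toric_kahler chart_in_atlas unfolding toric_kahler_def by blast
  moreover have "pullback2 (toric_atlas \<Sigma>) (torus_act u) \<omega> chart p v w =
     \<omega> ?d (torus_act u p) (coord_deriv id chart ?d (torus_act u p) (torus_coords u * v))
        (coord_deriv id chart ?d (torus_act u p) (torus_coords u * w))"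
    by (simp add: pullback2_def Let_def coord_deriv_torus_act[OF nz d(1) p pd])
  moreover have "\<dots> = \<omega> chart (torus_act u p) (torus_coords u * v) (torus_coords u * w)"
  proof -
    have "\<forall>c\<in>toric_atlas \<Sigma>. \<forall>d\<in>toric_atlas \<Sigma>. \<forall>p\<in>fst c \<inter> fst d. \<forall>v w.
        \<omega> c p v w = \<omega> d p (coord_deriv id c d p v) (coord_deriv id c d p w)"
    proof -
      have "smooth_tensor2 (toric_atlas \<Sigma>) \<omega>"
        using toric_kahler by (simp add: toric_kahler_def kahler_structure_def closed_2form_def)
      then show ?thesis unfolding smooth_tensor2_def by (elim conjE)
    qed
    then have "\<omega> chart (torus_act u p) v' w' = \<omega> ?d (torus_act u p)
        (coord_deriv id chart ?d (torus_act u p) v') (coord_deriv id chart ?d (torus_act u p) w')" for v' w'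
      using chart_in_atlas d(1) IntI[OF up d(2)] by blast
    then show ?thesis by simp
  qed
  ultimately show ?thesis by simp
qed

lemma g_torus_act:
  assumes u: "u \<in> real_torus" and p: "p \<in> fst chart"
  shows "g chart (torus_act u p) (torus_coords u * v) (torus_coords u * w) = g chart p v w"
proof -
  have up: "torus_act u p \<in> fst chart"
    using torus_act_in_chart_iff[OF real_torus_nonzero[OF u] chart_in_atlas] p by blast
  have "\<i> *s (torus_coords u * v) = torus_coords u * (\<i> *s v)" by (simp add: vec_eq_iff)
  then show ?thesis by (simp add: g_eq p up \<omega>_torus_act[OF u p])
qed

text \<open>Torus orbits are isotropic: along a circle subgroup a component of the moment map has constant
  derivative, by invariance of \<open>\<omega>\<close>, and it is periodic.\<close>
lemma orbits_isotropic:
  assumes p: "p \<in> fst chart"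
  shows "\<omega> chart p (rotation v (snd chart p)) (rotation (of_ivec b) (snd chart p)) = 0"
proof -
  define q where "q t = torus_act (torus_exp (t *\<^sub>R of_ivec b)) p" for t
  define C where "C = \<omega> chart p (rotation v (snd chart p)) (rotation (of_ivec b) (snd chart p))"
  have q: "q t \<in> fst chart" for t
    unfolding q_def using torus_act_in_chart_iff[OF torus_exp_nonzero chart_in_atlas] p by blast
  have deriv: "((\<lambda>t. \<mu> (q t) \<bullet> v) has_real_derivative - C) (at t)" for t
  proof -
    have "((\<lambda>t. \<mu> (chart_inv chart (snd chart (q t))) \<bullet> v) has_derivative
        (\<lambda>h. - \<omega> chart (q t) (rotation v (snd chart (q t))) (h *\<^sub>R rotation (of_ivec b) (snd chart (q t))))) (at t)"
      using has_derivative_compose[OF torus_flow_derivative moment_map_derivative[OF q[unfolded q_def]]]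
      unfolding q_def .
    moreover have "\<omega> chart (q t) (rotation v (snd chart (q t))) (rotation (of_ivec b) (snd chart (q t))) = C"
      unfolding q_def snd_chart_torus_act rotation_torus_coords C_def
      by (rule \<omega>_torus_act[OF torus_exp_in_real_torus p])
    moreover have "(\<lambda>h. - (h * C)) = (*) (- C)" by (simp add: fun_eq_iff)
    ultimately show ?thesis
      by (simp add: chart_inv_chart[OF q] bilinear_rmul[OF bilinear_\<omega>[OF q]] has_field_derivative_def)
  qed
  have "torus_exp (of_ivec b) = 1"
    by (simp add: torus_exp_def vec_eq_iff exp_eq_1 exI[of _ "b $ _"])
  then have "q 1 = q 0"
    using torus_act_one by (simp add: q_def torus_exp_def vec_eq_iff)
  moreover obtain s :: real where "\<mu> (q 1) \<bullet> v - \<mu> (q 0) \<bullet> v = (1 - 0) * - C"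
    using MVT2[of 0 1 "\<lambda>t. \<mu> (q t) \<bullet> v" "\<lambda>_. - C"] deriv by auto
  ultimately show ?thesis by (simp add: C_def)
qed

text \<open>The real form is Lagrangian: where no coordinate vanishes, \<open>\<i>\<close> times its tangent space is tangent
  to a torus orbit; the other points are limits.\<close>
lemma real_form_isotropic:
  assumes p: "p \<in> fst chart" and r: "snd chart p = complexify r"
  shows "\<omega> chart p (complexify X) (complexify Y) = 0"
proof -
  have zero: "\<omega> chart (chart_inv chart w) (axis k 1) (axis l 1) = 0"
    if w: "w = complexify s" "\<And>j. s $ j \<noteq> 0" for w s k l
  proof -
    let ?q = "chart_inv chart w"
    have wi: "w \<in> chart_image chart" using w by (simp add: chart_image_eq)
    note q = chart_inv_in[OF wi]
    note bil = bilinear_\<omega>[OF q]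
    have rot: "rotation (of_ivec (B j)) (snd chart ?q) = (2 * pi * s $ j) *\<^sub>R (\<i> *s axis j 1)" for j
      unfolding snd_chart_chart_inv[OF wi] rotation_generator
      by (simp add: vec_eq_iff w(1)) (simp add: scaleR_conv_of_real)
    have "\<omega> chart ?q (rotation (of_ivec (B k)) (snd chart ?q)) (rotation (of_ivec (B l)) (snd chart ?q)) = 0"
      by (rule orbits_isotropic[OF q])
    then show ?thesis
      using w(2)[of k] w(2)[of l]
      unfolding rot bilinear_lmul[OF bil] bilinear_rmul[OF bil] \<omega>_J[OF q] by simp
  qed
  have axes: "\<omega> chart p (axis k 1) (axis l 1) = 0" for k l
  proof -
    let ?f = "\<lambda>x. \<omega> chart (chart_inv chart x) (axis k 1) (axis l 1)"
    have "?f (perturb (snd chart p) n) = 0" for n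
      using perturb_nonzero[of "snd chart p" n]
      by (intro zero[of _ "\<chi> k. if r $ k = 0 then inverse (real (Suc n)) else r $ k"])
        (simp_all add: r perturb_complexify del: of_nat_Suc)
    then have "?f (snd chart p) = 0"
      using perturb_limit[OF \<omega>_continuous snd_chart_in[OF p], of "axis k 1" "axis l 1"]
      by (simp add: LIMSEQ_const_iff)
    then show ?thesis by (simp add: chart_inv_chart[OF p])
  qed
  have expand: "complexify X = (\<Sum>k\<in>UNIV. X $ k *\<^sub>R axis k 1)" for X :: "real^'m"
    by (simp add: vec_eq_iff axis_def if_distrib cong: if_cong) (simp add: scaleR_conv_of_real)
  note bil = bilinear_\<omega>[OF p]
  have "\<omega> chart p (complexify X) (complexify Y)
      = (\<Sum>(k, l)\<in>UNIV \<times> UNIV. \<omega> chart p (X $ k *\<^sub>R axis k 1) (Y $ l *\<^sub>R axis l 1))"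
    unfolding expand by (rule bilinear_sum[OF bil])
  also have "\<dots> = 0"
    by (intro sum.neutral) (auto simp: bilinear_lmul[OF bil] bilinear_rmul[OF bil] axes)
  finally show ?thesis .
qed

end



section \<open>Stabilizers and the moment polytope\<close>

lemma of_generator_primitive:
  assumes "dual_bases B B'"
  shows "Gcd (range (($) (B k))) = 1"
proof -
  let ?d = "Gcd (range (($) (B k)))"
  have "?d dvd B k $ i" for i by (intro Gcd_dvd) auto
  then have "?d dvd pairing (B' k) (B k)" unfolding pairing_def by (intro dvd_sum) auto
  then have "?d dvd 1" by (simp add: dual_bases_pairing[OF assms])
  then show ?thesis using Gcd_int_greater_eq_0[of "range (($) (B k))"] by (simp add: zdvd1_eq)
qed

lemma (in smooth_cone) generator_is_ray: "k \<in> K \<Longrightarrow> B k \<in> ray_generators \<Sigma>"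
  using cone_in_fan_subset[of "{k}"] of_generator_primitive[OF dual, of k]
  by (simp add: ray_generators_def)

context toric_kahler_chart
begin

text \<open>The vector field generated by \<open>B k\<close> vanishes where \<open>w $ k = 0\<close>, and so does the differential of its
  component of the moment map. This locus is connected, as the image of a vector space under \<open>E\<close>.\<close>
lemma divisor_constant:
  assumes k: "k \<in> K" and w: "w \<in> chart_image chart" "w $ k = 0" and w': "w' \<in> chart_image chart" "w' $ k = 0"
  shows "\<mu> (chart_inv chart w) \<bullet> of_ivec (B k) = \<mu> (chart_inv chart w') \<bullet> of_ivec (B k)"
proof -
  define E :: "complex^'m \<Rightarrow> complex^'m" where
    "E z = (\<chi> j. if j = k then 0 else if j \<in> K then z $ j else exp (z $ j))" for z
  have E_in: "E z \<in> chart_image chart" for z using k by (auto simp: chart_image_eq E_def)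
  have "\<exists>D. ((\<lambda>z. if j = k then 0 else if j \<in> K then z $ j else exp (z $ j)) has_derivative D) (at z)"
    for z :: "complex^'m" and j
  proof -
    have nth: "((\<lambda>w::complex^'m. w $ j) has_derivative (\<lambda>w. w $ j)) (at z)"
      by (rule bounded_linear_imp_has_derivative) (rule bounded_linear_vec_nth)
    have "((\<lambda>w::complex^'m. exp (w $ j)) has_derivative (\<lambda>w. exp (z $ j) * w $ j)) (at z)"
      using has_derivative_compose[OF nth, of exp] DERIV_exp[of "z $ j"]
      by (simp add: has_field_derivative_def)
    with nth consider "j = k" | "j \<noteq> k" "j \<in> K" | "j \<noteq> k" "j \<notin> K"
      "((\<lambda>w::complex^'m. exp (w $ j)) has_derivative (\<lambda>w. exp (z $ j) * w $ j)) (at z)" by blast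
    then show ?thesis
    proof cases
      case 1 then show ?thesis by (intro exI[of _ "\<lambda>w. 0"]) simp
    next
      case 2 then show ?thesis using nth by (intro exI[of _ "\<lambda>w. w $ j"]) simp
    next
      case 3 then show ?thesis by (intro exI[of _ "\<lambda>w. exp (z $ j) * w $ j"]) simp
    qed
  qed
  then have "\<forall>j z. \<exists>D. ((\<lambda>z::complex^'m. if j = k then 0 else if j \<in> K then z $ j else exp (z $ j)) has_derivative D) (at z)"
    by blast
  then obtain D where "\<And>j z. ((\<lambda>z::complex^'m. if j = k then 0 else if j \<in> K then z $ j else exp (z $ j)) has_derivative D j z) (at z)"
    unfolding choice_iff by blast
  from has_derivative_vec_lambda[OF this]
  have E': "(E has_derivative (\<lambda>h. \<chi> j. D j z h)) (at z)" for z unfolding E_def .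
  let ?f = "\<lambda>z. \<mu> (chart_inv chart (E z)) \<bullet> of_ivec (B k)"
  have f': "(?f has_derivative (\<lambda>h. 0)) (at z)" for z
  proof -
    note p = chart_inv_in[OF E_in[of z]] and Ez = snd_chart_chart_inv[OF E_in[of z]]
    have "E z $ k = 0" by (simp add: E_def)
    then have "rotation (of_ivec (B k)) (E z) = 0" unfolding rotation_generator by (simp add: vec_eq_iff)
    moreover note has_derivative_compose[OF E'[of z] moment_map_derivative[OF p, unfolded Ez, of "of_ivec (B k)"]]
    ultimately show ?thesis by (simp add: bilinear_lzero[OF bilinear_\<omega>[OF p]])
  qed
  have "\<exists>c. \<forall>z\<in>UNIV. ?f z = c"
    by (rule has_derivative_zero_constant[OF convex_UNIV]) (simp add: f')
  then obtain c where c: "\<And>z. ?f z = c" by blast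
  have onto: "\<exists>z. E z = v" if "v \<in> chart_image chart" "v $ k = 0" for v
    using that by (intro exI[of _ "\<chi> j. if j \<in> K then v $ j else Ln (v $ j)"])
      (auto simp: E_def vec_eq_iff chart_image_eq)
  show ?thesis using onto[OF w] onto[OF w'] c by metis
qed

text \<open>Away from \<open>w $ k = 0\<close> the radial direction \<open>\<delta>\<close> is \<open>- \<i>\<close> times a positive multiple of the vector field
  generated by \<open>B k\<close>, so the radial derivative of this component of the moment map is a positive multiple of
  \<open>g(\<delta>, \<delta>)\<close>.\<close>
lemma moment_map_radial:
  assumes k: "k \<in> K" and w: "w \<in> chart_image chart"
  shows "\<mu> (chart_inv chart (\<chi> j. if j = k then 0 else w $ j)) \<bullet> of_ivec (B k)
    \<le> \<mu> (chart_inv chart w) \<bullet> of_ivec (B k)"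
proof -
  define \<delta> where "\<delta> = w $ k *s (axis k 1 :: complex^'m)"
  define c where "c t = (\<chi> j. if j = k then of_real t * w $ j else w $ j)" for t :: real
  have c_in: "c t \<in> chart_image chart" for t using w k by (auto simp: chart_image_eq c_def)
  have c_eq: "c t = (w - \<delta>) + t *\<^sub>R \<delta>" for t
    by (auto simp: vec_eq_iff c_def \<delta>_def axis_def) (auto simp: scaleR_conv_of_real)
  have c': "(c has_derivative (\<lambda>h. h *\<^sub>R \<delta>)) (at t)" for t
    unfolding c_eq by (auto intro!: derivative_eq_intros)
  let ?f = "\<lambda>t. \<mu> (chart_inv chart (c t)) \<bullet> of_ivec (B k)"
  have "\<exists>y. DERIV ?f t :> y \<and> 0 \<le> y" if "0 \<le> t" for t
  proof -
    note p = chart_inv_in[OF c_in[of t]] and ct = snd_chart_chart_inv[OF c_in[of t]]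
    let ?p = "chart_inv chart (c t)"
    note bil = bilinear_\<omega>[OF p] bilinear_g[OF p]
    have rot: "rotation (of_ivec (B k)) (c t) = (2 * pi * t) *\<^sub>R (\<i> *s \<delta>)"
      unfolding rotation_generator by (simp add: vec_eq_iff c_def \<delta>_def) (simp add: scaleR_conv_of_real)
    have "- \<omega> chart ?p (rotation (of_ivec (B k)) (c t)) \<delta> = 2 * pi * t * g chart ?p \<delta> \<delta>"
      unfolding rot by (simp add: bilinear_lmul[OF bil(1)] g_eq[OF p])
    moreover have "0 \<le> g chart ?p \<delta> \<delta>"
      using g_pos[OF p, of \<delta>] by (cases "\<delta> = 0") (auto simp: bilinear_lzero[OF bil(2)])
    moreover have "(?f has_derivative (\<lambda>h. - \<omega> chart ?p (rotation (of_ivec (B k)) (c t)) (h *\<^sub>R \<delta>))) (at t)"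
      using has_derivative_compose[OF c' moment_map_derivative[OF p, unfolded ct, of "of_ivec (B k)"]] .
    moreover have "- \<omega> chart ?p X (h *\<^sub>R \<delta>) = - \<omega> chart ?p X \<delta> * h" for X h
      by (simp add: bilinear_rmul[OF bil(1)])
    ultimately have "DERIV ?f t :> 2 * pi * t * g chart ?p \<delta> \<delta>"
      by (simp only: has_field_derivative_def)
    then show ?thesis using that \<open>0 \<le> g chart ?p \<delta> \<delta>\<close> by (intro exI[of _ "2 * pi * t * g chart ?p \<delta> \<delta>"]) simp
  qed
  then have "?f 0 \<le> ?f 1"
    by (intro DERIV_nonneg_imp_nondecreasing[of 0 1 ?f]) (simp, blast)
  moreover have "c 0 = (\<chi> j. if j = k then 0 else w $ j)" "c 1 = w"
    by (auto simp: c_def vec_eq_iff)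
  ultimately show ?thesis by simp
qed

text \<open>Within the chart the component increases away from the divisor \<open>w $ k = 0\<close>. Every other point is a limit
  of points of the open orbit, which lies in the chart.\<close>
lemma moment_map_minimal_on_divisor:
  assumes p: "p \<in> fst chart" "snd chart p $ k = 0" and q: "q \<in> toric_variety \<Sigma>"
  shows "\<mu> p \<bullet> of_ivec (B k) \<le> \<mu> q \<bullet> of_ivec (B k)"
proof -
  let ?m = "\<lambda>q. \<mu> q \<bullet> of_ivec (B k)"
  have k: "k \<in> K" using p chart_point_snd_chart(2) by blast
  have in_chart: "?m p \<le> ?m q" if "q \<in> fst chart" for q
  proof -
    let ?w = "\<chi> j. if j = k then 0 else snd chart q $ j"
    have "?w \<in> chart_image chart" using snd_chart_in[OF that] k by (auto simp: chart_image_eq)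
    then have "?m p = ?m (chart_inv chart ?w)"
      using divisor_constant[OF k snd_chart_in[OF p(1)] p(2), of ?w] by (simp add: chart_inv_chart[OF p(1)])
    also have "\<dots> \<le> ?m q" using moment_map_radial[OF k snd_chart_in[OF that]] by (simp add: chart_inv_chart[OF that])
    finally show ?thesis .
  qed
  obtain d where "d \<in> toric_atlas \<Sigma>" and qd: "q \<in> fst d" using toric_variety_covered[OF smooth_fan q] by blast
  then obtain C C' H where C: "smooth_cone \<Sigma> C C' H"
    and d: "d = toric_chart \<Sigma> (convex_cone hull (of_ivec ` C ` H)) C'"
    using toric_atlasE[OF smooth_fan] by blast
  interpret d: toric_kahler_chart \<Sigma> C C' H \<omega> g \<mu> \<kappa>
    using C toric_kahler by (simp add: toric_kahler_chart_def toric_kahler_chart_axioms_def)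
  have q': "q \<in> fst d.chart" using qd d by simp
  have "?m p \<le> ?m (chart_inv d.chart (perturb (snd d.chart q) n))" for n
  proof -
    note in_d = d.chart_inv_in[OF d.perturb_in[of "snd d.chart q" n]]
    have "\<And>k. snd d.chart (chart_inv d.chart (perturb (snd d.chart q) n)) $ k \<noteq> 0"
      by (simp add: d.snd_chart_chart_inv[OF d.perturb_in] perturb_nonzero)
    then obtain z where "chart_inv d.chart (perturb (snd d.chart q) n) = orbit_point (\<chi> i. exp (z $ i))"
      using d.chart_point_orbit[OF in_d] by blast
    then show ?thesis using orbit_point_in_chart(1)[of "\<chi> i. exp (z $ i)"] by (intro in_chart) simp
  qed
  moreover have "(\<lambda>n. ?m (chart_inv d.chart (perturb (snd d.chart q) n))) \<longlonglongrightarrow> ?m (chart_inv d.chart (snd d.chart q))"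
    using has_derivative_continuous[OF d.moment_map_derivative[OF q', of "of_ivec (B k)"]]
    by (rule continuous_at_sequentially[THEN iffD1, rule_format, unfolded comp_def, OF _ perturb_tendsto])
  ultimately show ?thesis
    using LIMSEQ_le_const[of _ "?m q" "?m p"] by (simp add: d.chart_inv_chart[OF q'])
qed

text \<open>The \<open>B k\<close> with vanishing coordinate span the Lie algebra of the stabilizer of \<open>p\<close>; regularity speaks of
  the active constraints at \<open>\<mu> p\<close> instead. If \<open>B k\<close> were not in their span, some direction perpendicular to
  them would decrease the pairing with \<open>B k\<close>, and \<open>\<mu> p\<close> could be moved along it inside the closed polytope
  to a value below the minimum.\<close>
lemma stabilizer_in_active_span:
  assumes p: "p \<in> fst chart" and k: "snd chart p $ k = 0"
  shows "of_ivec (B k) \<in> span (of_ivec ` {a \<in> ray_generators \<Sigma>. \<mu> p \<bullet> of_ivec a = \<kappa> a})" (is "_ \<in> span ?S")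
proof (rule ccontr)
  assume not_in: "of_ivec (B k) \<notin> span ?S"
  let ?\<Delta> = "moment_polytope \<Sigma> \<mu>"
  obtain y z where y: "y \<in> span ?S" and z: "\<And>w. w \<in> span ?S \<Longrightarrow> orthogonal z w"
    and yz: "of_ivec (B k) = y + z"
    by (rule orthogonal_subspace_decomp_exists[of ?S "of_ivec (B k)"]) blast
  have "z \<noteq> 0" using not_in y yz by auto
  have "z \<bullet> y = 0" using z[OF y] by (simp add: orthogonal_def)
  then have zB: "z \<bullet> of_ivec (B k) > 0" using \<open>z \<noteq> 0\<close> by (simp add: yz inner_add_right)
  have pM: "p \<in> toric_variety \<Sigma>" using p by (simp add: toric_chart_def affine_piece_def)
  have closure: "closure ?\<Delta> = (\<Inter>a\<in>ray_generators \<Sigma>. {y. y \<bullet> of_ivec a \<ge> \<kappa> a})"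
    and fin: "finite (ray_generators \<Sigma>)"
    using toric_kahler by (simp_all add: toric_kahler_def Let_def)
  have "\<mu> p \<in> closure ?\<Delta>" using pM closure_subset[of ?\<Delta>] by (auto simp: moment_polytope_def)
  then have ge: "\<mu> p \<bullet> of_ivec a \<ge> \<kappa> a" if "a \<in> ray_generators \<Sigma>" for a using that closure by auto
  have "\<forall>\<^sub>F \<epsilon> in at_right 0. (\<mu> p - \<epsilon> *\<^sub>R z) \<bullet> of_ivec a \<ge> \<kappa> a" if a: "a \<in> ray_generators \<Sigma>" for a
  proof (cases "\<mu> p \<bullet> of_ivec a = \<kappa> a")
    case True
    then have "z \<bullet> of_ivec a = 0" using z[of "of_ivec a"] a by (auto simp: orthogonal_def intro: span_base)
    then show ?thesis using True by (simp add: inner_diff_left)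
  next
    case False
    then have "\<mu> p \<bullet> of_ivec a > \<kappa> a" using ge[OF a] by simp
    moreover have "((\<lambda>\<epsilon>. (\<mu> p - \<epsilon> *\<^sub>R z) \<bullet> of_ivec a) \<longlongrightarrow> (\<mu> p - 0 *\<^sub>R z) \<bullet> of_ivec a) (at_right 0)"
      by (intro tendsto_intros)
    ultimately have "\<forall>\<^sub>F \<epsilon> in at_right 0. (\<mu> p - \<epsilon> *\<^sub>R z) \<bullet> of_ivec a > \<kappa> a"
      by (intro order_tendstoD(1)) auto
    then show ?thesis by (rule eventually_mono) simp
  qed
  then have "\<forall>\<^sub>F \<epsilon> in at_right 0. \<forall>a\<in>ray_generators \<Sigma>. (\<mu> p - \<epsilon> *\<^sub>R z) \<bullet> of_ivec a \<ge> \<kappa> a"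
    using fin by (simp add: eventually_ball_finite)
  then have "\<forall>\<^sub>F \<epsilon> in at_right 0. (\<forall>a\<in>ray_generators \<Sigma>. (\<mu> p - \<epsilon> *\<^sub>R z) \<bullet> of_ivec a \<ge> \<kappa> a) \<and> 0 < \<epsilon>"
    using eventually_at_right_less[of "0::real"] by (rule eventually_conj)
  then obtain \<epsilon> :: real where \<epsilon>: "0 < \<epsilon>" "\<mu> p - \<epsilon> *\<^sub>R z \<in> closure ?\<Delta>"
    using that eventually_happens'[OF trivial_limit_at_right_real] unfolding closure INT_iff mem_Collect_eq by blast
  have "?\<Delta> \<subseteq> {y. \<mu> p \<bullet> of_ivec (B k) \<le> of_ivec (B k) \<bullet> y}"
    using moment_map_minimal_on_divisor[OF p k] by (auto simp: moment_polytope_def inner_commute)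
  then have "closure ?\<Delta> \<subseteq> {y. \<mu> p \<bullet> of_ivec (B k) \<le> of_ivec (B k) \<bullet> y}"
    by (intro closure_minimal closed_halfspace_ge) (auto simp: closed_halfspace_ge)
  then have "\<mu> p \<bullet> of_ivec (B k) \<le> (\<mu> p - \<epsilon> *\<^sub>R z) \<bullet> of_ivec (B k)" using \<epsilon>(2) by (auto simp: inner_commute)
  then show False using \<epsilon>(1) zB by (simp add: inner_diff_left mult_le_0_iff not_le)
qed

end

section \<open>The holomorphic volume form\<close>

locale toric_calabi_yau_chart = toric_kahler_chart \<Sigma> B B' K \<omega> g \<mu> \<kappa>
  for \<Sigma> :: "(real^'m) set set" and B B' :: "'m \<Rightarrow> int^'m" and K :: "'m set"
    and \<omega> g :: "('m tpoint, complex^'m) tensor2" and \<mu> :: "'m tpoint \<Rightarrow> real^'m"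
    and \<kappa> :: "int^'m \<Rightarrow> real" +
  fixes \<gamma> :: "int^'m" and \<Omega> :: "('m tpoint, 'm) top_form"
  assumes rays: "\<And>a. a \<in> ray_generators \<Sigma> \<Longrightarrow> pairing \<gamma> a = 1"
    and volume_form: "toric_volume_form \<Sigma> \<gamma> \<Omega>"
begin

definition basis_det :: real where
  "basis_det = det (\<chi> i j. real_of_int (B j $ i))"

lemma basis_det_nonzero: "basis_det \<noteq> 0"
proof -
  let ?N = "\<chi> i j. real_of_int (B j $ i)" and ?M = "\<chi> j i. real_of_int (B' j $ i)"
  have "(?M ** ?N) $ j $ k = (mat 1 :: real^'m^'m) $ j $ k" for j k
    using arg_cong[OF pairing_dual[of j k], of real_of_int]
    by (simp add: matrix_matrix_mult_def pairing_def mat_def)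
  then have "?M ** ?N = mat 1" by (simp add: vec_eq_iff)
  then have "det ?M * det ?N = 1" by (metis det_I det_mul)
  then show ?thesis by (auto simp: basis_det_def)
qed

lemma det_of_real: "det (\<chi> i j. complex_of_real (a i j)) = of_real (det (\<chi> i j. a i j))"
  by (simp add: det_def)

lemma det_scale_rows: "det (\<chi> i j. c i * a i j) = (\<Prod>i\<in>UNIV. c i :: complex) * det (\<chi> i j. a i j)"
  using det_rows_mul[of c "\<lambda>i. \<chi> j. a i j"] by (simp add: vector_scalar_mult_def)

lemma volume_form_coefficient:
  obtains h where "continuous_on (chart_image chart) h"
    "\<And>p X. p \<in> fst chart \<Longrightarrow> \<Omega> chart p X = h (snd chart p) * dz_top X"
proof -
  have "\<forall>c\<in>toric_atlas \<Sigma>. \<exists>h. holomorphic_on_vec h (chart_image c) \<and> (\<forall>x\<in>chart_image c. h x \<noteq> 0) \<and>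
      (\<forall>p\<in>fst c. \<forall>X. \<Omega> c p X = h (snd c p) * dz_top X)"
    using volume_form unfolding toric_volume_form_def holomorphic_volume_form_def by (elim conjE)
  from bspec[OF this chart_in_atlas]
  obtain h where h': "holomorphic_on_vec h (chart_image chart) \<and> (\<forall>x\<in>chart_image chart. h x \<noteq> 0) \<and>
      (\<forall>p\<in>fst chart. \<forall>X. \<Omega> chart p X = h (snd chart p) * dz_top X)" ..
  note h = h'[THEN conjunct1] h'[THEN conjunct2, THEN conjunct2]
  have "continuous_on (chart_image chart) h"
  proof (rule continuous_at_imp_continuous_on, rule ballI)
    fix x assume "x \<in> chart_image chart"
    then obtain D where "(h has_derivative D) (at x)" using h(1) unfolding holomorphic_on_vec_def by meson
    then show "isCont h x" by (rule has_derivative_continuous)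
  qed
  then show thesis using that[of h] h(2) by simp
qed

text \<open>On the open orbit the coefficient of \<open>\<Omega>\<close> is read off from the images of the lattice basis \<open>B\<close>,
  which the chart turns into multiples of the coordinate vectors.\<close>
lemma volume_form_orbit:
  assumes h: "\<And>p X. p \<in> fst chart \<Longrightarrow> \<Omega> chart p X = h (snd chart p) * dz_top X"
    and w: "\<And>k. w $ k \<noteq> 0"
  shows "h w = of_real basis_det * (\<Prod>k\<in>UNIV. (w $ k) powi (pairing \<gamma> (B k) - 1))"
proof -
  have wi: "w \<in> chart_image chart" using w by (simp add: chart_image_eq)
  obtain z where z: "chart_inv chart w = orbit_point (\<chi> i. exp (z $ i))"
    using chart_point_orbit[OF chart_inv_in[OF wi]] w by (auto simp: snd_chart_chart_inv[OF wi])
  let ?p = "orbit_point (\<chi> i. exp (z $ i))"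
  define Y :: "'m \<Rightarrow> complex^'m" where "Y j = (\<chi> i. of_int (B j $ i))" for j
  have p: "?p \<in> fst chart" "?p \<in> fst (orbit_chart \<Sigma>)"
    using orbit_point_in_chart[of "\<chi> i. exp (z $ i)"] by simp_all
  have wk: "w $ k = exp (\<Sum>i\<in>UNIV. of_int (B' k $ i) * z $ i)" for k
    using snd_chart_chart_inv[OF wi] by (simp add: z snd_chart_orbit_point vec_eq_iff)
  have orbit_in: "orbit_chart \<Sigma> \<in> toric_atlas \<Sigma>"
    using smooth_cone.chart_in_atlas[OF orbit_smooth_cone] by (simp add: orbit_chart_def)
  let ?X = "\<lambda>j. \<chi> i. exp (z $ i) * Y j $ i"
  have "\<Omega> (orbit_chart \<Sigma>) ?p ?X = \<Omega> chart ?p (coord_deriv id (orbit_chart \<Sigma>) chart ?p \<circ> ?X)"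
    using volume_form orbit_in chart_in_atlas p
    unfolding toric_volume_form_def holomorphic_volume_form_def by blast
  also have "\<dots> = h w * dz_top (coord_deriv id (orbit_chart \<Sigma>) chart ?p \<circ> ?X)"
    using h[OF p(1)] snd_chart_chart_inv[OF wi] by (simp add: z)
  also have "coord_deriv id (orbit_chart \<Sigma>) chart ?p \<circ> ?X = (\<lambda>j. \<chi> k. w $ k * (if k = j then 1 else 0))"
  proof
    fix j
    have "(\<Sum>i\<in>UNIV. of_int (B' k $ i) * Y j $ i) = (if k = j then 1 else 0)" for k
      using arg_cong[OF pairing_dual[of k j], of "of_int :: int \<Rightarrow> complex"] by (simp add: Y_def pairing_def)
    then show "(coord_deriv id (orbit_chart \<Sigma>) chart ?p \<circ> ?X) j = (\<chi> k. w $ k * (if k = j then 1 else 0))"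
      unfolding comp_def coord_deriv_orbit_chart wk by simp
  qed
  also have "dz_top (\<lambda>j. \<chi> k. w $ k * (if k = j then 1 else 0)) = (\<Prod>k\<in>UNIV. w $ k)"
  proof -
    have "det ((\<chi> i j. if i = j then 1 else 0) :: complex^'m^'m) = 1"
      using det_I[where 'a=complex and 'n='m] by (simp add: mat_def)
    then show ?thesis unfolding dz_top_def by (simp add: det_scale_rows)
  qed
  finally have 1: "\<Omega> (orbit_chart \<Sigma>) ?p ?X = h w * (\<Prod>k\<in>UNIV. w $ k)" .
  have "\<Omega> (orbit_chart \<Sigma>) ?p ?X = exp (\<Sum>i\<in>UNIV. of_int (\<gamma> $ i) * z $ i) * dz_top Y"
    using volume_form unfolding toric_volume_form_def by blast
  also have "dz_top Y = of_real basis_det"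
    using det_of_real[of "\<lambda>i j. of_int (B j $ i)"] by (simp add: dz_top_def Y_def basis_det_def)
  also have "exp (\<Sum>i\<in>UNIV. of_int (\<gamma> $ i) * z $ i) = (\<Prod>k\<in>UNIV. (w $ k) powi pairing \<gamma> (B k))"
    unfolding dual_bases_expand_pairing[OF dual, of \<gamma> "($) z"] wk exp_power_int
    by (simp add: exp_sum[of UNIV "\<lambda>k. of_int (pairing \<gamma> (B k)) * _ k"] mult.commute[of _ "of_int (pairing \<gamma> _)"])
  also have "\<dots> = (\<Prod>k\<in>UNIV. (w $ k) powi (pairing \<gamma> (B k) - 1)) * (\<Prod>k\<in>UNIV. w $ k)"
    using w by (simp add: prod.distrib[symmetric] power_int_diff)
  finally have "\<Omega> (orbit_chart \<Sigma>) ?p ?X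
      = of_real basis_det * (\<Prod>k\<in>UNIV. (w $ k) powi (pairing \<gamma> (B k) - 1)) * (\<Prod>k\<in>UNIV. w $ k)"
    by (simp only: mult_ac)
  then have "h w * (\<Prod>k\<in>UNIV. w $ k)
      = of_real basis_det * (\<Prod>k\<in>UNIV. (w $ k) powi (pairing \<gamma> (B k) - 1)) * (\<Prod>k\<in>UNIV. w $ k)"
    unfolding 1 .
  moreover have "(\<Prod>k\<in>UNIV. w $ k) \<noteq> 0" using w by simp
  ultimately show ?thesis by (simp only: mult_cancel_right) simp
qed

text \<open>Because \<open>\<gamma>\<close> pairs to \<open>1\<close> with the rays, the formula on the open orbit has no factors that vanish
  or blow up at the boundary of the chart, and extends by continuity.\<close>
lemma volume_form_chart:
  assumes p: "p \<in> fst chart"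
  shows "\<Omega> chart p X =
    of_real basis_det * (\<Prod>k\<in>UNIV. (snd chart p $ k) powi (pairing \<gamma> (B k) - 1)) * dz_top X"
proof -
  obtain h where h: "continuous_on (chart_image chart) h"
    "\<And>p X. p \<in> fst chart \<Longrightarrow> \<Omega> chart p X = h (snd chart p) * dz_top X"
    using volume_form_coefficient by blast
  let ?w = "snd chart p"
  let ?f = "\<lambda>w::complex^'m. of_real basis_det * (\<Prod>k\<in>UNIV. (w $ k) powi (pairing \<gamma> (B k) - 1))"
  have "((\<lambda>n. (perturb ?w n $ k) powi (pairing \<gamma> (B k) - 1)) \<longlonglongrightarrow> (?w $ k) powi (pairing \<gamma> (B k) - 1))" for k
  proof (cases "?w $ k = 0")
    case True
    then have "k \<in> K" using chart_point_snd_chart(2)[OF p] by blast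
    then have "pairing \<gamma> (B k) = 1" using rays generator_is_ray by blast
    then show ?thesis by simp
  next
    case False
    then show ?thesis by (intro tendsto_power_int tendsto_vec_nth perturb_tendsto)
  qed
  then have "(\<lambda>n. ?f (perturb ?w n)) \<longlonglongrightarrow> ?f ?w" by (intro tendsto_mult tendsto_const tendsto_prod)
  moreover have "h (perturb ?w n) = ?f (perturb ?w n)" for n
    by (rule volume_form_orbit[of h, OF h(2) perturb_nonzero])
  ultimately have "(\<lambda>n. h (perturb ?w n)) \<longlonglongrightarrow> ?f ?w" by simp
  then have "h ?w = ?f ?w" by (rule LIMSEQ_unique[OF perturb_limit[OF h(1) snd_chart_in[OF p]]])
  then show ?thesis using h(2)[OF p] by simp
qed

lemma volume_form_factor_nonzero:
  assumes p: "p \<in> fst chart"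
  shows "(\<Prod>k\<in>UNIV. (snd chart p $ k) powi (pairing \<gamma> (B k) - 1)) \<noteq> 0"
proof -
  have "(snd chart p $ k) powi (pairing \<gamma> (B k) - 1) \<noteq> 0" for k
  proof (cases "k \<in> K")
    case True
    then show ?thesis using rays generator_is_ray by simp
  next
    case False
    then show ?thesis using chart_point_snd_chart(2)[OF p] by simp
  qed
  then show ?thesis by simp
qed

lemma dz_top_torus_coords: "dz_top (\<lambda>j. torus_coords u * X j) = (\<Prod>k\<in>UNIV. torus_coords u $ k) * dz_top X"
  using det_scale_rows[of "\<lambda>i. torus_coords u $ i" "\<lambda>i j. X j $ i"] by (simp add: dz_top_def)

text \<open>The coefficient contributes the exponents \<open>\<langle>\<gamma>, B k\<rangle> - 1\<close>, the determinant of the action the missing \<open>1\<close>.\<close>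
lemma volume_form_torus_act:
  assumes p: "p \<in> fst chart"
  shows "\<Omega> chart (torus_act (torus_exp v) p) (\<lambda>j. torus_coords (torus_exp v) * X j) =
    exp (2 * pi * \<i> * of_real (of_ivec \<gamma> \<bullet> v)) * \<Omega> chart p X"
proof -
  let ?U = "torus_coords (torus_exp v)"
  have up: "torus_act (torus_exp v) p \<in> fst chart"
    using torus_act_in_chart_iff[OF torus_exp_nonzero chart_in_atlas] p by blast
  have nz: "?U $ k \<noteq> 0" for k by (intro torus_coords_nonzero torus_exp_nonzero)
  have "(\<Prod>k\<in>UNIV. (?U $ k) powi (pairing \<gamma> (B k) - 1)) * (\<Prod>k\<in>UNIV. ?U $ k)
      = (\<Prod>k\<in>UNIV. (?U $ k) powi pairing \<gamma> (B k))"
    using nz by (simp add: prod.distrib[symmetric] power_int_diff)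
  also have "\<dots> = exp (\<Sum>k\<in>UNIV. of_int (pairing \<gamma> (B k)) * (2 * pi * \<i> * of_real (of_ivec (B' k) \<bullet> v)))"
    by (simp add: torus_coords_torus_exp exp_sum exp_power_int mult.commute)
  also have "\<dots> = exp (2 * pi * \<i> * of_real (of_ivec \<gamma> \<bullet> v))"
    unfolding dual_bases_expand_inner[OF dual, of \<gamma>] by (simp add: sum_distrib_left mult_ac)
  finally have phase: "(\<Prod>k\<in>UNIV. (?U $ k) powi (pairing \<gamma> (B k) - 1)) * (\<Prod>k\<in>UNIV. ?U $ k)
      = exp (2 * pi * \<i> * of_real (of_ivec \<gamma> \<bullet> v))" .
  show ?thesis
    unfolding volume_form_chart[OF p] volume_form_chart[OF up] dz_top_torus_coords phase[symmetric]
    by (simp add: snd_chart_torus_act power_int_mult_distrib prod.distrib mult_ac)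
qed

end



section \<open>Invariance of the potential\<close>

lemma wedge_compose:
  "wedge k l \<alpha> \<beta> (T \<circ> X) = wedge k l (\<lambda>X. \<alpha> (T \<circ> X)) (\<lambda>X. \<beta> (T \<circ> X)) X"
  by (simp add: wedge_def comp_def)

lemma wedge_power2_compose: "wedge_power2 \<alpha> k (T \<circ> X) = wedge_power2 (\<lambda>X. \<alpha> (T \<circ> X)) k X"
proof (induction k arbitrary: X)
  case (Suc k)
  show ?case by (simp only: wedge_power2.simps wedge_compose Suc)
qed simp

lemma wedge_scale: "wedge k l (\<lambda>X. a * \<alpha> X) (\<lambda>X. b * \<beta> X) X = (a * b) * wedge k l \<alpha> \<beta> X"
proof -
  have "(\<Sum>\<pi> | \<pi> permutes {..<k + l}. of_int (sign \<pi>) * (a * \<alpha> (X \<circ> \<pi>)) * (b * \<beta> (\<lambda>i. X (\<pi> (k + i)))))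
      = (a * b) * (\<Sum>\<pi> | \<pi> permutes {..<k + l}. of_int (sign \<pi>) * \<alpha> (X \<circ> \<pi>) * \<beta> (\<lambda>i. X (\<pi> (k + i))))"
    unfolding sum_distrib_left by (intro sum.cong) (simp_all only: mult_ac)
  then show ?thesis by (simp add: wedge_def)
qed

lemma toric_calabi_yau_chartE:
  assumes "toric_almost_calabi_yau \<Sigma> \<omega> g \<mu> \<kappa> \<gamma> \<Omega>" "c \<in> toric_atlas \<Sigma>"
  obtains B B' K where "toric_calabi_yau_chart \<Sigma> B B' K \<omega> g \<mu> \<kappa> \<gamma> \<Omega>"
    "c = toric_chart \<Sigma> (convex_cone hull (of_ivec ` B ` K)) B'"
proof -
  have "toric_kahler \<Sigma> \<omega> g \<mu> \<kappa>" and rays: "\<forall>a\<in>ray_generators \<Sigma>. pairing \<gamma> a = 1"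
    and "toric_volume_form \<Sigma> \<gamma> \<Omega>"
    using assms(1) by (simp_all add: toric_almost_calabi_yau_def pairing_def)
  moreover then have "smooth_fan \<Sigma>" by (simp add: toric_kahler_def)
  then obtain B B' K where "smooth_cone \<Sigma> B B' K"
    "c = toric_chart \<Sigma> (convex_cone hull (of_ivec ` B ` K)) B'"
    using toric_atlasE assms(2) by blast
  ultimately show thesis
    using that[of B B' K]
    by (simp add: toric_calabi_yau_chart_def toric_calabi_yau_chart_axioms_def toric_kahler_chart_def
        toric_kahler_chart_axioms_def)
qed

text \<open>The torus multiplies \<open>\<Omega>\<close> by a complex unit and preserves \<open>\<omega>\<close>, so the equations that define the
  potential at the two points are the same.\<close>
lemma acy_potential_torus_act:
  fixes \<Omega> :: "('m::finite tpoint, 'm) top_form"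
  assumes acy: "toric_almost_calabi_yau \<Sigma> \<omega> g \<mu> \<kappa> \<gamma> \<Omega>"
  shows "acy_potential (toric_atlas \<Sigma>) \<omega> \<Omega> (torus_act (torus_exp v) p) = acy_potential (toric_atlas \<Sigma>) \<omega> \<Omega> p"
proof -
  let ?q = "torus_act (torus_exp v) p"
  define m where "m = CARD('m)"
  define l where "l c x \<psi> X = complex_of_real (exp (2 * real m * \<psi>)) *
      wedge_power2 (\<lambda>X. complex_of_real (\<omega> c x (X 0) (X 1))) m X / fact m" for c x \<psi> X
  define F where "F c x X = \<Omega> c x (\<lambda>j. X (to_nat_on (UNIV :: 'm set) j))" for c x X
  define r where "r c x X = (- 1) ^ (m * (m - 1) div 2) * (\<i> / 2) ^ m *
      wedge m m (F c x) (\<lambda>X. cnj (F c x X)) X" for c x X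
  have eq: "(\<forall>X. l c ?q \<psi> X = r c ?q X) \<longleftrightarrow> (\<forall>X. l c p \<psi> X = r c p X)"
    if c: "c \<in> toric_atlas \<Sigma>" and p: "p \<in> fst c" for c \<psi>
  proof -
    obtain B B' K where cy: "toric_calabi_yau_chart \<Sigma> B B' K \<omega> g \<mu> \<kappa> \<gamma> \<Omega>"
      and c: "c = toric_chart \<Sigma> (convex_cone hull (of_ivec ` B ` K)) B'"
      using toric_calabi_yau_chartE[OF acy c] by blast
    interpret toric_calabi_yau_chart \<Sigma> B B' K \<omega> g \<mu> \<kappa> \<gamma> \<Omega> by (rule cy)
    define T where "T = (\<lambda>z. torus_coords (torus_exp v) * z)"
    define T' where "T' = (\<lambda>z::complex^'m. (\<chi> k. inverse (torus_coords (torus_exp v) $ k)) * z)"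
    define a where "a = exp (2 * pi * \<i> * of_real (of_ivec \<gamma> \<bullet> v))"
    have pc: "p \<in> fst chart" using p c by simp
    have TT': "T \<circ> (T' \<circ> X) = X" for X :: "nat \<Rightarrow> complex^'m"
      using torus_coords_nonzero[OF torus_exp_nonzero, of v]
      by (simp add: T_def T'_def fun_eq_iff vec_eq_iff)
    have "a * cnj a = 1"
    proof -
      have "norm a = 1" by (simp add: a_def norm_exp_eq_Re)
      then show ?thesis using complex_norm_square[of a] by simp
    qed
    moreover have F: "F c ?q (T \<circ> X) = a * F c p X" for X
      using volume_form_torus_act[OF pc, of v "\<lambda>j. X (to_nat_on UNIV j)"] by (simp add: F_def T_def c a_def)
    ultimately have r: "r c ?q (T \<circ> X) = r c p X" for X
      using wedge_scale[of m m a "F c p" "cnj a" "\<lambda>X. cnj (F c p X)"]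
      by (simp add: r_def wedge_compose F)
    have l: "l c ?q \<psi> (T \<circ> X) = l c p \<psi> X" for X
      using \<omega>_torus_act[OF torus_exp_in_real_torus pc, of v]
      by (simp add: l_def wedge_power2_compose T_def c)
    show ?thesis
    proof
      assume "\<forall>X. l c ?q \<psi> X = r c ?q X"
      then show "\<forall>X. l c p \<psi> X = r c p X" using l r by metis
    next
      assume *: "\<forall>X. l c p \<psi> X = r c p X"
      have "l c ?q \<psi> (T \<circ> (T' \<circ> X)) = r c ?q (T \<circ> (T' \<circ> X))" for X using * l r by simp
      then show "\<forall>X. l c ?q \<psi> X = r c ?q X" by (simp add: TT')
    qed
  qed
  have "acy_potential (toric_atlas \<Sigma>) \<omega> \<Omega> x =
      (THE \<psi>. \<forall>c\<in>toric_atlas \<Sigma>. x \<in> fst c \<longrightarrow> (\<forall>X. l c x \<psi> X = r c x X))" for x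
    unfolding acy_potential_def Let_def l_def r_def F_def m_def ..
  moreover have "(\<forall>c\<in>toric_atlas \<Sigma>. ?q \<in> fst c \<longrightarrow> (\<forall>X. l c ?q \<psi> X = r c ?q X)) \<longleftrightarrow>
      (\<forall>c\<in>toric_atlas \<Sigma>. p \<in> fst c \<longrightarrow> (\<forall>X. l c p \<psi> X = r c p X))" for \<psi>
    using eq torus_act_in_chart_iff[OF torus_exp_nonzero] by blast
  ultimately show ?thesis by presburger
qed

section \<open>The Lagrangian in adapted coordinates\<close>

context smooth_cone
begin

definition real_coords :: "'m tpoint \<Rightarrow> real^'m" where
  "real_coords p = (\<chi> j. Re (snd chart p $ j))"

abbreviation real_chart :: "('m tpoint, real^'m) chart" where
  "real_chart \<equiv> (fst chart \<inter> real_form \<Sigma>, real_coords)"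

lemma real_chart_in_atlas: "real_chart \<in> real_form_atlas \<Sigma>"
  using chart_in_atlas by (auto simp: real_form_atlas_def real_coords_def fun_eq_iff intro!: exI[of _ "fst chart"])

lemma snd_chart_real_form: "p \<in> real_form \<Sigma> \<Longrightarrow> snd chart p = complexify (real_coords p)"
proof -
  assume "p \<in> real_form \<Sigma>"
  then have "snd (conjugation p) a = snd p a" for a by (simp add: real_form_def)
  then have "Im (snd p a) = 0" for a by (simp add: conjugation_def complex_eq_iff)
  then show ?thesis by (simp add: vec_eq_iff real_coords_def toric_chart_def complex_eq_iff)
qed

lemma inj_on_real_chart: "inj_on real_coords (fst chart \<inter> real_form \<Sigma>)"
proof (rule inj_onI)
  fix p q assume "p \<in> fst chart \<inter> real_form \<Sigma>" "q \<in> fst chart \<inter> real_form \<Sigma>" "real_coords p = real_coords q"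
  then show "p = q" using inj_onD[OF inj_on_chart, of p q] by (simp add: snd_chart_real_form)
qed

end

lemma subspace_V_span: "subspace (V_span n \<zeta>)"
  by (simp add: V_span_def)

lemma of_ivec_zero [simp]: "of_ivec 0 = 0"
  by (simp add: vec_eq_iff)

lemma zero_in_int_lattice: "0 \<in> int_lattice"
  unfolding int_lattice_def by (metis of_ivec_zero rangeI)

lemma torus_exp_lattice: "l \<in> int_lattice \<Longrightarrow> torus_exp l = 1"
  by (auto simp: int_lattice_def torus_exp_def vec_eq_iff exp_eq_1 intro: exI[of _ "_ $ _"])

lemma F_map_T_class:
  assumes "subspace V"
  shows "F_map (p, T_class V v) = torus_act (torus_exp v) p"
proof -
  have "v + 0 \<in> T_class V v"
    using zero_in_int_lattice subspace_0[OF assms] unfolding T_class_def by blast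
  then have "(SOME v'. v' \<in> T_class V v) \<in> T_class V v" by (rule someI)
  then obtain l where "(SOME v'. v' \<in> T_class V v) = v + l" "l \<in> int_lattice" by (auto simp: T_class_def)
  then show ?thesis by (simp add: F_map_def torus_exp_add torus_exp_lattice)
qed

lemma T_class_eqD:
  assumes "subspace V" "T_class V v = T_class V w"
  shows "v - w \<in> int_lattice"
proof -
  have "v + 0 \<in> T_class V v"
    using zero_in_int_lattice subspace_0[OF assms(1)] unfolding T_class_def by blast
  then show ?thesis unfolding assms(2) by (auto simp: T_class_def)
qed

lemma linear_slice_part: "linear (slice_part I)"
  by (rule linearI) (simp_all add: slice_part_def vec_eq_iff)

lemma bounded_linear_slice_part: "bounded_linear (slice_part I)"
  using linear_slice_part[of I] by (rule linear_conv_bounded_linear[THEN iffD1])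

lemma linear_torus_part: "linear (torus_part \<zeta> I e)"
  by (rule linearI) (simp_all add: torus_part_def algebra_simps sum.distrib scaleR_sum_right)

locale lagrangian_setting =
  fixes \<Sigma> :: "(real^'m) set set" and \<omega> g :: "('m tpoint, complex^'m) tensor2"
    and \<mu> :: "'m tpoint \<Rightarrow> real^'m" and \<kappa> :: "int^'m \<Rightarrow> real" and \<gamma> :: "int^'m"
    and \<Omega> :: "('m tpoint, 'm) top_form" and n :: nat and \<zeta> :: "nat \<Rightarrow> int^'m" and c :: "nat \<Rightarrow> real"
  assumes acy: "toric_almost_calabi_yau \<Sigma> \<omega> g \<mu> \<kappa> \<gamma> \<Omega>"
    and n_le: "n \<le> CARD('m)"
    and inj_\<zeta>: "inj_on \<zeta> {..<n}"
    and independent_\<zeta>: "independent ((\<lambda>i. of_ivec (\<zeta> i)) ` {..<n})"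
    and regular: "\<And>y. y \<in> moment_polytope \<Sigma> \<mu> \<Longrightarrow> (\<And>i. i < n \<Longrightarrow> y \<bullet> of_ivec (\<zeta> i) = c i) \<Longrightarrow>
      regular_point \<Sigma> \<kappa> (V_span n \<zeta>) y"
begin

abbreviation V :: "(real^'m) set" where "V \<equiv> V_span n \<zeta>"
abbreviation S :: "'m tpoint set" where "S \<equiv> real_level \<Sigma> \<mu> n \<zeta> c"
abbreviation L :: "('m tpoint \<times> (real^'m) set, real^'m) chart set" where
  "L \<equiv> product_atlas (real_form \<Sigma>) (real_form_atlas \<Sigma>) S n \<zeta>"

end

text \<open>One chart of \<open>L\<close>: slice coordinates \<open>d\<close> on the level set and linear coordinates on \<open>V\<close>.\<close>
locale product_chart = lagrangian_setting \<Sigma> \<omega> g \<mu> \<kappa> \<gamma> \<Omega> n \<zeta> c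
  for \<Sigma> :: "(real^'m) set set" and \<omega> g :: "('m tpoint, complex^'m) tensor2"
    and \<mu> :: "'m tpoint \<Rightarrow> real^'m" and \<kappa> :: "int^'m \<Rightarrow> real" and \<gamma> :: "int^'m"
    and \<Omega> :: "('m tpoint, 'm) top_form" and n :: nat and \<zeta> :: "nat \<Rightarrow> int^'m" and c :: "nat \<Rightarrow> real" +
  fixes I :: "'m set" and e :: "'m \<Rightarrow> nat" and d :: "('m tpoint, real^'m) chart" and W :: "(real^'m) set"
  assumes slice: "slice_chart (real_form \<Sigma>) (real_form_atlas \<Sigma>) S I d"
    and card_I: "card I = CARD('m) - n"
    and e: "bij_betw e (-I) {..<n}"
    and open_W: "open W"
    and W_inj: "\<And>x y. x \<in> W \<Longrightarrow> y \<in> W \<Longrightarrow> torus_part \<zeta> I e x - torus_part \<zeta> I e y \<in> int_lattice \<Longrightarrow>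
      torus_part \<zeta> I e x = torus_part \<zeta> I e y"
begin

abbreviation tor :: "real^'m \<Rightarrow> real^'m" where "tor \<equiv> torus_part \<zeta> I e"
abbreviation sl :: "real^'m \<Rightarrow> real^'m" where "sl \<equiv> slice_part I"
definition D :: "(real^'m) set" where "D = {x \<in> W. sl x \<in> chart_image d}"
abbreviation param :: "real^'m \<Rightarrow> 'm tpoint \<times> (real^'m) set" where "param \<equiv> product_param n \<zeta> I e d"
definition lc :: "('m tpoint \<times> (real^'m) set, real^'m) chart" where
  "lc = (param ` D, inv_into D param)"
definition pt :: "real^'m \<Rightarrow> 'm tpoint" where "pt x = chart_inv d (sl x)"

lemma tor_expand: "tor x = (\<Sum>j\<in>-I. x $ j *\<^sub>R of_ivec (\<zeta> (e j)))"
  by (simp add: torus_part_def)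

lemma e_less: "j \<notin> I \<Longrightarrow> e j < n"
  using e by (auto simp: bij_betw_def)

lemma tor_in_V: "tor x \<in> V"
  unfolding tor_expand V_span_def by (intro span_sum span_scale span_base) (use e_less in auto)

lemma tor_eq_0D:
  assumes "tor x = 0" "j \<notin> I"
  shows "x $ j = 0"
proof -
  define f where "f j = of_ivec (\<zeta> (e j))" for j
  have inj: "inj_on f (-I)"
  proof (rule inj_onI)
    fix i j assume ij: "i \<in> -I" "j \<in> -I" "f i = f j"
    then have "\<zeta> (e i) = \<zeta> (e j)" by (simp add: f_def vec_eq_iff)
    then have "e i = e j" using inj_\<zeta> e_less ij by (auto dest: inj_onD)
    then show "i = j" using e ij by (auto simp: bij_betw_def dest: inj_onD)
  qed
  have image: "f ` (-I) = (\<lambda>i. of_ivec (\<zeta> i)) ` {..<n}"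
    using e by (auto simp: bij_betw_def f_def image_iff) (metis ComplI image_iff lessThan_iff)
  have "(\<Sum>v\<in>f ` (-I). x $ inv_into (-I) f v *\<^sub>R v) = 0"
    unfolding sum.reindex[OF inj] using assms(1) inj by (simp add: tor_expand f_def[symmetric])
  then have "x $ inv_into (-I) f (f j) = 0"
    using independentD[OF independent_\<zeta>, of "f ` (-I)" "\<lambda>v. x $ inv_into (-I) f v" "f j"] assms(2)
    by (simp add: image)
      (metis ComplI image image_eqI finite_imageI finite_lessThan)
  then show ?thesis using inj assms(2) by simp
qed

lemma sl_nth: "j \<in> I \<Longrightarrow> sl x $ j = x $ j"
  by (simp add: slice_part_def)

lemma coordinates_eqI: "sl x = sl y \<Longrightarrow> tor x = tor y \<Longrightarrow> x = y"
  using tor_eq_0D[of "x - y"] linear_diff[OF linear_torus_part, of \<zeta> I e x y] sl_nth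
  by (metis (no_types, lifting) cancel_comm_monoid_add_class.diff_cancel right_minus_eq vec_eq_iff vector_minus_component)

lemma d_compatible: "compatible_chart (real_form \<Sigma>) (real_form_atlas \<Sigma>) d"
  using slice by (simp add: slice_chart_def)

lemma inj_on_d: "inj_on (snd d) (fst d)" and open_image_d: "open (chart_image d)"
  and fst_d_subset: "fst d \<subseteq> real_form \<Sigma>"
  using d_compatible by (simp_all add: compatible_chart_def)

lemma chart_inv_d: "y \<in> chart_image d \<Longrightarrow> chart_inv d y \<in> fst d \<and> snd d (chart_inv d y) = y"
  by (auto simp: chart_inv_def chart_image_def inv_into_into f_inv_into_f)

lemma open_D: "open D"
proof -
  have "D = W \<inter> sl -` chart_image d" by (auto simp: D_def)
  moreover have "open (sl -` chart_image d)"
    by (intro open_vimage linear_continuous_on open_image_d bounded_linear_slice_part)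
  ultimately show ?thesis using open_W by (simp only: open_Int)
qed

lemma param_eq: "param x = (pt x, T_class V (tor x))"
  by (simp add: product_param_def pt_def)

lemma inj_on_param: "inj_on param D"
proof (rule inj_onI)
  fix x y assume x: "x \<in> D" and y: "y \<in> D" and "param x = param y"
  then have "pt x = pt y" "T_class V (tor x) = T_class V (tor y)" by (simp_all add: param_eq)
  then have "sl x = sl y" using chart_inv_d x y by (metis (no_types, lifting) D_def mem_Collect_eq pt_def)
  moreover have "tor x = tor y"
    using W_inj T_class_eqD[OF subspace_V_span \<open>T_class V (tor x) = T_class V (tor y)\<close>] x y by (simp add: D_def)
  ultimately show "x = y" by (rule coordinates_eqI)
qed

lemma snd_lc_param: "x \<in> D \<Longrightarrow> snd lc (param x) = x"
  by (simp add: lc_def inj_on_param)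

lemma chart_image_lc: "chart_image lc = D"
  using snd_lc_param by (force simp: chart_image_def lc_def)

lemma chart_inv_lc:
  assumes "x \<in> D" shows "chart_inv lc x = param x"
proof -
  have "inj_on (snd lc) (fst lc)" by (simp add: lc_def inj_on_inv_into)
  moreover have "param x \<in> fst lc" using assms by (simp add: lc_def)
  ultimately have "inv_into (fst lc) (snd lc) (snd lc (param x)) = param x" by (rule inv_into_f_f)
  then show ?thesis by (simp add: chart_inv_def snd_lc_param[OF assms])
qed

lemma lc_in_L: "lc \<in> L"
  unfolding product_atlas_def lc_def
  using slice card_I e open_W W_inj D_def by blast

lemma pt_in_S: "x \<in> D \<Longrightarrow> pt x \<in> S"
proof -
  assume x: "x \<in> D"
  then have "sl x \<in> snd d ` (fst d \<inter> S)"
    using slice by (auto simp: slice_chart_def D_def slice_part_def)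
  then obtain p where "p \<in> fst d" "p \<in> S" "sl x = snd d p" by auto
  moreover have "pt x = p" unfolding pt_def \<open>sl x = snd d p\<close> chart_inv_def
    using inj_on_d \<open>p \<in> fst d\<close> by simp
  ultimately show ?thesis by simp
qed

lemma pt_in_real_form: "x \<in> D \<Longrightarrow> pt x \<in> real_form \<Sigma>"
  using pt_in_S by (simp add: real_level_def)

lemma pt_in_toric_variety: "x \<in> D \<Longrightarrow> pt x \<in> toric_variety \<Sigma>"
  using pt_in_real_form by (simp add: real_form_def)

lemma F_map_param: "F_map (param x) = torus_act (torus_exp (tor x)) (pt x)"
  by (simp add: param_eq F_map_T_class[OF subspace_V_span])

lemma F_map_in_chart_iff: "a \<in> toric_atlas \<Sigma> \<Longrightarrow> F_map (param x) \<in> fst a \<longleftrightarrow> pt x \<in> fst a"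
  unfolding F_map_param by (rule torus_act_in_chart_iff[OF torus_exp_nonzero])

end



text \<open>A chart of \<open>L\<close> together with a toric chart of \<open>M\<close>. Both for \<open>p\<close> and for \<open>F(p, [v])\<close> the same toric chart can
  be used, since the two points lie in the same orbit.\<close>
locale local_lagrangian =
  product_chart \<Sigma> \<omega> g \<mu> \<kappa> \<gamma> \<Omega> n \<zeta> c I e d W + toric_calabi_yau_chart \<Sigma> B B' K \<omega> g \<mu> \<kappa> \<gamma> \<Omega>
  for \<Sigma> :: "(real^'m) set set" and \<omega> g :: "('m tpoint, complex^'m) tensor2"
    and \<mu> :: "'m tpoint \<Rightarrow> real^'m" and \<kappa> :: "int^'m \<Rightarrow> real" and \<gamma> :: "int^'m"
    and \<Omega> :: "('m tpoint, 'm) top_form" and n :: nat and \<zeta> :: "nat \<Rightarrow> int^'m" and c :: "nat \<Rightarrow> real"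
    and I :: "'m set" and e :: "'m \<Rightarrow> nat" and d :: "('m tpoint, real^'m) chart" and W :: "(real^'m) set"
    and B B' :: "'m \<Rightarrow> int^'m" and K :: "'m set"
begin

definition dom :: "(real^'m) set" where "dom = {x \<in> D. pt x \<in> fst chart}"

definition overlap :: "(real^'m) set" where "overlap = snd d ` (fst d \<inter> fst real_chart)"

text \<open>The real toric coordinates of a point of the real form as functions of its slice coordinates.\<close>
definition \<rho> :: "real^'m \<Rightarrow> real^'m" where "\<rho> = real_coords \<circ> chart_inv d"

lemma compat:
  "open overlap" "smooth_on overlap \<rho>"
  "open (real_coords ` (fst d \<inter> fst real_chart))"
  "smooth_on (real_coords ` (fst d \<inter> fst real_chart)) (snd d \<circ> chart_inv real_chart)"
  using d_compatible real_chart_in_atlas unfolding compatible_chart_def overlap_def \<rho>_def by auto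

lemma in_dom_iff: "x \<in> dom \<longleftrightarrow> x \<in> W \<and> sl x \<in> overlap"
proof
  assume x: "x \<in> dom"
  then have "chart_inv d (sl x) \<in> fst d" "snd d (chart_inv d (sl x)) = sl x"
    using chart_inv_d by (auto simp: dom_def D_def)
  then show "x \<in> W \<and> sl x \<in> overlap"
    using x fst_d_subset unfolding overlap_def dom_def D_def pt_def
    by (auto intro!: image_eqI[of _ _ "chart_inv d (sl x)"])
next
  assume x: "x \<in> W \<and> sl x \<in> overlap"
  then obtain p where p: "p \<in> fst d" "p \<in> fst chart" "sl x = snd d p" by (auto simp: overlap_def)
  then have "pt x = p" by (simp add: pt_def chart_inv_def inj_on_d)
  then show "x \<in> dom" using x p by (auto simp: dom_def D_def chart_image_def)
qed

lemma open_dom: "open dom"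
proof -
  have "dom = W \<inter> sl -` overlap" by (auto simp: in_dom_iff)
  moreover have "open (sl -` overlap)"
    by (intro open_vimage linear_continuous_on compat bounded_linear_slice_part)
  ultimately show ?thesis using open_W by (simp only: open_Int)
qed

lemma snd_chart_pt: "x \<in> dom \<Longrightarrow> snd chart (pt x) = complexify (\<rho> (sl x))"
  using pt_in_real_form snd_chart_real_form by (simp add: dom_def \<rho>_def pt_def)

lemma pt_in_chart: "x \<in> dom \<Longrightarrow> pt x \<in> fst chart" and dom_D: "x \<in> dom \<Longrightarrow> x \<in> D"
  by (simp_all add: dom_def)

abbreviation U :: "real^'m \<Rightarrow> complex^'m" where "U x \<equiv> torus_coords (torus_exp (tor x))"

lemma F_coords: "x \<in> dom \<Longrightarrow> snd chart (F_map (param x)) = U x * complexify (\<rho> (sl x))"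
  by (simp add: F_map_param snd_chart_torus_act snd_chart_pt)

text \<open>The real and imaginary part of the differential of \<open>F_map\<close>, up to the action of the torus: the
  slice coordinates move the point in the real form, the torus coordinates rotate it.\<close>
definition \<xi> :: "real^'m \<Rightarrow> real^'m \<Rightarrow> real^'m" where
  "\<xi> x h = frechet_derivative \<rho> (at (sl x)) (sl h)"

definition \<eta> :: "real^'m \<Rightarrow> real^'m \<Rightarrow> real^'m" where
  "\<eta> x h = (\<chi> j. 2 * pi * (of_ivec (B' j) \<bullet> tor h) * \<rho> (sl x) $ j)"

lemma \<rho>_derivative: "x \<in> dom \<Longrightarrow> (\<rho> has_derivative frechet_derivative \<rho> (at (sl x))) (at (sl x))"
  using smooth_on_has_derivative[OF compat(2,1)] by (simp add: in_dom_iff)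

lemma \<rho>_slice_derivative: "x \<in> dom \<Longrightarrow> ((\<lambda>y. \<rho> (sl y)) has_derivative \<xi> x) (at x)"
  using has_derivative_compose[OF bounded_linear_imp_has_derivative[OF bounded_linear_slice_part] \<rho>_derivative]
  by (simp add: \<xi>_def[abs_def])

lemma linear_\<xi>: "x \<in> dom \<Longrightarrow> linear (\<xi> x)"
  using \<rho>_slice_derivative has_derivative_linear by blast

lemma linear_\<eta>: "linear (\<eta> x)"
  by (rule linearI)
    (simp_all add: \<eta>_def vec_eq_iff linear_add[OF linear_torus_part] linear_scale[OF linear_torus_part]
      inner_add_right algebra_simps)

lemma rotation_tor: "x \<in> dom \<Longrightarrow> rotation (tor h) (complexify (\<rho> (sl x))) = \<i> *s complexify (\<eta> x h)"
  by (simp add: rotation_def \<eta>_def vec_eq_iff)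

lemma coords_exp: "U y * complexify (\<rho> (sl y)) =
    (\<chi> j. exp (2 * pi * \<i> * of_real (of_ivec (B' j) \<bullet> tor y)) * of_real (\<rho> (sl y) $ j))"
  by (simp add: vec_eq_iff torus_coords_torus_exp)

lemma linear_phase: "linear (\<lambda>y. 2 * pi * \<i> * of_real (of_ivec (B' j) \<bullet> tor y))"
  by (rule linearI)
    (simp_all add: linear_add[OF linear_torus_part] linear_scale[OF linear_torus_part] inner_add_right distrib_left,
      simp add: scaleR_conv_of_real)

lemma F_derivative:
  assumes x: "x \<in> dom"
  shows "((snd chart \<circ> F_map \<circ> chart_inv lc) has_derivative
    (\<lambda>h. U x * (complexify (\<xi> x h) + \<i> *s complexify (\<eta> x h)))) (at x)"
proof -
  define a where "a j y = 2 * pi * \<i> * of_real (of_ivec (B' j) \<bullet> tor y)" for j y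
  have "((\<lambda>y. exp (a j y) * of_real (\<rho> (sl y) $ j)) has_derivative
      (\<lambda>h. exp (a j x) * of_real (\<xi> x h $ j) + (exp (a j x) * a j h) * of_real (\<rho> (sl x) $ j))) (at x)" for j
  proof -
    have "bounded_linear (a j)" unfolding linear_conv_bounded_linear[symmetric] a_def[abs_def]
      by (rule linear_phase)
    from has_derivative_compose[OF bounded_linear_imp_has_derivative[OF this], of exp]
    have exp': "((\<lambda>y. exp (a j y)) has_derivative (\<lambda>h. exp (a j x) * a j h)) (at x)"
      using DERIV_exp[of "a j x"] by (simp add: has_field_derivative_def)
    have "((\<lambda>y. of_real (\<rho> (sl y) $ j)) has_derivative (\<lambda>h. of_real (\<xi> x h $ j) :: complex)) (at x)"
      by (intro has_derivative_of_real bounded_linear.has_derivative[OF bounded_linear_vec_nth]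
          \<rho>_slice_derivative x)
    from has_derivative_mult[OF exp' this] show ?thesis .
  qed
  from has_derivative_vec_lambda[OF this]
  have "((\<lambda>y. U y * complexify (\<rho> (sl y))) has_derivative
    (\<lambda>h. \<chi> j. exp (a j x) * of_real (\<xi> x h $ j) + (exp (a j x) * a j h) * of_real (\<rho> (sl x) $ j))) (at x)"
    unfolding coords_exp a_def .
  moreover have "(\<chi> j. exp (a j x) * of_real (\<xi> x h $ j) + (exp (a j x) * a j h) * of_real (\<rho> (sl x) $ j))
      = U x * (complexify (\<xi> x h) + \<i> *s complexify (\<eta> x h))" for h
    by (simp add: vec_eq_iff torus_coords_torus_exp a_def \<eta>_def algebra_simps)
  ultimately have "((\<lambda>y. U y * complexify (\<rho> (sl y))) has_derivative
      (\<lambda>h. U x * (complexify (\<xi> x h) + \<i> *s complexify (\<eta> x h)))) (at x)" by simp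
  then show ?thesis
    by (rule has_derivative_transform_within_open[OF _ open_dom x])
      (simp add: chart_inv_lc dom_D F_coords)
qed

lemma F_coord_deriv:
  assumes "x \<in> dom"
  shows "coord_deriv F_map lc chart (param x) h = U x * (complexify (\<xi> x h) + \<i> *s complexify (\<eta> x h))"
  using frechet_derivative_eqI[OF F_derivative[OF assms]] by (simp add: coord_deriv_def snd_lc_param dom_D assms)

lemma F_smooth: "smooth_on dom (snd chart \<circ> F_map \<circ> chart_inv lc)"
proof -
  have "Ck_on k dom (\<lambda>y. exp (2 * pi * \<i> * of_real (of_ivec (B' j) \<bullet> tor y)) * of_real (\<rho> (sl y) $ j))" for j k
  proof (rule Ck_on_mult[OF open_dom])
    show "Ck_on k dom (\<lambda>y. exp (2 * pi * \<i> * of_real (of_ivec (B' j) \<bullet> tor y)))"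
      by (intro Ck_on_exp_linear open_dom linear_phase)
    have "Ck_on k dom (\<lambda>y. \<rho> (sl y))"
      using compat(2) unfolding smooth_on_def
      by (intro Ck_on_compose_linear_right[OF linear_slice_part compat(1) open_dom]) (auto simp: in_dom_iff)
    moreover have "bounded_linear (\<lambda>v::real^'m. of_real (v $ j) :: complex)"
      by (intro bounded_linear_compose[OF bounded_linear_of_real bounded_linear_vec_nth])
    ultimately show "Ck_on k dom (\<lambda>y. of_real (\<rho> (sl y) $ j) :: complex)"
      using Ck_on_compose_linear_left[of "\<lambda>v. of_real (v $ j)", OF _ open_dom] by blast
  qed
  then have "smooth_on dom (\<lambda>y. U y * complexify (\<rho> (sl y)))"
    unfolding coords_exp by (intro smooth_on_vec open_dom)
  then show ?thesis unfolding smooth_on_def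
    using Ck_on_cong[OF open_dom, of "\<lambda>y. U y * complexify (\<rho> (sl y))" "snd chart \<circ> F_map \<circ> chart_inv lc"]
    by (simp add: chart_inv_lc dom_D F_coords)
qed

text \<open>\<open>\<rho>\<close> is a change between two charts of the real form and has a differentiable inverse.\<close>
lemma \<xi>_eq_0D:
  assumes x: "x \<in> dom" and "\<xi> x h = 0"
  shows "sl h = 0"
proof -
  define \<rho>' where "\<rho>' = snd d \<circ> chart_inv real_chart"
  have inv: "\<rho>' (\<rho> y) = y" "\<rho> y \<in> real_coords ` (fst d \<inter> fst real_chart)" if y: "y \<in> overlap" for y
  proof -
    obtain p where p: "p \<in> fst d" "p \<in> fst real_chart" "y = snd d p"
      using y unfolding overlap_def by blast
    have "chart_inv d y = p" using p by (simp add: chart_inv_def inj_on_d)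
    then have \<rho>: "\<rho> y = real_coords p" by (simp add: \<rho>_def)
    have "chart_inv real_chart (real_coords p) = p" using p inj_on_real_chart by (simp add: chart_inv_def)
    then show "\<rho>' (\<rho> y) = y" unfolding \<rho>'_def comp_def \<rho> using p(3) by simp
    show "\<rho> y \<in> real_coords ` (fst d \<inter> fst real_chart)" using p \<rho> by blast
  qed
  have s: "sl x \<in> overlap" using x by (simp add: in_dom_iff)
  have "((\<lambda>y. \<rho>' (\<rho> y)) has_derivative
      (\<lambda>v. frechet_derivative \<rho>' (at (\<rho> (sl x))) (frechet_derivative \<rho> (at (sl x)) v))) (at (sl x))"
    by (rule has_derivative_compose[OF \<rho>_derivative[OF x]
        smooth_on_has_derivative[OF compat(4,3) inv(2)[OF s], folded \<rho>'_def]])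
  moreover have "((\<lambda>y. \<rho>' (\<rho> y)) has_derivative (\<lambda>v. v)) (at (sl x))"
    by (rule has_derivative_transform_within_open[OF has_derivative_ident compat(1) s]) (simp add: inv)
  ultimately have "(\<lambda>v. frechet_derivative \<rho>' (at (\<rho> (sl x))) (frechet_derivative \<rho> (at (sl x)) v)) = (\<lambda>v. v)"
    by (rule has_derivative_unique)
  then have "sl h = frechet_derivative \<rho>' (at (\<rho> (sl x))) (\<xi> x h)" unfolding \<xi>_def by metis
  also have "\<dots> = 0"
    unfolding assms(2) using inv(2)[OF s]
    by (intro linear_0 has_derivative_linear[OF smooth_on_has_derivative[OF compat(4,3), folded \<rho>'_def]])
  finally show ?thesis .
qed

text \<open>\<open>\<eta>\<close> vanishes only if \<open>tor h\<close> is in the Lie algebra of the stabilizer, which regularity excludes for nonzero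
  vectors of \<open>V\<close>.\<close>
lemma \<eta>_eq_0D:
  assumes x: "x \<in> dom" and zero: "\<eta> x h = 0"
  shows "tor h = 0"
proof -
  let ?active = "of_ivec ` {a \<in> ray_generators \<Sigma>. \<mu> (pt x) \<bullet> of_ivec a = \<kappa> a}"
  have "(of_ivec (B' k) \<bullet> tor h) *\<^sub>R of_ivec (B k) \<in> span ?active" for k
  proof (cases "\<rho> (sl x) $ k = 0")
    case True
    then have "of_ivec (B k) \<in> span ?active"
      by (intro stabilizer_in_active_span pt_in_chart x) (simp add: snd_chart_pt x)
    then show ?thesis by (rule span_scale)
  next
    case False
    have "\<eta> x h $ k = 0" using zero by simp
    then have "of_ivec (B' k) \<bullet> tor h = 0" using False by (simp add: \<eta>_def)
    then show ?thesis by (simp add: span_zero)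
  qed
  then have "(\<Sum>k\<in>UNIV. (of_ivec (B' k) \<bullet> tor h) *\<^sub>R of_ivec (B k)) \<in> span ?active" by (intro span_sum)
  then have "tor h \<in> span ?active" by (simp only: dual_bases_expand_vector[OF dual])
  moreover have "regular_point \<Sigma> \<kappa> V (\<mu> (pt x))"
  proof (rule regular)
    show "\<mu> (pt x) \<in> moment_polytope \<Sigma> \<mu>"
      using pt_in_toric_variety[OF dom_D[OF x]] by (simp add: moment_polytope_def)
    show "\<mu> (pt x) \<bullet> of_ivec (\<zeta> i) = c i" if "i < n" for i
      using pt_in_S[OF dom_D[OF x]] that by (simp add: real_level_def)
  qed
  ultimately show ?thesis using tor_in_V[of h] unfolding regular_point_def by blast
qed

lemma real_part_isotropic: "x \<in> dom \<Longrightarrow> \<omega> chart (pt x) (complexify X) (complexify Y) = 0"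
  by (rule real_form_isotropic[OF pt_in_chart snd_chart_pt])

text \<open>By the moment map equation this is the derivative of \<open>\<langle>\<mu>, tor k\<rangle>\<close> along the level set, where it is constant.\<close>
lemma slice_torus_isotropic:
  assumes x: "x \<in> dom"
  shows "\<omega> chart (pt x) (\<i> *s complexify (\<eta> x k)) (complexify (\<xi> x h)) = 0"
proof -
  let ?f = "\<lambda>y. \<mu> (chart_inv chart (complexify (\<rho> (sl y)))) \<bullet> tor k"
  have const: "?f y = (\<Sum>j\<in>-I. k $ j * c (e j))" if y: "y \<in> dom" for y
  proof -
    have "chart_inv chart (complexify (\<rho> (sl y))) = pt y"
      using chart_inv_chart[OF pt_in_chart[OF y]] by (simp add: snd_chart_pt[OF y])
    moreover have "\<mu> (pt y) \<bullet> of_ivec (\<zeta> (e j)) = c (e j)" if "j \<in> -I" for j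
      using pt_in_S[OF dom_D[OF y]] e_less that by (simp add: real_level_def)
    ultimately show ?thesis by (simp add: tor_expand inner_sum_right)
  qed
  have "((\<lambda>y. complexify (\<rho> (sl y))) has_derivative (\<lambda>h. complexify (\<xi> x h))) (at x)"
    by (rule bounded_linear.has_derivative[OF bounded_linear_complexify \<rho>_slice_derivative[OF x]])
  from has_derivative_compose[OF this moment_map_derivative[OF pt_in_chart[OF x], of "tor k",
        unfolded snd_chart_pt[OF x] rotation_tor[OF x]]]
  have "(?f has_derivative (\<lambda>h. - \<omega> chart (pt x) (\<i> *s complexify (\<eta> x k)) (complexify (\<xi> x h)))) (at x)"
    .
  moreover have "(?f has_derivative (\<lambda>h. 0)) (at x)"
    by (rule has_derivative_transform_within_open[OF has_derivative_const[of "\<Sum>j\<in>-I. k $ j * c (e j)"] open_dom x])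
      (simp add: const)
  ultimately have "(\<lambda>h. - \<omega> chart (pt x) (\<i> *s complexify (\<eta> x k)) (complexify (\<xi> x h))) = (\<lambda>h. 0)"
    by (rule has_derivative_unique)
  then show ?thesis by (metis neg_equal_0_iff_equal)
qed

lemma F_isotropic:
  assumes x: "x \<in> dom"
  shows "\<omega> chart (pt x) (complexify (\<xi> x h) + \<i> *s complexify (\<eta> x h))
    (complexify (\<xi> x k) + \<i> *s complexify (\<eta> x k)) = 0"
proof -
  note p = pt_in_chart[OF x]
  note bil = bilinear_\<omega>[OF p]
  have "\<omega> chart (pt x) (complexify (\<xi> x h)) (\<i> *s complexify (\<eta> x k)) = 0"
    using slice_torus_isotropic[OF x] by (simp add: \<omega>_antisym[OF p, of "complexify _"])
  then show ?thesis
    by (simp only: bilinear_ladd[OF bil] bilinear_radd[OF bil] real_part_isotropic[OF x]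
        slice_torus_isotropic[OF x] \<omega>_J[OF p] add_0_left)
qed

text \<open>If \<open>\<eta> = - \<xi>\<close>, then \<open>\<omega>(\<i>\<xi>, \<xi>) = - g(\<xi>, \<xi>)\<close> is one of the vanishing mixed terms.\<close>
lemma \<xi>_plus_\<eta>_eq_0D:
  assumes x: "x \<in> dom" and zero: "\<xi> x h + \<eta> x k = 0"
  shows "sl h = 0" "tor k = 0"
proof -
  note p = pt_in_chart[OF x]
  have \<xi>: "\<eta> x k = - \<xi> x h" using zero by (simp add: eq_neg_iff_add_eq_0 add.commute)
  have "\<i> *s complexify (\<eta> x k) = - (\<i> *s complexify (\<xi> x h))" by (simp add: \<xi> vec_eq_iff)
  then have "\<omega> chart (pt x) (\<i> *s complexify (\<xi> x h)) (complexify (\<xi> x h)) = 0"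
    using slice_torus_isotropic[OF x, of k h] by (simp add: bilinear_lneg[OF bilinear_\<omega>[OF p]])
  then have "g chart (pt x) (complexify (\<xi> x h)) (complexify (\<xi> x h)) = 0" by (simp add: g_eq[OF p])
  then have "complexify (\<xi> x h) = 0" using g_pos[OF p, of "complexify (\<xi> x h)"] by fastforce
  then have "\<xi> x h = 0" by (simp add: vec_eq_iff)
  then show "sl h = 0" "tor k = 0" using \<xi> \<xi>_eq_0D[OF x] \<eta>_eq_0D[OF x] by auto
qed

lemma F_immersive:
  assumes x: "x \<in> dom" and zero: "complexify (\<xi> x h) + \<i> *s complexify (\<eta> x h) = 0"
  shows "h = 0"
proof -
  have "(complexify (\<xi> x h) + \<i> *s complexify (\<eta> x h)) $ j = 0" for j using zero by simp
  then have "\<xi> x h = 0" "\<eta> x h = 0" by (simp_all add: vec_eq_iff complex_eq_iff)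
  then have "sl h = sl 0" "tor h = tor 0"
    using \<xi>_eq_0D[OF x] \<eta>_eq_0D[OF x] by (simp_all add: linear_0[OF linear_slice_part] linear_0[OF linear_torus_part])
  then show "h = 0" by (rule coordinates_eqI)
qed

lemma \<xi>_torus_direction: "x \<in> dom \<Longrightarrow> j \<notin> I \<Longrightarrow> \<xi> x (axis j 1) = 0"
proof -
  assume x: "x \<in> dom" and j: "j \<notin> I"
  have "sl (axis j 1) = 0" using j by (auto simp: slice_part_def vec_eq_iff axis_def)
  then show ?thesis using linear_0[OF has_derivative_linear[OF \<rho>_derivative[OF x]]] by (simp add: \<xi>_def)
qed

lemma \<eta>_slice_direction: "j \<in> I \<Longrightarrow> \<eta> x (axis j 1) = 0"
proof -
  assume j: "j \<in> I"
  have "tor (axis j 1) = 0" unfolding tor_expand using j by (intro sum.neutral) (auto simp: axis_def)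
  then have "\<eta> x (axis j 1) $ i = 0" for i by (simp add: \<eta>_def)
  then show ?thesis by (simp add: vec_eq_iff)
qed

text \<open>Up to sign, \<open>g(\<xi>, \<i>\<eta>)\<close> is \<open>\<omega>(\<i>\<xi>, \<i>\<eta>) = \<omega>(\<xi>, \<eta>)\<close>, which vanishes on the real form.\<close>
lemma metric_block:
  assumes x: "x \<in> dom" and ij: "i \<in> I" "j \<notin> I"
  shows "g chart (pt x) (complexify (\<xi> x (axis i 1)) + \<i> *s complexify (\<eta> x (axis i 1)))
    (complexify (\<xi> x (axis j 1)) + \<i> *s complexify (\<eta> x (axis j 1))) = 0"
proof -
  note p = pt_in_chart[OF x]
  show ?thesis
    by (simp add: linear_0[OF linear_complexify] \<xi>_torus_direction[OF x ij(2)] \<eta>_slice_direction[OF ij(1)] g_eq[OF p] \<omega>_J[OF p] real_part_isotropic[OF x])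
qed

text \<open>Since the tangent space is totally real, the real vectors \<open>\<xi>\<close> of the slice directions and \<open>\<eta>\<close> of the torus
  directions are together linearly independent.\<close>
lemma F_real_tangent_basis:
  assumes x: "x \<in> dom"
  shows "det (\<chi> i j. (if j \<in> I then \<xi> x (axis j 1) else \<eta> x (axis j 1)) $ i) \<noteq> 0"
proof -
  let ?A = "\<chi> i j. (if j \<in> I then \<xi> x (axis j 1) else \<eta> x (axis j 1)) $ i"
  have lin: "linear (\<lambda>h. \<xi> x h + \<eta> x h)" by (intro linear_compose_add linear_\<xi>[OF x] linear_\<eta>)
  have A: "?A *v h = \<xi> x h + \<eta> x h" for h
  proof -
    have "?A = matrix (\<lambda>h. \<xi> x h + \<eta> x h)"
      by (simp add: matrix_def vec_eq_iff \<xi>_torus_direction[OF x] \<eta>_slice_direction)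
    then show ?thesis using fun_cong[OF matrix_vector_mul(2)[OF lin], of h] by simp
  qed
  have "h = 0" if "?A *v h = 0" for h
  proof -
    have "\<xi> x h + \<eta> x h = 0" using that by (simp only: A)
    from \<xi>_plus_\<eta>_eq_0D[OF x this] show "h = 0"
      using coordinates_eqI[of h 0] by (simp add: linear_0[OF linear_slice_part] linear_0[OF linear_torus_part])
  qed
  then have "inj ((*v) ?A)"
    using matrix_vector_mul_linear linear_injective_0 by blast
  then show ?thesis using invertible_det_nz invertible_left_inverse matrix_left_invertible_injective by blast
qed

lemma dz_top_tangent:
  "dz_top (\<lambda>j. complexify (\<xi> x (axis j 1)) + \<i> *s complexify (\<eta> x (axis j 1)))
    = \<i> ^ card (- I) * of_real (det (\<chi> i j. (if j \<in> I then \<xi> x (axis j 1) else \<eta> x (axis j 1)) $ i))"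
  if x: "x \<in> dom"
proof -
  define b where "b j = (if j \<in> I then 1 else \<i>)" for j
  define z where "z j = (if j \<in> I then \<xi> x (axis j 1) else \<eta> x (axis j 1))" for j
  have "(complexify (\<xi> x (axis j 1)) + \<i> *s complexify (\<eta> x (axis j 1))) $ i = b j * of_real (z j $ i)" for i j
    by (simp add: b_def z_def \<xi>_torus_direction[OF x] \<eta>_slice_direction)
  then have "dz_top (\<lambda>j. complexify (\<xi> x (axis j 1)) + \<i> *s complexify (\<eta> x (axis j 1)))
      = det (\<chi> i j. b j * of_real (z j $ i))" by (simp add: dz_top_def)
  also have "\<dots> = det (transpose (\<chi> i j. b j * of_real (z j $ i)))" by (simp only: det_transpose)
  also have "transpose (\<chi> i j. b j * of_real (z j $ i)) = (\<chi> j i. b j * of_real (z j $ i))"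
    by (simp add: transpose_def)
  also have "det \<dots> = (\<Prod>j\<in>UNIV. b j) * of_real (det (\<chi> j i. z j $ i))"
    by (simp only: det_scale_rows det_of_real)
  also have "det (\<chi> j i. z j $ i) = det (\<chi> i j. z j $ i)"
    using det_transpose[of "\<chi> i j. z j $ i"] by (simp add: transpose_def)
  also have "(\<Prod>j\<in>UNIV. b j) = \<i> ^ card (- I)"
  proof -
    have "(\<Prod>j\<in>UNIV. b j) = (\<Prod>j\<in>I. b j) * (\<Prod>j\<in>-I. b j)"
      using prod.union_disjoint[of I "-I" b] by (simp add: Compl_partition)
    then show ?thesis by (simp add: b_def)
  qed
  finally show ?thesis by (simp add: z_def)
qed

text \<open>The torus contributes the phase of \<open>\<gamma>\<close>, each torus direction a factor \<open>\<i>\<close>, everything else is real.\<close>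
lemma volume_form_tangent:
  assumes x: "x \<in> dom"
  obtains t :: real where "t \<noteq> 0"
    "\<Omega> chart (F_map (param x)) (\<lambda>j. coord_deriv F_map lc chart (param x) (axis j 1))
      = exp (\<i> * of_real (2 * pi * (of_ivec \<gamma> \<bullet> tor x) + pi / 2 * real n)) * of_real t"
proof
  note p = pt_in_chart[OF x]
  let ?det = "det (\<chi> i j. (if j \<in> I then \<xi> x (axis j 1) else \<eta> x (axis j 1)) $ i)"
  let ?P = "\<Prod>k\<in>UNIV. (\<rho> (sl x) $ k) powi (pairing \<gamma> (B k) - 1)"
  have P: "(\<Prod>k\<in>UNIV. (snd chart (pt x) $ k) powi (pairing \<gamma> (B k) - 1)) = of_real ?P"
    by (simp add: snd_chart_pt[OF x])
  then have "?P \<noteq> 0" using volume_form_factor_nonzero[OF p] by (metis of_real_0)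
  then show "basis_det * ?P * ?det \<noteq> 0" using basis_det_nonzero F_real_tangent_basis[OF x] by simp
  have card: "card (- I) = n" using e bij_betw_same_card by fastforce
  have i_n: "\<i> ^ n = exp (\<i> * of_real (pi / 2 * real n))"
  proof -
    have "\<i> = exp (\<i> * of_real (pi / 2))" by (metis cis_pi_half cis_conv_exp)
    then have "\<i> ^ n = exp (\<i> * of_real (pi / 2)) ^ n" by simp
    also have "\<dots> = exp (of_nat n * (\<i> * of_real (pi / 2)))" by (rule exp_of_nat_mult[symmetric])
    finally show ?thesis by (simp add: mult_ac)
  qed
  have "\<Omega> chart (F_map (param x)) (\<lambda>j. coord_deriv F_map lc chart (param x) (axis j 1))
      = exp (2 * pi * \<i> * of_real (of_ivec \<gamma> \<bullet> tor x)) * (of_real basis_det * of_real ?P * (\<i> ^ n * of_real ?det))"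
    unfolding F_coord_deriv[OF x] F_map_param volume_form_torus_act[OF p] volume_form_chart[OF p] P
      dz_top_tangent[OF x] card ..
  also have "\<dots> = (exp (2 * pi * \<i> * of_real (of_ivec \<gamma> \<bullet> tor x)) * exp (\<i> * of_real (pi / 2 * real n)))
      * of_real (basis_det * ?P * ?det)"
    by (simp add: i_n mult_ac)
  also have "exp (2 * pi * \<i> * of_real (of_ivec \<gamma> \<bullet> tor x)) * exp (\<i> * of_real (pi / 2 * real n))
      = exp (\<i> * of_real (2 * pi * (of_ivec \<gamma> \<bullet> tor x) + pi / 2 * real n))"
    by (simp add: exp_add[symmetric] algebra_simps)
  finally show "\<Omega> chart (F_map (param x)) (\<lambda>j. coord_deriv F_map lc chart (param x) (axis j 1))
      = exp (\<i> * of_real (2 * pi * (of_ivec \<gamma> \<bullet> tor x) + pi / 2 * real n)) * of_real (basis_det * ?P * ?det)" .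
qed

end



context local_lagrangian
begin

definition tangent :: "real^'m \<Rightarrow> real^'m \<Rightarrow> complex^'m" where
  "tangent x h = complexify (\<xi> x h) + \<i> *s complexify (\<eta> x h)"

lemma tangent_eq: "x \<in> dom \<Longrightarrow> coord_deriv F_map lc chart (param x) h = U x * tangent x h"
  by (simp add: F_coord_deriv tangent_def)

lemma linear_tangent:
  assumes "x \<in> dom" shows "linear (tangent x)"
  unfolding tangent_def
  by (rule linearI)
    (simp_all add: linear_add[OF linear_\<xi>[OF assms]] linear_add[OF linear_\<eta>] linear_add[OF linear_complexify]
      linear_scale[OF linear_\<xi>[OF assms]] linear_scale[OF linear_\<eta>] linear_scale[OF linear_complexify]
      vec_eq_iff algebra_simps)

lemma inj_F_coord_deriv:
  assumes x: "x \<in> dom" shows "inj (coord_deriv F_map lc chart (param x))"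
proof -
  have "coord_deriv F_map lc chart (param x) = (\<lambda>h. U x * tangent x h)"
    using tangent_eq[OF x] by blast
  moreover have "linear (\<lambda>h. U x * tangent x h)"
    using linear_compose[OF linear_tangent[OF x], of "\<lambda>v. U x * v"] linear_torus_coords_mult
    by (simp add: linear_conv_bounded_linear comp_def)
  moreover have "h = 0" if "U x * tangent x h = 0" for h
  proof -
    have "tangent x h = 0"
      using that torus_coords_nonzero[OF torus_exp_nonzero] by (simp add: vec_eq_iff)
    then show "h = 0" using F_immersive[OF x] by (simp add: tangent_def)
  qed
  ultimately show ?thesis by (simp add: linear_injective_0)
qed

lemma gram_entry:
  assumes x: "x \<in> dom" and chart: "chart_at (toric_atlas \<Sigma>) (pt x) = chart"
  shows "gram_matrix (pullback2 (toric_atlas \<Sigma>) F_map g) lc x $ i $ j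
    = g chart (pt x) (tangent x (axis i 1)) (tangent x (axis j 1))"
proof -
  have "chart_at (toric_atlas \<Sigma>) (F_map (param x)) = chart"
    unfolding F_map_param chart_at_torus_act[OF torus_exp_nonzero] by (rule chart)
  then show ?thesis
    by (simp add: gram_matrix_def pullback2_def Let_def chart_inv_lc[OF dom_D[OF x]] tangent_eq[OF x])
      (simp add: F_map_param g_torus_act[OF torus_exp_in_real_torus pt_in_chart[OF x]])
qed

lemma gram_block:
  assumes x: "x \<in> dom" and chart: "chart_at (toric_atlas \<Sigma>) (pt x) = chart" and ij: "(i \<in> I) \<noteq> (j \<in> I)"
  shows "gram_matrix (pullback2 (toric_atlas \<Sigma>) F_map g) lc x $ i $ j = 0"
proof (cases "i \<in> I")
  case True
  then show ?thesis using metric_block[OF x, of i j] ij unfolding gram_entry[OF x chart] tangent_def by blast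
next
  case False
  then have "g chart (pt x) (tangent x (axis j 1)) (tangent x (axis i 1)) = 0"
    using metric_block[OF x, of j i] ij unfolding tangent_def by blast
  then show ?thesis unfolding gram_entry[OF x chart] using g_sym[OF pt_in_chart[OF x]] by simp
qed

lemma gram_invertible:
  assumes x: "x \<in> dom" and chart: "chart_at (toric_atlas \<Sigma>) (pt x) = chart"
  shows "invertible (gram_matrix (pullback2 (toric_atlas \<Sigma>) F_map g) lc x)" (is "invertible ?G")
proof -
  note bil = bilinear_g[OF pt_in_chart[OF x]]
  have "h = 0" if Gh: "?G *v h = 0" for h
  proof -
    have "tangent x h = tangent x (\<Sum>i\<in>UNIV. h $ i *\<^sub>R axis i 1)"
      using basis_expansion[of h] by (simp add: scalar_mult_eq_scaleR)
    then have t: "tangent x h = (\<Sum>i\<in>UNIV. h $ i *\<^sub>R tangent x (axis i 1))"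
      by (simp add: linear_sum[OF linear_tangent[OF x]] linear_scale[OF linear_tangent[OF x]])
    have "g chart (pt x) (tangent x h) (tangent x h)
      = (\<Sum>(i, j)\<in>UNIV \<times> UNIV. g chart (pt x) (h $ i *\<^sub>R tangent x (axis i 1)) (h $ j *\<^sub>R tangent x (axis j 1)))"
      unfolding t by (rule bilinear_sum[OF bil])
    also have "\<dots> = (\<Sum>i\<in>UNIV. \<Sum>j\<in>UNIV. h $ i * (?G $ i $ j * h $ j))"
      unfolding sum.cartesian_product[symmetric]
      by (simp add: bilinear_lmul[OF bil] bilinear_rmul[OF bil] gram_entry[OF x chart] mult_ac)
    also have "\<dots> = (\<Sum>i\<in>UNIV. h $ i * (?G *v h) $ i)"
      by (simp add: matrix_vector_mult_def sum_distrib_left)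
    also have "\<dots> = 0" using Gh by simp
    finally have "tangent x h = 0" using g_pos[OF pt_in_chart[OF x], of "tangent x h"] by fastforce
    then show "h = 0" using F_immersive[OF x] by (simp add: tangent_def)
  qed
  then have "inj ((*v) ?G)" using matrix_vector_mul_linear linear_injective_0 by blast
  then show ?thesis using invertible_left_inverse matrix_left_invertible_injective by blast
qed

lemma gram_slice:
  assumes xy: "x \<in> dom" "y \<in> dom" "sl x = sl y" and chart: "chart_at (toric_atlas \<Sigma>) (pt x) = chart"
  shows "gram_matrix (pullback2 (toric_atlas \<Sigma>) F_map g) lc x
    = gram_matrix (pullback2 (toric_atlas \<Sigma>) F_map g) lc y"
proof -
  have pt: "pt y = pt x" using xy by (simp add: pt_def)
  have "tangent x = tangent y" using xy(3) by (simp add: fun_eq_iff tangent_def \<xi>_def \<eta>_def)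
  then show ?thesis using chart xy by (simp add: vec_eq_iff gram_entry pt)
qed

end

context product_chart
begin

lemma fan: "smooth_fan \<Sigma>"
  using acy by (simp add: toric_almost_calabi_yau_def toric_kahler_def)

lemma toric_chartE:
  assumes "a \<in> toric_atlas \<Sigma>"
  obtains B B' K where "local_lagrangian \<Sigma> \<omega> g \<mu> \<kappa> \<gamma> \<Omega> n \<zeta> c I e d W B B' K"
    "a = toric_chart \<Sigma> (convex_cone hull (of_ivec ` B ` K)) B'"
proof -
  obtain B B' K where "toric_calabi_yau_chart \<Sigma> B B' K \<omega> g \<mu> \<kappa> \<gamma> \<Omega>"
    "a = toric_chart \<Sigma> (convex_cone hull (of_ivec ` B ` K)) B'"
    using toric_calabi_yau_chartE[OF acy assms] by blast
  moreover then have "local_lagrangian \<Sigma> \<omega> g \<mu> \<kappa> \<gamma> \<Omega> n \<zeta> c I e d W B B' K"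
    using product_chart_axioms by (simp add: local_lagrangian_def)
  ultimately show thesis using that by blast
qed

lemma chart_at_ptE:
  assumes x: "x \<in> D"
  obtains B B' K where "local_lagrangian \<Sigma> \<omega> g \<mu> \<kappa> \<gamma> \<Omega> n \<zeta> c I e d W B B' K"
    "chart_at (toric_atlas \<Sigma>) (pt x) = toric_chart \<Sigma> (convex_cone hull (of_ivec ` B ` K)) B'"
    "pt x \<in> fst (toric_chart \<Sigma> (convex_cone hull (of_ivec ` B ` K)) B')"
  using toric_chartE[OF chart_at_toric_atlas(1)[OF fan pt_in_toric_variety[OF x]]]
    chart_at_toric_atlas(2)[OF fan pt_in_toric_variety[OF x]] by metis

lemma chart_at_F_map: "chart_at (toric_atlas \<Sigma>) (F_map (param x)) = chart_at (toric_atlas \<Sigma>) (pt x)"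
  unfolding F_map_param by (rule chart_at_torus_act[OF torus_exp_nonzero])

lemma fst_lcE: assumes "q \<in> fst lc" obtains x where "x \<in> D" "q = param x"
  using assms by (auto simp: lc_def)

lemma F_map_smooth_in_charts:
  assumes a: "a \<in> toric_atlas \<Sigma>"
  shows "open (snd lc ` (fst lc \<inter> F_map -` fst a))"
    "smooth_on (snd lc ` (fst lc \<inter> F_map -` fst a)) (snd a \<circ> F_map \<circ> chart_inv lc)"
proof -
  obtain B B' K where "local_lagrangian \<Sigma> \<omega> g \<mu> \<kappa> \<gamma> \<Omega> n \<zeta> c I e d W B B' K"
    and eq: "a = toric_chart \<Sigma> (convex_cone hull (of_ivec ` B ` K)) B'"
    using toric_chartE[OF a] by blast
  then interpret local_lagrangian \<Sigma> \<omega> g \<mu> \<kappa> \<gamma> \<Omega> n \<zeta> c I e d W B B' K by simp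
  have "snd lc ` (fst lc \<inter> F_map -` fst a) = dom"
  proof
    show "snd lc ` (fst lc \<inter> F_map -` fst a) \<subseteq> dom"
    proof
      fix x assume "x \<in> snd lc ` (fst lc \<inter> F_map -` fst a)"
      then obtain q where q: "q \<in> fst lc" "F_map q \<in> fst a" "x = snd lc q" by blast
      obtain y where y: "y \<in> D" "q = param y" using fst_lcE[OF q(1)] .
      then have "pt y \<in> fst chart" using q(2) F_map_in_chart_iff[OF a, of y] by (simp add: eq)
      then show "x \<in> dom" using y q(3) by (simp add: dom_def snd_lc_param)
    qed
    show "dom \<subseteq> snd lc ` (fst lc \<inter> F_map -` fst a)"
    proof
      fix x assume x: "x \<in> dom"
      then have "param x \<in> fst lc \<inter> F_map -` fst a"
        using F_map_in_chart_iff[OF a, of x] by (simp add: lc_def dom_def eq)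
      then show "x \<in> snd lc ` (fst lc \<inter> F_map -` fst a)"
        by (rule image_eqI[rotated]) (simp add: snd_lc_param dom_D x)
    qed
  qed
  then show "open (snd lc ` (fst lc \<inter> F_map -` fst a))"
    "smooth_on (snd lc ` (fst lc \<inter> F_map -` fst a)) (snd a \<circ> F_map \<circ> chart_inv lc)"
    using open_dom F_smooth by (simp_all add: eq)
qed

lemma F_map_immersion_in_charts:
  assumes a: "a \<in> toric_atlas \<Sigma>" and q: "q \<in> fst lc" "F_map q \<in> fst a"
  shows "inj (coord_deriv F_map lc a q)"
proof -
  obtain x where x: "x \<in> D" "q = param x" using fst_lcE[OF q(1)] .
  obtain B B' K where "local_lagrangian \<Sigma> \<omega> g \<mu> \<kappa> \<gamma> \<Omega> n \<zeta> c I e d W B B' K"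
    and eq: "a = toric_chart \<Sigma> (convex_cone hull (of_ivec ` B ` K)) B'"
    using toric_chartE[OF a] by blast
  then interpret local_lagrangian \<Sigma> \<omega> g \<mu> \<kappa> \<gamma> \<Omega> n \<zeta> c I e d W B B' K by simp
  have "x \<in> dom" using q(2) x F_map_in_chart_iff[OF a, of x] by (simp add: dom_def eq)
  from inj_F_coord_deriv[OF this] show ?thesis by (simp add: x(2) eq)
qed

lemma F_map_lagrangian_in_charts:
  assumes q: "q \<in> fst lc"
  shows "pullback2 (toric_atlas \<Sigma>) F_map \<omega> lc q v w = 0"
proof -
  obtain x where x: "x \<in> D" "q = param x" using fst_lcE[OF q(1)] .
  obtain B B' K where "local_lagrangian \<Sigma> \<omega> g \<mu> \<kappa> \<gamma> \<Omega> n \<zeta> c I e d W B B' K"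
    and chart: "chart_at (toric_atlas \<Sigma>) (pt x) = toric_chart \<Sigma> (convex_cone hull (of_ivec ` B ` K)) B'"
    and p: "pt x \<in> fst (toric_chart \<Sigma> (convex_cone hull (of_ivec ` B ` K)) B')"
    using chart_at_ptE[OF x(1)] .
  then interpret local_lagrangian \<Sigma> \<omega> g \<mu> \<kappa> \<gamma> \<Omega> n \<zeta> c I e d W B B' K by simp
  have "x \<in> dom" using x p by (simp add: dom_def)
  then show ?thesis
    by (simp add: pullback2_def Let_def x(2) chart_at_F_map chart F_coord_deriv)
      (simp add: F_map_param \<omega>_torus_act[OF torus_exp_in_real_torus p] F_isotropic)
qed

lemma volume_form_pullback:
  assumes x: "x \<in> D"
  obtains t :: real where "t \<noteq> 0"
    "pullback_coeff (toric_atlas \<Sigma>) \<Omega> F_map lc (param x)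
      = exp (\<i> * of_real (2 * pi * (of_ivec \<gamma> \<bullet> tor x) + pi / 2 * real n)) * of_real t"
proof -
  obtain B B' K where "local_lagrangian \<Sigma> \<omega> g \<mu> \<kappa> \<gamma> \<Omega> n \<zeta> c I e d W B B' K"
    and chart: "chart_at (toric_atlas \<Sigma>) (pt x) = toric_chart \<Sigma> (convex_cone hull (of_ivec ` B ` K)) B'"
    and p: "pt x \<in> fst (toric_chart \<Sigma> (convex_cone hull (of_ivec ` B ` K)) B')"
    using chart_at_ptE[OF x] .
  then interpret local_lagrangian \<Sigma> \<omega> g \<mu> \<kappa> \<gamma> \<Omega> n \<zeta> c I e d W B B' K by simp
  have "x \<in> dom" using x p by (simp add: dom_def)
  from volume_form_tangent[OF this] show thesis
    using that by (simp add: pullback_coeff_def Let_def chart_at_F_map chart) blast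
qed

text \<open>Points of \<open>L\<close> with the same slice part are mapped to one torus orbit, so the metric and the potential at
  them can be compared in one toric chart.\<close>
lemma stationary_in_chart:
  assumes x: "x \<in> D"
  shows "weighted_laplacian (gram_matrix (pullback2 (toric_atlas \<Sigma>) F_map g) lc)
    (\<lambda>z. - real CARD('m) * acy_potential (toric_atlas \<Sigma>) \<omega> \<Omega> (F_map (chart_inv lc z)))
    (\<lambda>z. 2 * pi * (of_ivec \<gamma> \<bullet> tor z) + pi / 2 * real n) x = 0"
proof (rule weighted_laplacian_adapted_zero[OF open_D x])
  fix y assume y: "y \<in> D"
  obtain B B' K where "local_lagrangian \<Sigma> \<omega> g \<mu> \<kappa> \<gamma> \<Omega> n \<zeta> c I e d W B B' K"
    and chart: "chart_at (toric_atlas \<Sigma>) (pt y) = toric_chart \<Sigma> (convex_cone hull (of_ivec ` B ` K)) B'"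
    and p: "pt y \<in> fst (toric_chart \<Sigma> (convex_cone hull (of_ivec ` B ` K)) B')"
    using chart_at_ptE[OF y] .
  then interpret local_lagrangian \<Sigma> \<omega> g \<mu> \<kappa> \<gamma> \<Omega> n \<zeta> c I e d W B B' K by simp
  have dom: "y \<in> dom" using y p by (simp add: dom_def)
  show "invertible (gram_matrix (pullback2 (toric_atlas \<Sigma>) F_map g) lc y)"
    by (rule gram_invertible[OF dom chart])
  show "gram_matrix (pullback2 (toric_atlas \<Sigma>) F_map g) lc y $ i $ j = 0" if "(i \<in> I) \<noteq> (j \<in> I)" for i j
    by (rule gram_block[OF dom chart that])
  fix z assume z: "z \<in> D" and yz: "sl y = sl z"
  have pt: "pt z = pt y" using yz by (simp add: pt_def)
  have "z \<in> dom" using z p by (simp add: dom_def pt)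
  then show "gram_matrix (pullback2 (toric_atlas \<Sigma>) F_map g) lc y
      = gram_matrix (pullback2 (toric_atlas \<Sigma>) F_map g) lc z"
    by (rule gram_slice[OF dom _ yz chart])
  show "- real CARD('m) * acy_potential (toric_atlas \<Sigma>) \<omega> \<Omega> (F_map (chart_inv lc y))
      = - real CARD('m) * acy_potential (toric_atlas \<Sigma>) \<omega> \<Omega> (F_map (chart_inv lc z))"
    by (simp add: chart_inv_lc y z F_map_param acy_potential_torus_act[OF acy] pt)
next
  show "2 * pi * (of_ivec \<gamma> \<bullet> tor y) + pi / 2 * real n
      = (\<Sum>j\<in>-I. 2 * pi * (of_ivec \<gamma> \<bullet> of_ivec (\<zeta> (e j))) * y $ j) + pi / 2 * real n" for y
    by (simp add: tor_expand inner_sum_right sum_distrib_left mult_ac)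
qed

end

section \<open>The Lagrangian angle\<close>

lemma mod_pi_shift: "mod_pi (a + pi * of_int k) = mod_pi a"
proof -
  have "a + pi * of_int k + pi * of_int j = a + pi * of_int (k + j)"
    "a + pi * of_int j = a + pi * of_int k + pi * of_int (j - k)" for j
    by (simp_all add: algebra_simps)
  then show ?thesis unfolding mod_pi_def by blast
qed

lemma mod_pi_Arg:
  assumes "t \<noteq> 0"
  shows "mod_pi (Arg (exp (\<i> * of_real a) * of_real t)) = mod_pi a"
proof -
  define z where "z = exp (\<i> * of_real a) * of_real t"
  have "z = of_real \<bar>t\<bar> * exp (\<i> * of_real (Arg z))"
    using Arg_eq[of z] assms by (simp add: z_def norm_mult)
  then have "of_real t * exp (\<i> * of_real a) = of_real \<bar>t\<bar> * exp (\<i> * of_real (Arg z))"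
    by (simp add: z_def mult.commute)
  then have "of_real t * (exp (\<i> * of_real a) * exp (- (\<i> * of_real a)))
      = of_real \<bar>t\<bar> * (exp (\<i> * of_real (Arg z)) * exp (- (\<i> * of_real a)))"
    by (simp only: mult.assoc[symmetric])
  then have "of_real t = of_real \<bar>t\<bar> * exp (\<i> * of_real (Arg z - a))"
    by (simp add: exp_add[symmetric] algebra_simps)
  then have "of_real t = of_real \<bar>t\<bar> * cis (Arg z - a)" by (simp add: cis_conv_exp)
  then have "Im (of_real t) = Im (of_real \<bar>t\<bar> * cis (Arg z - a))" by (rule arg_cong)
  then have "sin (Arg z - a) = 0" using assms by simp
  then obtain k :: int where "Arg z - a = of_int k * pi" using sin_zero_iff_int2 by blast
  then have "Arg z = a + pi * of_int k" by (simp add: algebra_simps)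
  then show ?thesis using mod_pi_shift by (simp add: z_def)
qed

lemma mod_pi_lattice:
  assumes "v - w \<in> int_lattice"
  shows "mod_pi (2 * pi * (of_ivec \<gamma> \<bullet> v) + b) = mod_pi (2 * pi * (of_ivec \<gamma> \<bullet> w) + b)"
proof -
  obtain a where "v - w = of_ivec a" using assms by (auto simp: int_lattice_def)
  then have "v = w + of_ivec a" by (simp add: algebra_simps)
  then have "2 * pi * (of_ivec \<gamma> \<bullet> v) + b = 2 * pi * (of_ivec \<gamma> \<bullet> w) + b + pi * of_int (2 * pairing \<gamma> a)"
    by (simp add: inner_add_right inner_of_ivec_of_ivec algebra_simps)
  then show ?thesis using mod_pi_shift by metis
qed

lemma int_lattice_small:
  assumes "v \<in> int_lattice" "norm v < 1"
  shows "v = 0"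
proof -
  obtain a where a: "v = of_ivec a" using assms by (auto simp: int_lattice_def)
  have "a $ i = 0" for i
  proof -
    have "\<bar>v $ i\<bar> < 1" using component_le_norm_cart[of v i] assms(2) by linarith
    then have "real_of_int \<bar>a $ i\<bar> < 1" by (simp add: a)
    then show ?thesis by linarith
  qed
  then show ?thesis by (simp add: a vec_eq_iff)
qed

context lagrangian_setting
begin

lemma product_chartE:
  assumes "lc \<in> L"
  obtains I e d W where "product_chart \<Sigma> \<omega> g \<mu> \<kappa> \<gamma> \<Omega> n \<zeta> c I e d W"
    "lc = product_chart.lc n \<zeta> I e d W"
proof -
  obtain I e d W D where *: "slice_chart (real_form \<Sigma>) (real_form_atlas \<Sigma>) S I d" "card I = CARD('m) - n"
    "bij_betw e (-I) {..<n}" "open W"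
    "\<forall>x\<in>W. \<forall>y\<in>W. torus_part \<zeta> I e x - torus_part \<zeta> I e y \<in> int_lattice \<longrightarrow>
       torus_part \<zeta> I e x = torus_part \<zeta> I e y"
    "D = {x \<in> W. slice_part I x \<in> chart_image d}"
    "lc = (product_param n \<zeta> I e d ` D, inv_into D (product_param n \<zeta> I e d))"
    using assms unfolding product_atlas_def by blast
  then have pc: "product_chart \<Sigma> \<omega> g \<mu> \<kappa> \<gamma> \<Omega> n \<zeta> c I e d W"
    using lagrangian_setting_axioms by (simp add: product_chart_def product_chart_axioms_def)
  then have "lc = product_chart.lc n \<zeta> I e d W"
    using * by (simp add: product_chart.lc_def product_chart.D_def)
  then show thesis using that pc by blast
qed

lemma V_coordinates:
  assumes e: "bij_betw e (-I) {..<n}" and v: "v \<in> V"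
  obtains x where "torus_part \<zeta> I e x = v" "\<And>j. j \<in> I \<Longrightarrow> x $ j = y $ j"
proof -
  have V: "V = span ((\<lambda>j. of_ivec (\<zeta> (e j))) ` (-I))"
    using e by (simp add: V_span_def bij_betw_def image_image[symmetric, of "\<lambda>i. of_ivec (\<zeta> i)" e])
  have "\<exists>x. torus_part \<zeta> I e x = v" using v unfolding V
  proof (induction rule: span_induct_alt)
    case base
    show ?case using linear_0[OF linear_torus_part] by blast
  next
    case (step r b w)
    then obtain x j where x: "torus_part \<zeta> I e x = w" and j: "j \<notin> I" "b = of_ivec (\<zeta> (e j))" by auto
    have "torus_part \<zeta> I e (axis j 1) = (\<Sum>i\<in>-I. if i = j then of_ivec (\<zeta> (e j)) else 0)"
      unfolding torus_part_def by (intro sum.cong) (auto simp: axis_def)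
    then have "torus_part \<zeta> I e (axis j 1) = b" using j by simp
    then have "torus_part \<zeta> I e (r *\<^sub>R axis j 1 + x) = r *\<^sub>R b + w"
      by (simp add: linear_add[OF linear_torus_part] linear_scale[OF linear_torus_part] x)
    then show ?case by blast
  qed
  then obtain x where "torus_part \<zeta> I e x = v" by blast
  then have "torus_part \<zeta> I e (\<chi> j. if j \<in> I then y $ j else x $ j) = v"
    by (simp add: torus_part_def)
  then show thesis by (rule that) simp
qed

lemma L_covers:
  assumes sub: "submanifold (real_form \<Sigma>) (real_form_atlas \<Sigma>) (CARD('m) - n) S"
    and p: "p \<in> S" and v: "v \<in> V"
  obtains I e d W x where "product_chart \<Sigma> \<omega> g \<mu> \<kappa> \<gamma> \<Omega> n \<zeta> c I e d W"
    "x \<in> product_chart.D I d W" "product_param n \<zeta> I e d x = (p, T_class V v)"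
proof -
  obtain I d where I: "card I = CARD('m) - n" and d: "slice_chart (real_form \<Sigma>) (real_form_atlas \<Sigma>) S I d"
    and pd: "p \<in> fst d" using sub p unfolding submanifold_def by blast
  have "card (-I) = card {..<n}" using I n_le by (simp add: Compl_eq_Diff_UNIV card_Diff_subset)
  then obtain e where e: "bij_betw e (-I) {..<n}"
    using finite_same_card_bij[of "-I" "{..<n}"] by auto
  \<comment> \<open>Torus parts differ by less than \<open>1\<close> on \<open>W\<close>, and no nonzero lattice vector is that short.\<close>
  define W where "W = {x. norm (torus_part \<zeta> I e x - v) < 1 / 2}"
  have "continuous_on UNIV (\<lambda>x. norm (torus_part \<zeta> I e x - v))"
    using linear_torus_part[of \<zeta> I e]
    by (intro continuous_intros linear_continuous_on) (simp add: linear_conv_bounded_linear)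
  then have "open W" unfolding W_def by (intro open_Collect_less) auto
  moreover have "torus_part \<zeta> I e x = torus_part \<zeta> I e y"
    if "x \<in> W" "y \<in> W" "torus_part \<zeta> I e x - torus_part \<zeta> I e y \<in> int_lattice" for x y
  proof -
    have "norm (torus_part \<zeta> I e x - torus_part \<zeta> I e y) < 1"
      using that(1,2) norm_triangle_ineq4[of "torus_part \<zeta> I e x - v" "torus_part \<zeta> I e y - v"]
      unfolding W_def by simp
    then show ?thesis using int_lattice_small[OF that(3)] by simp
  qed
  ultimately have pc: "product_chart \<Sigma> \<omega> g \<mu> \<kappa> \<gamma> \<Omega> n \<zeta> c I e d W"
    using lagrangian_setting_axioms I d e by (simp add: product_chart_def product_chart_axioms_def)
  then interpret product_chart \<Sigma> \<omega> g \<mu> \<kappa> \<gamma> \<Omega> n \<zeta> c I e d W .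
  obtain x where x: "tor x = v" "\<And>j. j \<in> I \<Longrightarrow> x $ j = snd d p $ j"
    using V_coordinates[OF e v, of "snd d p"] by blast
  have "snd d p $ j = 0" if "j \<notin> I" for j
  proof -
    have "snd d p \<in> snd d ` (fst d \<inter> S)" using pd p by blast
    then show ?thesis using d that unfolding slice_chart_def by simp
  qed
  then have sl: "sl x = snd d p" using x(2) by (auto simp: slice_part_def vec_eq_iff)
  have "x \<in> D" unfolding D_def using pd by (simp add: sl chart_image_def W_def x(1))
  moreover have "param x = (p, T_class V v)"
    using inj_on_d pd by (simp add: param_eq pt_def sl x(1) chart_inv_def)
  ultimately show thesis using that pc by blast
qed

lemma lagrangian_angle_eq:
  assumes sub: "submanifold (real_form \<Sigma>) (real_form_atlas \<Sigma>) (CARD('m) - n) S"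
    and p: "p \<in> S" and v: "v \<in> V"
  shows "lagrangian_angle L (toric_atlas \<Sigma>) \<Omega> F_map (p, T_class V v) =
    mod_pi (2 * pi * (of_ivec \<gamma> \<bullet> v) + pi / 2 * real n)" (is "_ = ?angle")
proof -
  let ?q = "(p, T_class V v)"
  have angle: "pullback_coeff (toric_atlas \<Sigma>) \<Omega> F_map lc ?q \<noteq> 0 \<and>
      mod_pi (Arg (pullback_coeff (toric_atlas \<Sigma>) \<Omega> F_map lc ?q)) = ?angle"
    if lc: "lc \<in> L" "?q \<in> fst lc" for lc
  proof -
    obtain I e d W where pc: "product_chart \<Sigma> \<omega> g \<mu> \<kappa> \<gamma> \<Omega> n \<zeta> c I e d W"
      and eq: "lc = product_chart.lc n \<zeta> I e d W" using product_chartE[OF lc(1)] .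
    interpret C: product_chart \<Sigma> \<omega> g \<mu> \<kappa> \<gamma> \<Omega> n \<zeta> c I e d W by (rule pc)
    obtain x where x: "x \<in> C.D" "?q = C.param x" using C.fst_lcE lc(2) eq by blast
    then have "T_class V (C.tor x) = T_class V v" by (simp add: C.param_eq)
    then have lattice: "C.tor x - v \<in> int_lattice" by (rule T_class_eqD[OF subspace_V_span])
    obtain t :: real where "t \<noteq> 0" and coeff: "pullback_coeff (toric_atlas \<Sigma>) \<Omega> F_map C.lc (C.param x)
      = exp (\<i> * of_real (2 * pi * (of_ivec \<gamma> \<bullet> C.tor x) + pi / 2 * real n)) * of_real t"
      using C.volume_form_pullback[OF x(1)] .
    then show ?thesis
      unfolding eq x(2) coeff mod_pi_Arg[OF \<open>t \<noteq> 0\<close>] using mod_pi_lattice[OF lattice] by simp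
  qed
  obtain I e d W x where pc: "product_chart \<Sigma> \<omega> g \<mu> \<kappa> \<gamma> \<Omega> n \<zeta> c I e d W"
    and x: "x \<in> product_chart.D I d W" "product_param n \<zeta> I e d x = ?q"
    using L_covers[OF sub p v] .
  interpret C: product_chart \<Sigma> \<omega> g \<mu> \<kappa> \<gamma> \<Omega> n \<zeta> c I e d W by (rule pc)
  have q: "?q \<in> fst C.lc" using x by (auto simp: C.lc_def intro!: image_eqI[of _ _ x])
  have "{mod_pi (Arg (pullback_coeff (toric_atlas \<Sigma>) \<Omega> F_map lc ?q)) | lc.
      lc \<in> L \<and> ?q \<in> fst lc \<and> pullback_coeff (toric_atlas \<Sigma>) \<Omega> F_map lc ?q \<noteq> 0} = {?angle}" (is "?angles = _")
  proof
    show "?angles \<subseteq> {?angle}" using angle by blast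
    show "{?angle} \<subseteq> ?angles" using angle[OF C.lc_in_L q] C.lc_in_L q by (intro subsetI CollectI exI[of _ C.lc]) simp
  qed
  then show ?thesis unfolding lagrangian_angle_def by simp
qed

lemma F_map_lagrangian_immersion: "lagrangian_immersion L (toric_atlas \<Sigma>) \<omega> F_map"
proof -
  have "(\<forall>a\<in>toric_atlas \<Sigma>. open (snd lc ` (fst lc \<inter> F_map -` fst a)) \<and>
        smooth_on (snd lc ` (fst lc \<inter> F_map -` fst a)) (snd a \<circ> F_map \<circ> chart_inv lc)) \<and>
     (\<forall>a\<in>toric_atlas \<Sigma>. \<forall>q\<in>fst lc. F_map q \<in> fst a \<longrightarrow> inj (coord_deriv F_map lc a q)) \<and>
     (\<forall>q\<in>fst lc. \<forall>v w. pullback2 (toric_atlas \<Sigma>) F_map \<omega> lc q v w = 0)" if lc: "lc \<in> L" for lc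
  proof -
    obtain I e d W where pc: "product_chart \<Sigma> \<omega> g \<mu> \<kappa> \<gamma> \<Omega> n \<zeta> c I e d W"
      and eq: "lc = product_chart.lc n \<zeta> I e d W" using product_chartE[OF lc(1)] .
    interpret C: product_chart \<Sigma> \<omega> g \<mu> \<kappa> \<gamma> \<Omega> n \<zeta> c I e d W by (rule pc)
    show ?thesis
      using C.F_map_smooth_in_charts C.F_map_immersion_in_charts C.F_map_lagrangian_in_charts eq by simp
  qed
  then show ?thesis unfolding lagrangian_immersion_def smooth_map_def by blast
qed

lemma F_map_torus_invariant: "torus_invariant V S F_map"
  unfolding torus_invariant_def
proof (intro conjI ballI)
  have act: "F_map (p, T_class V (w + v)) = torus_act (torus_exp v) (F_map (p, T_class V w))" for p v w
    by (simp add: F_map_T_class[OF subspace_V_span] torus_act_mult torus_exp_add mult.commute)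
  then show "F_map (p, T_class V (w + v)) = torus_act (torus_exp v) (F_map (p, T_class V w))" for p v w .
  fix v assume v: "v \<in> V"
  show "torus_act (torus_exp v) ` F_map ` (S \<times> T_quot V) = F_map ` (S \<times> T_quot V)"
  proof
    show "torus_act (torus_exp v) ` F_map ` (S \<times> T_quot V) \<subseteq> F_map ` (S \<times> T_quot V)"
    proof
      fix y assume "y \<in> torus_act (torus_exp v) ` F_map ` (S \<times> T_quot V)"
      then obtain p w where "p \<in> S" "w \<in> V" "y = torus_act (torus_exp v) (F_map (p, T_class V w))"
        by (auto simp: T_quot_def)
      moreover have "w + v \<in> V" using v \<open>w \<in> V\<close> subspace_add[OF subspace_V_span] by blast
      ultimately show "y \<in> F_map ` (S \<times> T_quot V)" by (auto simp: act[symmetric] T_quot_def)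
    qed
    show "F_map ` (S \<times> T_quot V) \<subseteq> torus_act (torus_exp v) ` F_map ` (S \<times> T_quot V)"
    proof
      fix y assume "y \<in> F_map ` (S \<times> T_quot V)"
      then obtain p w where pw: "p \<in> S" "w \<in> V" "y = F_map (p, T_class V w)" by (auto simp: T_quot_def)
      then have "y = torus_act (torus_exp v) (F_map (p, T_class V (w - v)))"
        using act[of p "w - v" v] by simp
      moreover have "w - v \<in> V" using v pw subspace_diff[OF subspace_V_span] by blast
      ultimately show "y \<in> torus_act (torus_exp v) ` F_map ` (S \<times> T_quot V)"
        using pw by (auto simp: T_quot_def)
    qed
  qed
qed

lemma F_map_weighted_hamiltonian_stationary:
  assumes sub: "submanifold (real_form \<Sigma>) (real_form_atlas \<Sigma>) (CARD('m) - n) S"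
  shows "weighted_hamiltonian_stationary L (toric_atlas \<Sigma>) g \<omega> \<Omega> F_map"
  unfolding weighted_hamiltonian_stationary_def
proof (intro ballI)
  fix lc x assume lc: "lc \<in> L" and x: "x \<in> chart_image lc"
  obtain I e d W where pc: "product_chart \<Sigma> \<omega> g \<mu> \<kappa> \<gamma> \<Omega> n \<zeta> c I e d W"
    and eq: "lc = product_chart.lc n \<zeta> I e d W" using product_chartE[OF lc(1)] .
  interpret C: product_chart \<Sigma> \<omega> g \<mu> \<kappa> \<gamma> \<Omega> n \<zeta> c I e d W by (rule pc)
  define u where "u = (\<lambda>z. 2 * pi * (of_ivec \<gamma> \<bullet> C.tor z) + pi / 2 * real n)"
  have "linear (\<lambda>z. 2 * pi * (of_ivec \<gamma> \<bullet> C.tor z))"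
    by (rule linearI)
      (simp_all add: linear_add[OF linear_torus_part] linear_scale[OF linear_torus_part] inner_add_right algebra_simps)
  then have "smooth_on C.D u" unfolding smooth_on_def u_def
    by (intro allI Ck_on_add[OF C.open_D] Ck_on_bounded_linear Ck_on_const) (simp add: linear_conv_bounded_linear)
  moreover have "u y \<in> lagrangian_angle L (toric_atlas \<Sigma>) \<Omega> F_map (chart_inv lc y)" if "y \<in> C.D" for y
  proof -
    have "u y \<in> mod_pi (u y)" unfolding mod_pi_def by (auto intro: exI[of _ 0])
    then show ?thesis
      using lagrangian_angle_eq[OF sub C.pt_in_S[OF that] C.tor_in_V]
      by (simp add: eq C.chart_inv_lc[OF that] C.param_eq u_def)
  qed
  moreover have "weighted_laplacian (gram_matrix (pullback2 (toric_atlas \<Sigma>) F_map g) lc)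
      (\<lambda>z. - real CARD('m) * acy_potential (toric_atlas \<Sigma>) \<omega> \<Omega> (F_map (chart_inv lc z))) u y = 0"
    if "y \<in> C.D" for y
    using C.stationary_in_chart[OF that] by (simp only: eq u_def)
  ultimately show "\<exists>W u. open W \<and> x \<in> W \<and> W \<subseteq> chart_image lc \<and> smooth_on W u \<and>
      (\<forall>y\<in>W. u y \<in> lagrangian_angle L (toric_atlas \<Sigma>) \<Omega> F_map (chart_inv lc y)) \<and>
      (\<forall>y\<in>W. weighted_laplacian (gram_matrix (pullback2 (toric_atlas \<Sigma>) F_map g) lc)
        (\<lambda>z. - real CARD('m) * acy_potential (toric_atlas \<Sigma>) \<omega> \<Omega> (F_map (chart_inv lc z))) u y = 0)"
    using C.open_D x C.chart_image_lc eq by (intro exI[of _ C.D] exI[of _ u]) auto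
qed

end


theorem theorem1:
  fixes \<Sigma> :: "(real^'m) set set"
    and \<omega> g :: "('m tpoint, complex^'m) tensor2"
    and \<mu> :: "'m tpoint \<Rightarrow> real^'m"
    and \<kappa> :: "int^'m \<Rightarrow> real"
    and \<gamma> :: "int^'m"
    and \<Omega> :: "('m tpoint, 'm) top_form"
    and n :: nat
    and \<zeta> :: "nat \<Rightarrow> int^'m"
    and c :: "nat \<Rightarrow> real"
  defines "M \<equiv> toric_atlas \<Sigma>"
    and "\<Delta> \<equiv> moment_polytope \<Sigma> \<mu>"
    and "V \<equiv> V_span n \<zeta>"
    and "S \<equiv> real_level \<Sigma> \<mu> n \<zeta> c"
    and "L \<equiv> product_atlas (real_form \<Sigma>) (real_form_atlas \<Sigma>) (real_level \<Sigma> \<mu> n \<zeta> c) n \<zeta>"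
  assumes "toric_almost_calabi_yau \<Sigma> \<omega> g \<mu> \<kappa> \<gamma> \<Omega>"
    and "n \<le> CARD('m)"
    and "inj_on \<zeta> {..<n}"
    and "independent ((\<lambda>i. of_ivec (\<zeta> i)) ` {..<n})"
    and "\<exists>y\<in>interior \<Delta>. \<forall>i<n. y \<bullet> of_ivec (\<zeta> i) = c i"
    and "\<forall>y\<in>\<Delta>. (\<forall>i<n. y \<bullet> of_ivec (\<zeta> i) = c i) \<longrightarrow> regular_point \<Sigma> \<kappa> V y"
    and "submanifold (real_form \<Sigma>) (real_form_atlas \<Sigma>) (CARD('m) - n) S"
    and "T_quot_iso_subtorus n V"
  shows "lagrangian_immersion L M \<omega> F_map \<and>
    (\<forall>p\<in>S. \<forall>v\<in>V. lagrangian_angle L M \<Omega> F_map (p, T_class V v) =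
        mod_pi (2 * pi * (of_ivec \<gamma> \<bullet> v) + pi / 2 * real n)) \<and>
    torus_invariant V S F_map \<and>
    weighted_hamiltonian_stationary L M g \<omega> \<Omega> F_map"
proof -
  interpret lagrangian_setting \<Sigma> \<omega> g \<mu> \<kappa> \<gamma> \<Omega> n \<zeta> c
    using assms(6-11) by unfold_locales (simp_all add: \<Delta>_def V_def)
  note sub = assms(12)[unfolded S_def]
  show ?thesis
    unfolding M_def V_def S_def L_def
    using F_map_lagrangian_immersion lagrangian_angle_eq[OF sub] F_map_torus_invariant
      F_map_weighted_hamiltonian_stationary[OF sub] by blast
qed


end
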